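(* Let $A=\mathbb{K}Q/J^2$ be a radical square zero algebra, where $Q$ has $n$ vertices. Then $\phi\dim(A)\le n$.
   Context: $\mathbb{K}$ is a field, $Q$ is a finite connected quiver, $J$ is the ideal of $\mathbb{K}Q$ generated by the arrows. Modules are finitely generated right modules. $K_0(A)$ is the abelian group generated by symbols $[M]$, one for each isomorphism class of finitely generated $A$-modules, modulo the relations $[M]-[M']-[M'']$ whenever $M\cong M'\oplus M''$ and $[P]$ for each projective $P$. The syzygy $\Omega$ induces a group endomorphism $\overline{\Omega}:K_0(A)\to K_0(A)$. For a module $M$, $\langle \mathrm{add}\, M\rangle$ is the subgroup of $K_0(A)$ generated by the classes of the indecomposable direct summands of $M$, and $\phi(M)=\min\{l\in\mathbb{N}: \overline{\Omega}|_{\overline{\Omega}^{l+s}\langle \mathrm{add}\, M\rangle}\text{ is injective for all } s\in\mathbb{N}\}$ ($0\in\mathbb{N}$). $\phi\dim(A)=\sup\{\phi(M): M\in \mathrm{mod}\,A\}$. *)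

theory Defs
  imports
    "HOL-Algebra.Free_Abelian_Groups"
    "HOL-Algebra.Ideal_Product"
    "HOL-Algebra.QuotRing"
    "HOL-Library.Extended_Nat"
    "Graph_Theory.Arc_Walk"
    "Graph_Theory.Digraph_Component"
begin

section \<open>Path algebras and their radical square zero quotients\<close>

text \<open>
  A quiver is a \<^typ>\<open>('v, 'e) pre_digraph\<close>; loops and parallel arrows are allowed.
  A path is a triple (source, list of arrows, target), which keeps the trivial paths
  at different vertices apart. Paths are written from left to right: the product
  \<open>p q\<close> is nonzero if and only if the target of \<open>p\<close> is the source of \<open>q\<close>.
\<close>

type_synonym ('v, 'e) path = "'v \<times> 'e list \<times> 'v"

definition quiver_paths :: "('v, 'e) pre_digraph \<Rightarrow> ('v, 'e) path set" where
  "quiver_paths Q = {(u, p, v). pre_digraph.awalk Q u p v}"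

definition path_mult ::
  "(('v, 'e) path \<Rightarrow>\<^sub>0 'k::field) \<Rightarrow> (('v, 'e) path \<Rightarrow>\<^sub>0 'k) \<Rightarrow> (('v, 'e) path \<Rightarrow>\<^sub>0 'k)" where
  "path_mult f g =
     (\<Sum>(u, p, v)\<in>Poly_Mapping.keys f. \<Sum>(v', q, w)\<in>Poly_Mapping.keys g.
        if v = v' then
          Poly_Mapping.single (u, p @ q, w)
            (Poly_Mapping.lookup f (u, p, v) * Poly_Mapping.lookup g (v', q, w))
        else 0)"

definition path_algebra :: "('v, 'e) pre_digraph \<Rightarrow> (('v, 'e) path \<Rightarrow>\<^sub>0 'k::field) ring" where
  "path_algebra Q =
     \<lparr>carrier = {f. Poly_Mapping.keys f \<subseteq> quiver_paths Q},
      monoid.mult = path_mult,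
      one = (\<Sum>v\<in>verts Q. Poly_Mapping.single (v, [], v) 1),
      zero = 0,
      add = (+)\<rparr>"

definition arrow_ideal :: "('v, 'e) pre_digraph \<Rightarrow> (('v, 'e) path \<Rightarrow>\<^sub>0 'k::field) set" where
  "arrow_ideal Q =
     Idl\<^bsub>path_algebra Q\<^esub> {Poly_Mapping.single (tail Q e, [e], head Q e) 1 | e. e \<in> arcs Q}"

definition radical_square_zero_algebra ::
  "('v, 'e) pre_digraph \<Rightarrow> (('v, 'e) path \<Rightarrow>\<^sub>0 'k::field) set ring" where
  "radical_square_zero_algebra Q =
     path_algebra Q Quot (arrow_ideal Q \<cdot>\<^bsub>path_algebra Q\<^esub> arrow_ideal Q)"


section \<open>Right modules over a not necessarily commutative ring\<close>

text \<open>
  Only the additive part of the underlying ring record is used; its fields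
  \<^term>\<open>one\<close> and \<^term>\<open>monoid.mult\<close> carry no information.
\<close>

record ('a, 'm) rmod = "'m ring" +
  ract :: "'m \<Rightarrow> 'a \<Rightarrow> 'm" (infixl \<open>\<triangleleft>\<index>\<close> 70)

locale right_module = A?: ring A + M?: abelian_group M
  for A :: "('a, 'b) ring_scheme" and M :: "('a, 'm, 'c) rmod_scheme" +
  assumes ract_closed:
      "\<lbrakk>x \<in> carrier M; a \<in> carrier A\<rbrakk> \<Longrightarrow> x \<triangleleft>\<^bsub>M\<^esub> a \<in> carrier M"
    and ract_add_left:
      "\<lbrakk>x \<in> carrier M; y \<in> carrier M; a \<in> carrier A\<rbrakk> \<Longrightarrow>
        (x \<oplus>\<^bsub>M\<^esub> y) \<triangleleft>\<^bsub>M\<^esub> a = (x \<triangleleft>\<^bsub>M\<^esub> a) \<oplus>\<^bsub>M\<^esub> (y \<triangleleft>\<^bsub>M\<^esub> a)"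
    and ract_add_right:
      "\<lbrakk>x \<in> carrier M; a \<in> carrier A; b \<in> carrier A\<rbrakk> \<Longrightarrow>
        x \<triangleleft>\<^bsub>M\<^esub> (a \<oplus>\<^bsub>A\<^esub> b) = (x \<triangleleft>\<^bsub>M\<^esub> a) \<oplus>\<^bsub>M\<^esub> (x \<triangleleft>\<^bsub>M\<^esub> b)"
    and ract_mult:
      "\<lbrakk>x \<in> carrier M; a \<in> carrier A; b \<in> carrier A\<rbrakk> \<Longrightarrow>
        x \<triangleleft>\<^bsub>M\<^esub> (a \<otimes>\<^bsub>A\<^esub> b) = (x \<triangleleft>\<^bsub>M\<^esub> a) \<triangleleft>\<^bsub>M\<^esub> b"
    and ract_one:
      "x \<in> carrier M \<Longrightarrow> x \<triangleleft>\<^bsub>M\<^esub> \<one>\<^bsub>A\<^esub> = x"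

definition rsubmodule :: "('a, 'b) ring_scheme \<Rightarrow> ('a, 'm) rmod \<Rightarrow> 'm set \<Rightarrow> bool" where
  "rsubmodule A M N \<longleftrightarrow>
     additive_subgroup N M \<and> (\<forall>x\<in>N. \<forall>a\<in>carrier A. x \<triangleleft>\<^bsub>M\<^esub> a \<in> N)"

definition rmod_hom ::
  "('a, 'b) ring_scheme \<Rightarrow> ('a, 'm) rmod \<Rightarrow> ('a, 'n) rmod \<Rightarrow> ('m \<Rightarrow> 'n) set" where
  "rmod_hom A M N =
     {f \<in> carrier M \<rightarrow> carrier N.
        (\<forall>x\<in>carrier M. \<forall>y\<in>carrier M. f (x \<oplus>\<^bsub>M\<^esub> y) = f x \<oplus>\<^bsub>N\<^esub> f y) \<and>
        (\<forall>x\<in>carrier M. \<forall>a\<in>carrier A. f (x \<triangleleft>\<^bsub>M\<^esub> a) = f x \<triangleleft>\<^bsub>N\<^esub> a)}"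

definition rmod_iso ::
  "('a, 'b) ring_scheme \<Rightarrow> ('a, 'm) rmod \<Rightarrow> ('a, 'n) rmod \<Rightarrow> bool" where
  "rmod_iso A M N \<longleftrightarrow> (\<exists>f\<in>rmod_hom A M N. bij_betw f (carrier M) (carrier N))"

definition rmod_sum ::
  "('a, 'm) rmod \<Rightarrow> ('a, 'n) rmod \<Rightarrow> ('a, 'm \<times> 'n) rmod" where
  "rmod_sum M N =
     \<lparr>carrier = carrier M \<times> carrier N,
      monoid.mult = undefined,
      one = undefined,
      zero = (\<zero>\<^bsub>M\<^esub>, \<zero>\<^bsub>N\<^esub>),
      add = (\<lambda>(x, y) (x', y'). (x \<oplus>\<^bsub>M\<^esub> x', y \<oplus>\<^bsub>N\<^esub> y')),
      ract = (\<lambda>(x, y) a. (x \<triangleleft>\<^bsub>M\<^esub> a, y \<triangleleft>\<^bsub>N\<^esub> a))\<rparr>"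

definition finitely_generated :: "('a, 'b) ring_scheme \<Rightarrow> ('a, 'm) rmod \<Rightarrow> bool" where
  "finitely_generated A M \<longleftrightarrow>
     (\<exists>S. finite S \<and> S \<subseteq> carrier M \<and>
        (\<forall>N. rsubmodule A M N \<and> S \<subseteq> N \<longrightarrow> N = carrier M))"

text \<open>
  Isomorphism classes need a fixed carrier type. A finitely generated right \<open>A\<close>-module is
  isomorphic to a quotient \<open>A\<^sup>n/U\<close>, whose elements are cosets, that is, sets of vectors over
  \<open>A\<close>. Hence the type \<^typ>\<open>(nat \<Rightarrow> 'a) set\<close> contains a copy of every such module
  and, as singletons, of every \<open>A\<^sup>n\<close>.
\<close>

type_synonym 'a std_rmod = "('a, (nat \<Rightarrow> 'a) set) rmod"

definition fgmod :: "('a, 'b) ring_scheme \<Rightarrow> 'a std_rmod set" where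
  "fgmod A = {M. right_module A M \<and> finitely_generated A M}"

text \<open>
  It makes no difference for a finitely generated \<open>P\<close> that the test modules \<open>M\<close> and \<open>N\<close>
  have the fixed carrier type: the surjections from the modules \<open>A\<^sup>n\<close> to \<open>P\<close> are among the test
  maps.
\<close>

definition projective :: "('a, 'b) ring_scheme \<Rightarrow> 'a std_rmod \<Rightarrow> bool" where
  "projective A P \<longleftrightarrow>
     right_module A P \<and>
     (\<forall>(M :: 'a std_rmod) (N :: 'a std_rmod). \<forall>f\<in>rmod_hom A M N. \<forall>g\<in>rmod_hom A P N.
        right_module A M \<and> right_module A N \<and> f ` carrier M = carrier N \<longrightarrow>
        (\<exists>h\<in>rmod_hom A P M. \<forall>x\<in>carrier P. f (h x) = g x))"

definition superfluous :: "('a, 'b) ring_scheme \<Rightarrow> ('a, 'm) rmod \<Rightarrow> 'm set \<Rightarrow> bool" where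
  "superfluous A M K \<longleftrightarrow>
     rsubmodule A M K \<and>
     (\<forall>N. rsubmodule A M N \<and> N <+>\<^bsub>M\<^esub> K = carrier M \<longrightarrow> N = carrier M)"

definition projective_cover ::
  "('a, 'b) ring_scheme \<Rightarrow> 'a std_rmod \<Rightarrow> 'a std_rmod \<Rightarrow> ((nat \<Rightarrow> 'a) set \<Rightarrow> (nat \<Rightarrow> 'a) set) \<Rightarrow> bool"
  where
  "projective_cover A M P p \<longleftrightarrow>
     P \<in> fgmod A \<and> projective A P \<and>
     p \<in> rmod_hom A P M \<and> p ` carrier P = carrier M \<and>
     superfluous A P (a_kernel P M p)"

definition is_syzygy :: "('a, 'b) ring_scheme \<Rightarrow> 'a std_rmod \<Rightarrow> 'a std_rmod \<Rightarrow> bool" where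
  "is_syzygy A M N \<longleftrightarrow>
     (\<exists>P p. projective_cover A M P p \<and> rmod_iso A N (P\<lparr>carrier := a_kernel P M p\<rparr>))"

definition indecomposable :: "('a, 'b) ring_scheme \<Rightarrow> 'a std_rmod \<Rightarrow> bool" where
  "indecomposable A M \<longleftrightarrow>
     carrier M \<noteq> {\<zero>\<^bsub>M\<^esub>} \<and>
     (\<forall>X\<in>fgmod A. \<forall>Y\<in>fgmod A. rmod_iso A M (rmod_sum X Y) \<longrightarrow>
        carrier X = {\<zero>\<^bsub>X\<^esub>} \<or> carrier Y = {\<zero>\<^bsub>Y\<^esub>})"

definition direct_summand :: "('a, 'b) ring_scheme \<Rightarrow> 'a std_rmod \<Rightarrow> 'a std_rmod \<Rightarrow> bool" where
  "direct_summand A M X \<longleftrightarrow>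
     X \<in> fgmod A \<and> (\<exists>Y\<in>fgmod A. rmod_iso A M (rmod_sum X Y))"


section \<open>The group \<open>K\<^sub>0(A)\<close> and the Igusa-Todorov function \<open>\<phi>\<close>\<close>

definition iso_class :: "('a, 'b) ring_scheme \<Rightarrow> 'a std_rmod \<Rightarrow> 'a std_rmod set" where
  "iso_class A M = {N \<in> fgmod A. rmod_iso A M N}"

definition K0_free :: "('a, 'b) ring_scheme \<Rightarrow> ('a std_rmod set \<Rightarrow>\<^sub>0 int) monoid" where
  "K0_free A = free_Abelian_group (iso_class A ` fgmod A)"

definition K0_relations :: "('a, 'b) ring_scheme \<Rightarrow> ('a std_rmod set \<Rightarrow>\<^sub>0 int) set" where
  "K0_relations A =
     {frag_of (iso_class A M) - frag_of (iso_class A M') - frag_of (iso_class A M'') | M M' M''.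
        M \<in> fgmod A \<and> M' \<in> fgmod A \<and> M'' \<in> fgmod A \<and> rmod_iso A M (rmod_sum M' M'')} \<union>
     {frag_of (iso_class A P) | P. P \<in> fgmod A \<and> projective A P}"

definition K0 :: "('a, 'b) ring_scheme \<Rightarrow> ('a std_rmod set \<Rightarrow>\<^sub>0 int) set monoid" where
  "K0 A = K0_free A Mod generate (K0_free A) (K0_relations A)"

definition K0_class ::
  "('a, 'b) ring_scheme \<Rightarrow> 'a std_rmod \<Rightarrow> ('a std_rmod set \<Rightarrow>\<^sub>0 int) set" where
  "K0_class A M =
     generate (K0_free A) (K0_relations A) #>\<^bsub>K0_free A\<^esub> frag_of (iso_class A M)"

text \<open>
  The endomorphism of \<open>K\<^sub>0(A)\<close> with \<open>[M] \<mapsto> [\<Omega> M]\<close>. Over a finite-dimensional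
  algebra it exists and is unique, the classes \<open>[M]\<close> being generators; extensionality
  fixes its values outside the carrier.
\<close>

definition Omega_bar ::
  "('a, 'b) ring_scheme \<Rightarrow>
     ('a std_rmod set \<Rightarrow>\<^sub>0 int) set \<Rightarrow> ('a std_rmod set \<Rightarrow>\<^sub>0 int) set" where
  "Omega_bar A =
     (THE h. h \<in> hom (K0 A) (K0 A) \<and> h \<in> extensional (carrier (K0 A)) \<and>
        (\<forall>M\<in>fgmod A. \<forall>N\<in>fgmod A. is_syzygy A M N \<longrightarrow> h (K0_class A M) = K0_class A N))"

definition add_subgroup ::
  "('a, 'b) ring_scheme \<Rightarrow> 'a std_rmod \<Rightarrow> ('a std_rmod set \<Rightarrow>\<^sub>0 int) set set" where
  "add_subgroup A M =
     generate (K0 A) {K0_class A X | X. indecomposable A X \<and> direct_summand A M X}"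

text \<open>
  In \<^typ>\<open>enat\<close>, the infimum is the minimum if the set is nonempty and \<open>\<infinity>\<close> otherwise.
\<close>

definition igusa_todorov_phi :: "('a, 'b) ring_scheme \<Rightarrow> 'a std_rmod \<Rightarrow> enat" where
  "igusa_todorov_phi A M =
     Inf {enat l | l. \<forall>s. inj_on (Omega_bar A) ((Omega_bar A ^^ (l + s)) ` add_subgroup A M)}"

definition phi_dim :: "('a, 'b) ring_scheme \<Rightarrow> enat" where
  "phi_dim A = (SUP M\<in>fgmod A. igusa_todorov_phi A M)"

end

theory Submission
  imports Defs "Jordan_Normal_Form.Missing_VectorSpace"
begin

text \<open>
  A syzygy \<open>\<Omega> M\<close> lies in the radical of a projective module, hence is semisimple because \<open>J\<^sup>2 = 0\<close>.
  So the image of \<open>\<Omega>\<close> on \<open>K\<^sub>0\<close> lies in the subgroup spanned by the classes of the simple modules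
  \<open>S\<^bsub>v\<^esub>\<close>. This subgroup is free on the classes with \<open>v\<close> not a sink, and \<open>\<Omega>\<close> acts on it by the adjacency
  matrix \<open>T\<close> of the quiver. Kernels of powers of an \<open>r \<times> r\<close> matrix are stable from the exponent \<open>r\<close> on. If
  there is a sink, then \<open>r < n\<close>; if there is none, then \<open>T\<close> is nonnegative with nonzero rows, hence not
  nilpotent, and the kernels are already stable from \<open>n - 1\<close> on. In both cases one more application
  of \<open>\<Omega>\<close>, to reach the simple classes, gives the bound \<open>n\<close>.
\<close>

section \<open>Dimension of subspaces\<close>

text \<open>The delicate point is a single unit. Stability of the kernels from exponent n on, plus
  the one application of the syzygy operator that reaches the simple classes, would only give n + 1;
  the case distinction on sinks saves that unit. The other obstacle is that K_0(A) is given by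
  generators and relations over all finitely generated modules, so neither the operator nor the
  independence of the simple classes is visible. Both come from integer invariants that are additive
  on direct sums and vanish on projectives, hence factor through K_0(A). The entries of the
  dimension vector of a syzygy are such invariants, because a projective cover has the same top as
  the module it covers; as a syzygy is semisimple, they determine its class, whichever cover is
  chosen. For v not a sink, the dimension at v of the annihilator of J minus that of the radical is
  another one; it is 1 on the simple module at v and 0 on the other simple modules. A sink has a
  projective simple module, of class zero. Injectivity is proved on the iterated images of all of
  K_0(A), which makes the bound uniform in the module.\<close>

context vectorspace
begin

definition sdim :: "'c set \<Rightarrow> nat" where
  "sdim X = vectorspace.dim K (V\<lparr>carrier := X\<rparr>)"

lemma subspaceI:
  assumes "X \<subseteq> carrier V" "\<zero>\<^bsub>V\<^esub> \<in> X" "\<And>x y. x \<in> X \<Longrightarrow> y \<in> X \<Longrightarrow> x \<oplus>\<^bsub>V\<^esub> y \<in> X"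
    "\<And>c x. c \<in> carrier K \<Longrightarrow> x \<in> X \<Longrightarrow> c \<odot>\<^bsub>V\<^esub> x \<in> X"
  shows "subspace K X V"
  unfolding subspace_def submodule_def
  using assms vectorspace_axioms module_axioms by blast

lemma subspaceD:
  assumes "subspace K X V"
  shows "X \<subseteq> carrier V" "\<zero>\<^bsub>V\<^esub> \<in> X" "\<And>x y. x \<in> X \<Longrightarrow> y \<in> X \<Longrightarrow> x \<oplus>\<^bsub>V\<^esub> y \<in> X"
    "\<And>c x. c \<in> carrier K \<Longrightarrow> x \<in> X \<Longrightarrow> c \<odot>\<^bsub>V\<^esub> x \<in> X"
  using assms unfolding subspace_def submodule_def by auto

text \<open>Independent subsets of \<open>X\<close> have at most \<open>dim\<close> elements, so a
  maximal one exists. Span and independence mean the same in \<open>X\<close> and in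
  \<open>V\<close>, hence it is a basis of \<open>X\<close> and an independent set of
  \<open>V\<close> at once.\<close>

lemma subspace_basis:
  assumes fd: "fin_dim" and X: "subspace K X V"
  obtains B where "finite B" "B \<subseteq> X" "lin_indpt B" "span B = X" "sdim X = card B"
    "vectorspace.basis K (V\<lparr>carrier := X\<rparr>) B"
proof -
  interpret X: vectorspace K "V\<lparr>carrier := X\<rparr>"
    by (rule subspace_is_vs[OF X])
  have sm: "submodule K X V" and XV: "X \<subseteq> carrier V" using X subspaceD(1) by auto
  have dep: "\<And>S. S \<subseteq> X \<Longrightarrow> X.lin_dep S = lin_dep S" "\<And>S. S \<subseteq> X \<Longrightarrow> X.span S = span S"
    using span_li_not_depend[OF _ sm] by auto
  have "\<exists>A. finite A \<and> maximal A (\<lambda>S. S \<subseteq> X \<and> X.lin_indpt S)"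
  proof (rule maximal_exists[where N = dim and B = "{}"])
    fix S assume S: "S \<subseteq> X \<and> X.lin_indpt S"
    then have "S \<subseteq> carrier V" "lin_indpt S" using dep(1)[of S] XV by auto
    then show "finite S \<and> card S \<le> dim" using li_le_dim[OF fd] by blast
  qed (simp add: X.lin_dep_def)
  then obtain B where B: "finite B" "maximal B (\<lambda>S. S \<subseteq> carrier (V\<lparr>carrier := X\<rparr>) \<and> X.lin_indpt S)"
    by auto
  have bas: "X.basis B" by (rule X.max_li_is_basis[OF B(2)])
  have BX: "B \<subseteq> X" using bas by (auto simp: X.basis_def)
  show thesis
  proof (rule that[OF B(1) BX])
    show "lin_indpt B" using bas dep(1)[OF BX] by (auto simp: X.basis_def)
    show "span B = X" using bas dep(2)[OF BX] by (auto simp: X.basis_def)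
    show "sdim X = card B" unfolding sdim_def by (rule X.dim_basis[OF B(1) bas])
    show "X.basis B" by (rule bas)
  qed
qed

lemma sdim_span:
  assumes "finite B" "B \<subseteq> carrier V" "lin_indpt B"
  shows "sdim (span B) = card B"
proof -
  have X: "subspace K (span B) V" using assms span_is_subspace by auto
  interpret X: vectorspace K "V\<lparr>carrier := span B\<rparr>"
    by (rule subspace_is_vs[OF X])
  have sm: "submodule K (span B) V" using X by auto
  have BX: "B \<subseteq> span B" using in_own_span assms by auto
  have "X.basis B" using span_li_not_depend[OF BX sm] BX assms by (auto simp: X.basis_def)
  then show ?thesis unfolding sdim_def using X.dim_basis assms by auto
qed

lemma subspace_fin_dim:
  assumes fd: "fin_dim" and X: "subspace K X V"
  shows "vectorspace.fin_dim K (V\<lparr>carrier := X\<rparr>)"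
proof -
  interpret X: vectorspace K "V\<lparr>carrier := X\<rparr>"
    by (rule subspace_is_vs[OF X])
  obtain B where "finite B" "X.basis B" using subspace_basis[OF fd X] by metis
  then show ?thesis unfolding X.fin_dim_def X.basis_def by auto
qed

lemma subspace_sum_line:
  assumes R: "subspace K R V" and x: "x \<in> carrier V"
  shows "subspace K {r \<oplus>\<^bsub>V\<^esub> c \<odot>\<^bsub>V\<^esub> x | r c. r \<in> R \<and> c \<in> carrier K} V"
proof (rule subspaceI)
  note Rd = subspaceD[OF R]
  show "{r \<oplus>\<^bsub>V\<^esub> c \<odot>\<^bsub>V\<^esub> x | r c. r \<in> R \<and> c \<in> carrier K} \<subseteq> carrier V"
    using Rd(1) x by auto
  have "\<zero>\<^bsub>V\<^esub> = \<zero>\<^bsub>V\<^esub> \<oplus>\<^bsub>V\<^esub> \<zero>\<^bsub>K\<^esub> \<odot>\<^bsub>V\<^esub> x" using x by auto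
  then show "\<zero>\<^bsub>V\<^esub> \<in> {r \<oplus>\<^bsub>V\<^esub> c \<odot>\<^bsub>V\<^esub> x | r c. r \<in> R \<and> c \<in> carrier K}" using Rd(2) by blast
next
  fix a b assume "a \<in> {r \<oplus>\<^bsub>V\<^esub> c \<odot>\<^bsub>V\<^esub> x | r c. r \<in> R \<and> c \<in> carrier K}" "b \<in> {r \<oplus>\<^bsub>V\<^esub> c \<odot>\<^bsub>V\<^esub> x | r c. r \<in> R \<and> c \<in> carrier K}"
  then obtain r c s d where *: "a = r \<oplus>\<^bsub>V\<^esub> c \<odot>\<^bsub>V\<^esub> x" "b = s \<oplus>\<^bsub>V\<^esub> d \<odot>\<^bsub>V\<^esub> x" "r \<in> R" "s \<in> R" "c \<in> carrier K" "d \<in> carrier K" by auto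
  have "a \<oplus>\<^bsub>V\<^esub> b = (r \<oplus>\<^bsub>V\<^esub> s) \<oplus>\<^bsub>V\<^esub> (c \<oplus>\<^bsub>K\<^esub> d) \<odot>\<^bsub>V\<^esub> x"
    using * x subspaceD(1)[OF R] by (simp add: smult_l_distr subset_iff a_ac)
  then show "a \<oplus>\<^bsub>V\<^esub> b \<in> {r \<oplus>\<^bsub>V\<^esub> c \<odot>\<^bsub>V\<^esub> x | r c. r \<in> R \<and> c \<in> carrier K}"
    using * subspaceD(3)[OF R] by blast
next
  fix e a assume e: "e \<in> carrier K" and "a \<in> {r \<oplus>\<^bsub>V\<^esub> c \<odot>\<^bsub>V\<^esub> x | r c. r \<in> R \<and> c \<in> carrier K}"
  then obtain r c where *: "a = r \<oplus>\<^bsub>V\<^esub> c \<odot>\<^bsub>V\<^esub> x" "r \<in> R" "c \<in> carrier K" by auto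
  have "e \<odot>\<^bsub>V\<^esub> a = e \<odot>\<^bsub>V\<^esub> r \<oplus>\<^bsub>V\<^esub> (e \<otimes>\<^bsub>K\<^esub> c) \<odot>\<^bsub>V\<^esub> x"
    using * e x subspaceD(1)[OF R] by (simp add: smult_r_distr smult_assoc1 subset_iff)
  then show "e \<odot>\<^bsub>V\<^esub> a \<in> {r \<oplus>\<^bsub>V\<^esub> c \<odot>\<^bsub>V\<^esub> x | r c. r \<in> R \<and> c \<in> carrier K}"
    using * e subspaceD(4)[OF R] by blast
qed

text \<open>A basis of \<open>R\<close> stays independent when \<open>x\<close> joins it, because
  \<open>x\<close> lies outside its span. Later dimension counts enlarge a subspace by one vector at
  a time through this lemma.\<close>

lemma sdim_sum_line:
  assumes fd: "fin_dim" and R: "subspace K R V" and x: "x \<in> carrier V" "x \<notin> R"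
  shows "sdim {r \<oplus>\<^bsub>V\<^esub> c \<odot>\<^bsub>V\<^esub> x | r c. r \<in> R \<and> c \<in> carrier K} = Suc (sdim R)"
proof -
  let ?S = "{r \<oplus>\<^bsub>V\<^esub> c \<odot>\<^bsub>V\<^esub> x | r c. r \<in> R \<and> c \<in> carrier K}"
  obtain B where B: "finite B" "B \<subseteq> R" "lin_indpt B" "span B = R" "sdim R = card B"
    using subspace_basis[OF fd R] by metis
  have BV: "B \<subseteq> carrier V" using B(2) subspaceD(1)[OF R] by auto
  have xB: "x \<notin> B" using x B(2) by auto
  have li: "lin_indpt (B \<union> {x})" using lin_dep_iff_in_span[OF BV B(3) x(1) xB] B(4) x(2) by auto
  have "span (B \<union> {x}) = ?S"
  proof
    have S: "submodule K ?S V" using subspace_sum_line[OF R x(1)] by auto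
    have "r \<in> ?S" if "r \<in> R" for r
    proof -
      have "r = r \<oplus>\<^bsub>V\<^esub> \<zero>\<^bsub>K\<^esub> \<odot>\<^bsub>V\<^esub> x" using that x subspaceD(1)[OF R] by auto
      then show ?thesis using that by blast
    qed
    moreover have "x = \<zero>\<^bsub>V\<^esub> \<oplus>\<^bsub>V\<^esub> \<one>\<^bsub>K\<^esub> \<odot>\<^bsub>V\<^esub> x" using x by auto
    then have "x \<in> ?S" using subspaceD(2)[OF R] by blast
    ultimately show "span (B \<union> {x}) \<subseteq> ?S" by (intro span_is_subset S) (use B(2) in auto)
    have sp: "subspace K (span (B \<union> {x})) V" using BV x by (intro span_is_subspace) auto
    have "R \<subseteq> span (B \<union> {x})" using B(4) span_is_monotone[of B "B \<union> {x}"] by auto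
    moreover have "x \<in> span (B \<union> {x})" using in_own_span[of "B \<union> {x}"] BV x by auto
    ultimately show "?S \<subseteq> span (B \<union> {x})" using subspaceD(3,4)[OF sp] by blast
  qed
  then show ?thesis using sdim_span[of "B \<union> {x}"] li B BV x xB by auto
qed

lemma sdim_mono:
  assumes fd: "fin_dim" and X: "subspace K X V" and Y: "subspace K Y V" and XY: "X \<subseteq> Y"
  shows "sdim X \<le> sdim Y"
proof -
  interpret Y: vectorspace K "V\<lparr>carrier := Y\<rparr>"
    by (rule subspace_is_vs[OF Y])
  obtain B where B: "finite B" "B \<subseteq> X" "lin_indpt B" "span B = X" "sdim X = card B"
    using subspace_basis[OF fd X] by metis
  have sm: "submodule K Y V" using Y by auto
  have BY: "B \<subseteq> Y" using B XY by auto
  have "Y.lin_indpt B" using span_li_not_depend(2)[OF BY sm] B by auto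
  then show ?thesis
    using Y.li_le_dim(2)[of B] subspace_fin_dim[OF fd Y] BY B by (auto simp: sdim_def)
qed

text \<open>A vector of \<open>Y\<close> outside \<open>X\<close> would yield a subspace of
  \<open>Y\<close> whose dimension exceeds that of \<open>X\<close> by one.\<close>

lemma sdim_eq_imp_eq:
  assumes fd: "fin_dim" and X: "subspace K X V" and Y: "subspace K Y V" and XY: "X \<subseteq> Y"
    and eq: "sdim X = sdim Y"
  shows "X = Y"
proof (rule ccontr)
  assume "X \<noteq> Y"
  then obtain y where y: "y \<in> Y" "y \<notin> X" using XY by auto
  have yV: "y \<in> carrier V" using y subspaceD(1)[OF Y] by auto
  have "sdim {r \<oplus>\<^bsub>V\<^esub> c \<odot>\<^bsub>V\<^esub> y | r c. r \<in> X \<and> c \<in> carrier K} \<le> sdim Y"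
    by (rule sdim_mono[OF fd subspace_sum_line[OF X yV] Y]) (use XY y subspaceD[OF Y] in blast)
  then show False using sdim_sum_line[OF fd X yV y(2)] eq by auto
qed

lemma sdim_zero: "sdim {\<zero>\<^bsub>V\<^esub>} = 0"
  using sdim_span[of "{}"] by (auto simp: span_empty lin_dep_def)

lemma sdim_line:
  assumes fd: "fin_dim" and x: "x \<in> carrier V" "x \<noteq> \<zero>\<^bsub>V\<^esub>"
  shows "sdim {c \<odot>\<^bsub>V\<^esub> x | c. c \<in> carrier K} = 1"
proof -
  have "subspace K {\<zero>\<^bsub>V\<^esub>} V" by (rule subspaceI) auto
  from sdim_sum_line[OF fd this x(1)] x sdim_zero
  have "sdim {\<zero>\<^bsub>V\<^esub> \<oplus>\<^bsub>V\<^esub> c \<odot>\<^bsub>V\<^esub> x | c. c \<in> carrier K} = 1" by auto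
  moreover have "{\<zero>\<^bsub>V\<^esub> \<oplus>\<^bsub>V\<^esub> c \<odot>\<^bsub>V\<^esub> x | c. c \<in> carrier K} = {c \<odot>\<^bsub>V\<^esub> x | c. c \<in> carrier K}"
    using x by (intro Collect_cong ex_cong1) auto
  ultimately show ?thesis by simp
qed

text \<open>Among the subspaces between \<open>R\<close> and \<open>X\<close> that avoid
  \<open>x\<close>, one of maximal dimension is a hyperplane: for \<open>y\<close> outside
  \<open>H\<close>, the larger space H + K y must contain \<open>x\<close>, and the resulting
  relation can be solved for \<open>y\<close>.\<close>

lemma hyperplane_exists:
  assumes fd: "fin_dim" and R: "subspace K R V" and X: "subspace K X V" and RX: "R \<subseteq> X"
    and x: "x \<in> X" "x \<notin> R"
  obtains H where "subspace K H V" "R \<subseteq> H" "H \<subseteq> X" "x \<notin> H"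
    "\<And>y. y \<in> X \<Longrightarrow> \<exists>h\<in>H. \<exists>c\<in>carrier K. y = h \<oplus>\<^bsub>V\<^esub> c \<odot>\<^bsub>V\<^esub> x"
proof -
  let ?P = "\<lambda>H. subspace K H V \<and> R \<subseteq> H \<and> H \<subseteq> X \<and> x \<notin> H"
  have PR: "?P R" using assms by auto
  have bd: "\<forall>H. ?P H \<longrightarrow> sdim H < Suc (sdim X)"
    using sdim_mono[OF fd _ X] by (auto simp: less_Suc_eq_le)
  obtain H where H: "?P H" and max: "\<And>H'. ?P H' \<Longrightarrow> sdim H' \<le> sdim H"
    using ex_has_greatest_nat[of ?P, OF PR bd] by blast
  have XV: "X \<subseteq> carrier V" using subspaceD(1)[OF X] .
  show thesis
  proof (rule that[of H])
    fix y assume y: "y \<in> X"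
    show "\<exists>h\<in>H. \<exists>c\<in>carrier K. y = h \<oplus>\<^bsub>V\<^esub> c \<odot>\<^bsub>V\<^esub> x"
    proof (cases "y \<in> H")
      case True
      then have "y = y \<oplus>\<^bsub>V\<^esub> \<zero>\<^bsub>K\<^esub> \<odot>\<^bsub>V\<^esub> x" using x XV y by (simp add: subset_iff)
      then show ?thesis using True by blast
    next
      case False
      let ?S = "{r \<oplus>\<^bsub>V\<^esub> c \<odot>\<^bsub>V\<^esub> y | r c. r \<in> H \<and> c \<in> carrier K}"
      have HS: "H \<subseteq> ?S"
      proof
        fix h assume h: "h \<in> H"
        have "h \<in> carrier V" "y \<in> carrier V" using h y XV H by blast+
        then have "h = h \<oplus>\<^bsub>V\<^esub> \<zero>\<^bsub>K\<^esub> \<odot>\<^bsub>V\<^esub> y" by simp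
        with h show "h \<in> ?S" by blast
      qed
      have S: "subspace K ?S V" using subspace_sum_line H y XV by blast
      have dS: "sdim ?S = Suc (sdim H)" using sdim_sum_line[OF fd _ _ False] H y XV by blast
      have "?S \<subseteq> X" using H y subspaceD[OF X] by blast
      moreover have "R \<subseteq> ?S" using HS H by (meson subset_trans)
      moreover have "\<not> ?P ?S" using max[of ?S] dS by (metis Suc_n_not_le_n)
      ultimately have "x \<in> ?S" using S by blast
      then obtain h c where hc: "x = h \<oplus>\<^bsub>V\<^esub> c \<odot>\<^bsub>V\<^esub> y" "h \<in> H" "c \<in> carrier K" by auto
      have HV: "h \<in> carrier V" "y \<in> carrier V" "x \<in> carrier V" using hc(2) H XV y x(1) by blast+
      \<comment> \<open>Since \<open>x\<close> is not in \<open>H\<close>, the coefficient of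
        \<open>y\<close> in this expression of \<open>x\<close> cannot vanish.\<close>
      have c0: "c \<noteq> \<zero>\<^bsub>K\<^esub>"
      proof
        assume "c = \<zero>\<^bsub>K\<^esub>"
        then have "x = h \<oplus>\<^bsub>V\<^esub> \<zero>\<^bsub>K\<^esub> \<odot>\<^bsub>V\<^esub> y" using hc(1) by simp
        then have "x = h" using HV(1,2) by (metis M.r_zero smult_l_null)
        then show False using hc(2) H by blast
      qed
      define d where "d = inv\<^bsub>K\<^esub> c"
      have d: "d \<in> carrier K" "d \<otimes>\<^bsub>K\<^esub> c = \<one>\<^bsub>K\<^esub>"
        using c0 hc(3) by (auto simp: d_def field_Units)
      have "d \<odot>\<^bsub>V\<^esub> x = d \<odot>\<^bsub>V\<^esub> h \<oplus>\<^bsub>V\<^esub> (d \<otimes>\<^bsub>K\<^esub> c) \<odot>\<^bsub>V\<^esub> y"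
        using hc HV d(1) by (simp add: smult_r_distr smult_assoc1)
      then have "d \<odot>\<^bsub>V\<^esub> x = d \<odot>\<^bsub>V\<^esub> h \<oplus>\<^bsub>V\<^esub> y" using d HV by auto
      then have "y = \<ominus>\<^bsub>V\<^esub> (d \<odot>\<^bsub>V\<^esub> h) \<oplus>\<^bsub>V\<^esub> d \<odot>\<^bsub>V\<^esub> x"
        using HV d by (simp add: r_neg1)
      moreover have "\<ominus>\<^bsub>V\<^esub> (d \<odot>\<^bsub>V\<^esub> h) = (\<ominus>\<^bsub>K\<^esub> d) \<odot>\<^bsub>V\<^esub> h" using d HV by (simp add: smult_l_minus)
      ultimately show ?thesis using H hc(2) d subspaceD(4) by (metis R.a_inv_closed)
    qed
  qed (use H in auto)
qed

end

context linear_map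
begin

lemma sdim_image_kernel:
  assumes fd: "V.fin_dim" and X: "subspace K X V"
  shows "V.sdim X = W.sdim (T ` X) + V.sdim {x \<in> X. T x = \<zero>\<^bsub>W\<^esub>}"
proof -
  interpret X: vectorspace K "V\<lparr>carrier := X\<rparr>"
    by (rule V.subspace_is_vs[OF X])
  have XV: "X \<subseteq> carrier V" using V.subspaceD(1)[OF X] .
  interpret TX: linear_map K "V\<lparr>carrier := X\<rparr>" W T
    using XV T_add T_smult
    by unfold_locales (auto simp: module_hom_def subset_iff)
  from TX.rank_nullity[OF V.subspace_fin_dim[OF fd X]]
  show ?thesis by (simp add: V.sdim_def W.sdim_def X.sdim_def TX.im_def TX.ker_def)
qed

end

section \<open>Right modules\<close>

context right_module
begin

lemma ract_zero_left [simp]: "a \<in> carrier A \<Longrightarrow> \<zero>\<^bsub>M\<^esub> \<triangleleft>\<^bsub>M\<^esub> a = \<zero>\<^bsub>M\<^esub>"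
  using ract_add_left[of "\<zero>\<^bsub>M\<^esub>" "\<zero>\<^bsub>M\<^esub>" a] ract_closed[of "\<zero>\<^bsub>M\<^esub>" a]
  by (metis M.l_zero M.zero_closed M.add.r_cancel_one')

lemma ract_zero_right [simp]: "x \<in> carrier M \<Longrightarrow> x \<triangleleft>\<^bsub>M\<^esub> \<zero>\<^bsub>A\<^esub> = \<zero>\<^bsub>M\<^esub>"
  using ract_add_right[of x "\<zero>\<^bsub>A\<^esub>" "\<zero>\<^bsub>A\<^esub>"] ract_closed[of x "\<zero>\<^bsub>A\<^esub>"]
  by (metis A.l_zero A.zero_closed M.add.r_cancel_one')

lemma ract_minus_one: "x \<in> carrier M \<Longrightarrow> x \<triangleleft>\<^bsub>M\<^esub> (\<ominus>\<^bsub>A\<^esub> \<one>\<^bsub>A\<^esub>) = \<ominus>\<^bsub>M\<^esub> x"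
  using ract_add_right[of x "\<one>\<^bsub>A\<^esub>" "\<ominus>\<^bsub>A\<^esub> \<one>\<^bsub>A\<^esub>"] ract_closed[of x "\<ominus>\<^bsub>A\<^esub> \<one>\<^bsub>A\<^esub>"] ract_one[of x]
  by (metis A.a_inv_closed A.one_closed A.r_neg M.minus_equality M.a_comm ract_zero_right)

lemma ract_finsum_left:
  assumes "f \<in> I \<rightarrow> carrier M" "a \<in> carrier A"
  shows "finsum M f I \<triangleleft>\<^bsub>M\<^esub> a = finsum M (\<lambda>i. f i \<triangleleft>\<^bsub>M\<^esub> a) I"
  using assms
proof (induct I rule: infinite_finite_induct)
  case (insert i I)
  then have "f \<in> I \<rightarrow> carrier M" "f i \<in> carrier M" by auto
  with insert show ?case
    by (simp add: M.finsum_insert ract_add_left ract_closed Pi_iff)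
qed simp_all

lemma ract_finsum_right:
  assumes "f \<in> I \<rightarrow> carrier A" "x \<in> carrier M"
  shows "x \<triangleleft>\<^bsub>M\<^esub> finsum A f I = finsum M (\<lambda>i. x \<triangleleft>\<^bsub>M\<^esub> f i) I"
  using assms
proof (induct I rule: infinite_finite_induct)
  case (insert i I)
  then have "f \<in> I \<rightarrow> carrier A" "f i \<in> carrier A" by auto
  with insert show ?case
    by (simp add: M.finsum_insert A.finsum_insert ract_add_right ract_closed Pi_iff)
qed simp_all

end

lemma rsubmoduleI:
  assumes M: "right_module A M"
    and X: "X \<subseteq> carrier M" "\<zero>\<^bsub>M\<^esub> \<in> X" "\<And>x y. x \<in> X \<Longrightarrow> y \<in> X \<Longrightarrow> x \<oplus>\<^bsub>M\<^esub> y \<in> X"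
    and act: "\<And>x a. x \<in> X \<Longrightarrow> a \<in> carrier A \<Longrightarrow> x \<triangleleft>\<^bsub>M\<^esub> a \<in> X"
  shows "rsubmodule A M X"
proof -
  interpret M: right_module A M by fact
  have "\<ominus>\<^bsub>M\<^esub> x \<in> X" if "x \<in> X" for x
    using act[OF that, of "\<ominus>\<^bsub>A\<^esub> \<one>\<^bsub>A\<^esub>"] M.ract_minus_one[of x] that X(1) by auto
  then have "subgroup X (add_monoid M)"
    using X by (intro M.add.subgroupI) (auto simp: a_inv_def)
  then show ?thesis
    using act by (auto simp: rsubmodule_def additive_subgroup_def)
qed

lemma rsubmodule_carrier:
  assumes "right_module A M"
  shows "rsubmodule A M (carrier M)"
proof -
  interpret M: right_module A M by fact
  show ?thesis by (rule rsubmoduleI[OF assms]) (auto simp: M.ract_closed)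
qed

lemma rsubmodule_zero:
  assumes "right_module A M"
  shows "rsubmodule A M {\<zero>\<^bsub>M\<^esub>}"
proof -
  interpret M: right_module A M by fact
  show ?thesis by (rule rsubmoduleI[OF assms]) auto
qed

lemma rsubmoduleD:
  assumes "rsubmodule A M X"
  shows "X \<subseteq> carrier M" "\<zero>\<^bsub>M\<^esub> \<in> X" "\<And>x y. x \<in> X \<Longrightarrow> y \<in> X \<Longrightarrow> x \<oplus>\<^bsub>M\<^esub> y \<in> X"
    "\<And>x a. x \<in> X \<Longrightarrow> a \<in> carrier A \<Longrightarrow> x \<triangleleft>\<^bsub>M\<^esub> a \<in> X"
  using assms
  by (auto simp: rsubmodule_def additive_subgroup_def subgroup_def)

lemma right_moduleI:
  assumes "ring A" "abelian_group M"
    and "\<And>x a. \<lbrakk>x \<in> carrier M; a \<in> carrier A\<rbrakk> \<Longrightarrow> x \<triangleleft>\<^bsub>M\<^esub> a \<in> carrier M"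
    and "\<And>x y a. \<lbrakk>x \<in> carrier M; y \<in> carrier M; a \<in> carrier A\<rbrakk> \<Longrightarrow>
        (x \<oplus>\<^bsub>M\<^esub> y) \<triangleleft>\<^bsub>M\<^esub> a = (x \<triangleleft>\<^bsub>M\<^esub> a) \<oplus>\<^bsub>M\<^esub> (y \<triangleleft>\<^bsub>M\<^esub> a)"
    and "\<And>x a b. \<lbrakk>x \<in> carrier M; a \<in> carrier A; b \<in> carrier A\<rbrakk> \<Longrightarrow>
        x \<triangleleft>\<^bsub>M\<^esub> (a \<oplus>\<^bsub>A\<^esub> b) = (x \<triangleleft>\<^bsub>M\<^esub> a) \<oplus>\<^bsub>M\<^esub> (x \<triangleleft>\<^bsub>M\<^esub> b)"
    and "\<And>x a b. \<lbrakk>x \<in> carrier M; a \<in> carrier A; b \<in> carrier A\<rbrakk> \<Longrightarrow>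
        x \<triangleleft>\<^bsub>M\<^esub> (a \<otimes>\<^bsub>A\<^esub> b) = (x \<triangleleft>\<^bsub>M\<^esub> a) \<triangleleft>\<^bsub>M\<^esub> b"
    and "\<And>x. x \<in> carrier M \<Longrightarrow> x \<triangleleft>\<^bsub>M\<^esub> \<one>\<^bsub>A\<^esub> = x"
  shows "right_module A M"
  using assms by (auto simp: right_module_def right_module_axioms_def)

lemma rsubmodule_right_module:
  assumes M: "right_module A M" and X: "rsubmodule A M X"
  shows "right_module A (M\<lparr>carrier := X\<rparr>)"
proof (rule right_moduleI)
  interpret right_module A M by fact
  note Xd = rsubmoduleD[OF X]
  show "ring A" ..
  have neg: "\<ominus>\<^bsub>M\<^esub> x \<in> X" if "x \<in> X" for x
    using Xd(1) Xd(4)[of x "\<ominus>\<^bsub>A\<^esub> \<one>\<^bsub>A\<^esub>"] ract_minus_one[of x] that by auto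
  show "abelian_group (M\<lparr>carrier := X\<rparr>)"
  proof (rule abelian_groupI)
    fix x assume x: "x \<in> carrier (M\<lparr>carrier := X\<rparr>)"
    then show "\<exists>y\<in>carrier (M\<lparr>carrier := X\<rparr>). y \<oplus>\<^bsub>M\<lparr>carrier := X\<rparr>\<^esub> x = \<zero>\<^bsub>M\<lparr>carrier := X\<rparr>\<^esub>"
      using neg[of x] Xd(1) by (auto intro!: bexI[of _ "\<ominus>\<^bsub>M\<^esub> x"] simp: M.l_neg subset_iff)
  qed (use Xd in \<open>auto simp: subset_iff M.a_ac\<close>)
next
  interpret right_module A M by fact
  note Xd = rsubmoduleD[OF X]
  show "\<And>x a b. \<lbrakk>x \<in> carrier (M\<lparr>carrier := X\<rparr>); a \<in> carrier A; b \<in> carrier A\<rbrakk> \<Longrightarrow>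
        x \<triangleleft>\<^bsub>M\<lparr>carrier := X\<rparr>\<^esub> (a \<otimes>\<^bsub>A\<^esub> b) = (x \<triangleleft>\<^bsub>M\<lparr>carrier := X\<rparr>\<^esub> a) \<triangleleft>\<^bsub>M\<lparr>carrier := X\<rparr>\<^esub> b"
    using Xd ract_mult by (auto simp: subset_iff)
  show "\<And>x a b. \<lbrakk>x \<in> carrier (M\<lparr>carrier := X\<rparr>); a \<in> carrier A; b \<in> carrier A\<rbrakk> \<Longrightarrow>
        x \<triangleleft>\<^bsub>M\<lparr>carrier := X\<rparr>\<^esub> (a \<oplus>\<^bsub>A\<^esub> b) = (x \<triangleleft>\<^bsub>M\<lparr>carrier := X\<rparr>\<^esub> a) \<oplus>\<^bsub>M\<lparr>carrier := X\<rparr>\<^esub> (x \<triangleleft>\<^bsub>M\<lparr>carrier := X\<rparr>\<^esub> b)"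
    using Xd ract_add_right by (auto simp: subset_iff)
  show "\<And>x y a. \<lbrakk>x \<in> carrier (M\<lparr>carrier := X\<rparr>); y \<in> carrier (M\<lparr>carrier := X\<rparr>); a \<in> carrier A\<rbrakk> \<Longrightarrow>
        (x \<oplus>\<^bsub>M\<lparr>carrier := X\<rparr>\<^esub> y) \<triangleleft>\<^bsub>M\<lparr>carrier := X\<rparr>\<^esub> a = (x \<triangleleft>\<^bsub>M\<lparr>carrier := X\<rparr>\<^esub> a) \<oplus>\<^bsub>M\<lparr>carrier := X\<rparr>\<^esub> (y \<triangleleft>\<^bsub>M\<lparr>carrier := X\<rparr>\<^esub> a)"
    using Xd ract_add_left by (auto simp: subset_iff)
  show "\<And>x. x \<in> carrier (M\<lparr>carrier := X\<rparr>) \<Longrightarrow> x \<triangleleft>\<^bsub>M\<lparr>carrier := X\<rparr>\<^esub> \<one>\<^bsub>A\<^esub> = x"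
    using Xd ract_one by (auto simp: subset_iff)
qed (use rsubmoduleD[OF X] in auto)

lemma rsubmodule_finsum:
  assumes M: "right_module A M" and X: "rsubmodule A M X" and f: "f \<in> I \<rightarrow> X"
  shows "finsum M f I \<in> X"
proof -
  interpret M: right_module A M by fact
  note Xd = rsubmoduleD[OF X]
  show ?thesis using f
  proof (induct I rule: infinite_finite_induct)
    case (insert i I)
    then have "f \<in> I \<rightarrow> carrier M" "f i \<in> carrier M" using Xd(1) by auto
    with insert Xd show ?case by (simp add: M.finsum_insert Pi_iff)
  qed (use Xd in auto)
qed

section \<open>Homomorphisms, isomorphisms and direct sums of right modules\<close>

lemma rmod_homI:
  assumes "\<And>x. x \<in> carrier M \<Longrightarrow> f x \<in> carrier N"
    "\<And>x y. x \<in> carrier M \<Longrightarrow> y \<in> carrier M \<Longrightarrow> f (x \<oplus>\<^bsub>M\<^esub> y) = f x \<oplus>\<^bsub>N\<^esub> f y"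
    "\<And>x a. x \<in> carrier M \<Longrightarrow> a \<in> carrier A \<Longrightarrow> f (x \<triangleleft>\<^bsub>M\<^esub> a) = f x \<triangleleft>\<^bsub>N\<^esub> a"
  shows "f \<in> rmod_hom A M N"
  using assms by (auto simp: rmod_hom_def)

lemma rmod_homD:
  assumes "f \<in> rmod_hom A M N"
  shows "\<And>x. x \<in> carrier M \<Longrightarrow> f x \<in> carrier N"
    "\<And>x y. x \<in> carrier M \<Longrightarrow> y \<in> carrier M \<Longrightarrow> f (x \<oplus>\<^bsub>M\<^esub> y) = f x \<oplus>\<^bsub>N\<^esub> f y"
    "\<And>x a. x \<in> carrier M \<Longrightarrow> a \<in> carrier A \<Longrightarrow> f (x \<triangleleft>\<^bsub>M\<^esub> a) = f x \<triangleleft>\<^bsub>N\<^esub> a"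
  using assms by (auto simp: rmod_hom_def)

lemma rmod_hom_zero:
  assumes "abelian_group M" "abelian_group N" "f \<in> rmod_hom A M N"
  shows "f \<zero>\<^bsub>M\<^esub> = \<zero>\<^bsub>N\<^esub>"
proof -
  interpret M: abelian_group M by fact
  interpret N: abelian_group N by fact
  have "f \<zero>\<^bsub>M\<^esub> \<oplus>\<^bsub>N\<^esub> f \<zero>\<^bsub>M\<^esub> = f \<zero>\<^bsub>M\<^esub>"
    using rmod_homD(2)[OF assms(3), of "\<zero>\<^bsub>M\<^esub>" "\<zero>\<^bsub>M\<^esub>"] by simp
  then show ?thesis
    using rmod_homD(1)[OF assms(3) M.zero_closed] by (metis N.add.r_cancel_one')
qed

lemma rmod_hom_finsum:
  assumes "abelian_group M" "abelian_group N" "f \<in> rmod_hom A M N" "g \<in> I \<rightarrow> carrier M"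
  shows "f (finsum M g I) = finsum N (\<lambda>i. f (g i)) I"
proof -
  interpret M: abelian_group M by fact
  interpret N: abelian_group N by fact
  show ?thesis using assms(4)
  proof (induct I rule: infinite_finite_induct)
    case (insert i I)
    then have g: "g \<in> I \<rightarrow> carrier M" "g i \<in> carrier M" by auto
    then have "(\<lambda>i. f (g i)) \<in> I \<rightarrow> carrier N" using rmod_homD(1)[OF assms(3)] by auto
    with insert g show ?case
      by (simp add: M.finsum_insert N.finsum_insert rmod_homD[OF assms(3)] M.finsum_closed)
  qed (simp_all add: rmod_hom_zero[OF assms(1-3)])
qed

lemma rmod_hom_compose:
  "f \<in> rmod_hom A M N \<Longrightarrow> g \<in> rmod_hom A N L \<Longrightarrow> (\<lambda>x. g (f x)) \<in> rmod_hom A M L"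
  by (auto simp: rmod_hom_def Pi_iff)

lemma rmod_hom_diff:
  assumes M: "abelian_group M" and N: "abelian_group N" and f: "f \<in> rmod_hom A M N"
    and "x \<in> carrier M" "y \<in> carrier M" "f x = f y"
  shows "f (x \<ominus>\<^bsub>M\<^esub> y) = \<zero>\<^bsub>N\<^esub>"
proof -
  interpret M: abelian_group M by fact
  interpret N: abelian_group N by fact
  have "f x = f ((x \<ominus>\<^bsub>M\<^esub> y) \<oplus>\<^bsub>M\<^esub> y)"
    using assms(4,5) by (simp add: M.minus_eq M.a_assoc M.l_neg)
  also have "\<dots> = f (x \<ominus>\<^bsub>M\<^esub> y) \<oplus>\<^bsub>N\<^esub> f y"
    using assms(4,5) rmod_homD(2)[OF f] by simp
  finally have "f y = f (x \<ominus>\<^bsub>M\<^esub> y) \<oplus>\<^bsub>N\<^esub> f y" using assms(6) by simp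
  then show ?thesis
    using assms(4,5) rmod_homD(1)[OF f] N.add.r_cancel_one'[of "f y" "f (x \<ominus>\<^bsub>M\<^esub> y)"] by simp
qed

lemma rmod_hom_inj_onI:
  assumes M: "abelian_group M" and N: "abelian_group N" and f: "f \<in> rmod_hom A M N"
    and ker: "\<And>x. x \<in> carrier M \<Longrightarrow> f x = \<zero>\<^bsub>N\<^esub> \<Longrightarrow> x = \<zero>\<^bsub>M\<^esub>"
  shows "inj_on f (carrier M)"
proof (rule inj_onI)
  interpret M: abelian_group M by fact
  fix x y assume xy: "x \<in> carrier M" "y \<in> carrier M" "f x = f y"
  then have "x \<ominus>\<^bsub>M\<^esub> y = \<zero>\<^bsub>M\<^esub>" using rmod_hom_diff[OF M N f xy] ker by auto
  then show "x = y" using xy by simp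
qed

lemma rsubmodule_kernel:
  assumes "right_module A M" "right_module A N" "f \<in> rmod_hom A M N"
  shows "rsubmodule A M {x \<in> carrier M. f x = \<zero>\<^bsub>N\<^esub>}"
proof -
  interpret M: right_module A M by fact
  interpret N: right_module A N by fact
  note z = rmod_hom_zero[OF M.abelian_group_axioms N.abelian_group_axioms assms(3)]
  show ?thesis
    by (rule rsubmoduleI[OF M.right_module_axioms]) (auto simp: z rmod_homD[OF assms(3)] M.ract_closed)
qed

lemma rsubmodule_image:
  assumes "right_module A M" "right_module A N" "f \<in> rmod_hom A M N" "rsubmodule A M X"
  shows "rsubmodule A N (f ` X)"
proof -
  interpret M: right_module A M by fact
  interpret N: right_module A N by fact
  note z = rmod_hom_zero[OF M.abelian_group_axioms N.abelian_group_axioms assms(3)]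
  note X = rsubmoduleD[OF assms(4)] and f = rmod_homD[OF assms(3)]
  show ?thesis
  proof (rule rsubmoduleI[OF N.right_module_axioms])
    show "\<zero>\<^bsub>N\<^esub> \<in> f ` X" using z X(2) by force
    show "x \<oplus>\<^bsub>N\<^esub> y \<in> f ` X" if xy: "x \<in> f ` X" "y \<in> f ` X" for x y
    proof -
      obtain x' y' where *: "x = f x'" "y = f y'" "x' \<in> X" "y' \<in> X" using xy by auto
      then have "x \<oplus>\<^bsub>N\<^esub> y = f (x' \<oplus>\<^bsub>M\<^esub> y')" using f(2) X(1) by (simp add: subset_iff)
      then show ?thesis using X(3) * by auto
    qed
    show "x \<triangleleft>\<^bsub>N\<^esub> a \<in> f ` X" if xa: "x \<in> f ` X" "a \<in> carrier A" for x a
    proof -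
      obtain x' where *: "x = f x'" "x' \<in> X" using xa by auto
      then have "x \<triangleleft>\<^bsub>N\<^esub> a = f (x' \<triangleleft>\<^bsub>M\<^esub> a)" using f(3) X(1) xa by (simp add: subset_iff)
      then show ?thesis using X(4) * xa by auto
    qed
  qed (use X f in auto)
qed

lemma rsubmodule_vimage:
  assumes "right_module A M" "right_module A N" "f \<in> rmod_hom A M N" "rsubmodule A N X"
  shows "rsubmodule A M {x \<in> carrier M. f x \<in> X}"
proof -
  interpret M: right_module A M by fact
  interpret N: right_module A N by fact
  note z = rmod_hom_zero[OF M.abelian_group_axioms N.abelian_group_axioms assms(3)]
  show ?thesis
    by (rule rsubmoduleI[OF M.right_module_axioms])
      (auto simp: z rmod_homD[OF assms(3)] rsubmoduleD[OF assms(4)] M.ract_closed)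
qed

lemma rmod_iso_refl: "rmod_iso A M M"
  unfolding rmod_iso_def by (rule bexI[of _ id]) (auto intro: rmod_homI)

lemma rmod_iso_trans:
  assumes "rmod_iso A M N" "rmod_iso A N L"
  shows "rmod_iso A M L"
proof -
  obtain f g where f: "f \<in> rmod_hom A M N" "bij_betw f (carrier M) (carrier N)"
    and g: "g \<in> rmod_hom A N L" "bij_betw g (carrier N) (carrier L)"
    using assms by (auto simp: rmod_iso_def)
  show ?thesis unfolding rmod_iso_def
    using rmod_hom_compose[OF f(1) g(1)] bij_betw_trans[OF f(2) g(2)]
    by (auto simp: comp_def)
qed

lemma rmod_hom_inverse:
  assumes M: "right_module A M" and f: "f \<in> rmod_hom A M N" "bij_betw f (carrier M) (carrier N)"
  shows "inv_into (carrier M) f \<in> rmod_hom A N M"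
proof -
  interpret M: right_module A M by fact
  let ?g = "inv_into (carrier M) f"
  have g: "\<And>y. y \<in> carrier N \<Longrightarrow> ?g y \<in> carrier M" "\<And>y. y \<in> carrier N \<Longrightarrow> f (?g y) = y"
    "\<And>x. x \<in> carrier M \<Longrightarrow> ?g (f x) = x"
    using f(2) by (auto simp: bij_betw_def inv_into_into f_inv_into_f inv_into_f_f)
  show ?thesis
  proof (rule rmod_homI)
    fix x y assume xy: "x \<in> carrier N" "y \<in> carrier N"
    have "?g (x \<oplus>\<^bsub>N\<^esub> y) = ?g (f (?g x) \<oplus>\<^bsub>N\<^esub> f (?g y))" using g xy by simp
    also have "\<dots> = ?g (f (?g x \<oplus>\<^bsub>M\<^esub> ?g y))" using rmod_homD(2)[OF f(1)] g xy by simp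
    finally show "?g (x \<oplus>\<^bsub>N\<^esub> y) = ?g x \<oplus>\<^bsub>M\<^esub> ?g y" using g xy by simp
  next
    fix x a assume xa: "x \<in> carrier N" "a \<in> carrier A"
    have "?g (x \<triangleleft>\<^bsub>N\<^esub> a) = ?g (f (?g x) \<triangleleft>\<^bsub>N\<^esub> a)" using g xa by simp
    also have "\<dots> = ?g (f (?g x \<triangleleft>\<^bsub>M\<^esub> a))" using rmod_homD(3)[OF f(1)] g xa by simp
    finally show "?g (x \<triangleleft>\<^bsub>N\<^esub> a) = ?g x \<triangleleft>\<^bsub>M\<^esub> a" using g xa M.ract_closed by simp
  qed (use g in auto)
qed

lemma rmod_iso_sym:
  assumes M: "right_module A M" and "rmod_iso A M N"
  shows "rmod_iso A N M"
  using assms rmod_hom_inverse[OF M] bij_betw_inv_into unfolding rmod_iso_def by blast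

lemma rmod_sum_simps [simp]:
  "carrier (rmod_sum M N) = carrier M \<times> carrier N"
  "\<zero>\<^bsub>rmod_sum M N\<^esub> = (\<zero>\<^bsub>M\<^esub>, \<zero>\<^bsub>N\<^esub>)"
  "(x, y) \<oplus>\<^bsub>rmod_sum M N\<^esub> (x', y') = (x \<oplus>\<^bsub>M\<^esub> x', y \<oplus>\<^bsub>N\<^esub> y')"
  "(x, y) \<triangleleft>\<^bsub>rmod_sum M N\<^esub> a = (x \<triangleleft>\<^bsub>M\<^esub> a, y \<triangleleft>\<^bsub>N\<^esub> a)"
  by (auto simp: rmod_sum_def)

lemma rmod_sum_right_module:
  assumes "right_module A M" "right_module A N"
  shows "right_module A (rmod_sum M N)"
proof -
  interpret M: right_module A M by fact
  interpret N: right_module A N by fact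
  show ?thesis
  proof (rule right_moduleI)
    show "abelian_group (rmod_sum M N)"
    proof (rule abelian_groupI)
      fix x assume x: "x \<in> carrier (rmod_sum M N)"
      then show "\<exists>y\<in>carrier (rmod_sum M N). y \<oplus>\<^bsub>rmod_sum M N\<^esub> x = \<zero>\<^bsub>rmod_sum M N\<^esub>"
        by (auto intro!: bexI[of _ "\<ominus>\<^bsub>M\<^esub> fst x"] bexI[of _ "\<ominus>\<^bsub>N\<^esub> snd x"] simp: M.l_neg N.l_neg)
    qed (auto simp: M.a_ac N.a_ac)
  qed (auto simp: M.ract_closed N.ract_closed M.ract_add_left N.ract_add_left M.ract_add_right
      N.ract_add_right M.ract_mult N.ract_mult M.ract_one N.ract_one intro: M.A.ring_axioms)
qed

text \<open>The sum of \<open>X\<close> and \<open>Y\<close> is the image of the addition map on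
  their external direct sum.\<close>

lemma rsubmodule_sum:
  assumes M: "right_module A M" and X: "rsubmodule A M X" and Y: "rsubmodule A M Y"
  shows "rsubmodule A M {x \<oplus>\<^bsub>M\<^esub> y | x y. x \<in> X \<and> y \<in> Y}"
proof -
  let ?S = "rmod_sum (M\<lparr>carrier := X\<rparr>) (M\<lparr>carrier := Y\<rparr>)"
  interpret M: right_module A M by fact
  note Xd = rsubmoduleD[OF X] and Yd = rsubmoduleD[OF Y]
  have S: "right_module A ?S"
    by (intro rmod_sum_right_module rsubmodule_right_module M X Y)
  have f: "(\<lambda>(x, y). x \<oplus>\<^bsub>M\<^esub> y) \<in> rmod_hom A ?S M"
    using Xd(1) Yd(1) by (intro rmod_homI) (auto simp: M.ract_add_left M.M.a_ac subset_iff)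
  have "(\<lambda>(x, y). x \<oplus>\<^bsub>M\<^esub> y) ` carrier ?S = {x \<oplus>\<^bsub>M\<^esub> y | x y. x \<in> X \<and> y \<in> Y}" by auto
  with rsubmodule_image[OF S M f rsubmodule_carrier[OF S]] show ?thesis by simp
qed

lemma rmod_sum_homs:
  assumes "right_module A M" "right_module A N"
  shows "fst \<in> rmod_hom A (rmod_sum M N) M" "snd \<in> rmod_hom A (rmod_sum M N) N"
    "(\<lambda>x. (x, \<zero>\<^bsub>N\<^esub>)) \<in> rmod_hom A M (rmod_sum M N)" "(\<lambda>y. (\<zero>\<^bsub>M\<^esub>, y)) \<in> rmod_hom A N (rmod_sum M N)"
proof -
  interpret M: right_module A M by fact
  interpret N: right_module A N by fact
  show "fst \<in> rmod_hom A (rmod_sum M N) M" "snd \<in> rmod_hom A (rmod_sum M N) N"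
    "(\<lambda>x. (x, \<zero>\<^bsub>N\<^esub>)) \<in> rmod_hom A M (rmod_sum M N)" "(\<lambda>y. (\<zero>\<^bsub>M\<^esub>, y)) \<in> rmod_hom A N (rmod_sum M N)"
    by (rule rmod_homI; auto)+
qed

text \<open>Moves a module along an injection to another carrier type. The definition of
  \<open>fgmod\<close> fixes the carrier type, so modules built elsewhere have to be carried over to
  it.\<close>

definition rmod_transport :: "('m \<Rightarrow> 'n) \<Rightarrow> ('a, 'm) rmod \<Rightarrow> ('a, 'n) rmod" where
  "rmod_transport g M =
     \<lparr>carrier = g ` carrier M,
      monoid.mult = undefined,
      one = undefined,
      zero = g \<zero>\<^bsub>M\<^esub>,
      add = (\<lambda>x y. g (inv_into (carrier M) g x \<oplus>\<^bsub>M\<^esub> inv_into (carrier M) g y)),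
      ract = (\<lambda>x a. g (inv_into (carrier M) g x \<triangleleft>\<^bsub>M\<^esub> a))\<rparr>"

lemma rmod_transport:
  assumes M: "right_module A M" and g: "inj_on g (carrier M)"
  shows "right_module A (rmod_transport g M)" "g \<in> rmod_hom A M (rmod_transport g M)"
    "bij_betw g (carrier M) (carrier (rmod_transport g M))"
proof -
  interpret M: right_module A M by fact
  let ?T = "rmod_transport g M"
  have inv: "\<And>x. x \<in> carrier M \<Longrightarrow> inv_into (carrier M) g (g x) = x" using g by simp
  have T: "carrier ?T = g ` carrier M" "\<zero>\<^bsub>?T\<^esub> = g \<zero>\<^bsub>M\<^esub>"
    "\<And>x y. x \<in> carrier M \<Longrightarrow> y \<in> carrier M \<Longrightarrow> g x \<oplus>\<^bsub>?T\<^esub> g y = g (x \<oplus>\<^bsub>M\<^esub> y)"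
    "\<And>x a. x \<in> carrier M \<Longrightarrow> g x \<triangleleft>\<^bsub>?T\<^esub> a = g (x \<triangleleft>\<^bsub>M\<^esub> a)"
    by (auto simp: rmod_transport_def inv)
  show "right_module A ?T"
  proof (rule right_moduleI)
    show "abelian_group ?T"
    proof (rule abelian_groupI)
      fix x assume "x \<in> carrier ?T"
      then obtain x' where "x = g x'" "x' \<in> carrier M" using T(1) by auto
      then show "\<exists>y\<in>carrier ?T. y \<oplus>\<^bsub>?T\<^esub> x = \<zero>\<^bsub>?T\<^esub>"
        by (intro bexI[of _ "g (\<ominus>\<^bsub>M\<^esub> x')"]) (auto simp: T M.l_neg)
    qed (auto simp: T M.a_ac)
  qed (auto simp: T M.ract_closed M.ract_add_left M.ract_add_right
       M.ract_mult M.ract_one intro: M.A.ring_axioms)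
  show "g \<in> rmod_hom A M ?T" by (rule rmod_homI) (auto simp: T)
  show "bij_betw g (carrier M) (carrier ?T)" using g T(1) by (auto simp: bij_betw_def)
qed

text \<open>The kernel of the addition map on pairs consists of pairs (x, -x), whose entries lie in
  both submodules. The isomorphism is obtained in the direction of the addition map and then
  inverted.\<close>

lemma rmod_sum_internal:
  assumes M: "right_module A M" and X: "rsubmodule A M X" and Y: "rsubmodule A M Y"
    and int: "X \<inter> Y \<subseteq> {\<zero>\<^bsub>M\<^esub>}"
    and sum: "\<And>z. z \<in> carrier M \<Longrightarrow> \<exists>x\<in>X. \<exists>y\<in>Y. z = x \<oplus>\<^bsub>M\<^esub> y"
  shows "rmod_iso A M (rmod_sum (M\<lparr>carrier := X\<rparr>) (M\<lparr>carrier := Y\<rparr>))"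
proof -
  interpret M: right_module A M by fact
  note Xd = rsubmoduleD[OF X] and Yd = rsubmoduleD[OF Y]
  let ?S = "rmod_sum (M\<lparr>carrier := X\<rparr>) (M\<lparr>carrier := Y\<rparr>)"
  let ?f = "\<lambda>(x, y). x \<oplus>\<^bsub>M\<^esub> y"
  have S: "right_module A ?S"
    by (intro rmod_sum_right_module rsubmodule_right_module M X Y)
  then interpret S: right_module A ?S .
  have f: "?f \<in> rmod_hom A ?S M"
    using Xd(1) Yd(1) by (intro rmod_homI) (auto simp: M.ract_add_left M.a_ac subset_iff)
  have "inj_on ?f (carrier ?S)"
  proof (rule rmod_hom_inj_onI[OF S.abelian_group_axioms M.abelian_group_axioms f])
    fix z assume "z \<in> carrier ?S" and z0: "?f z = \<zero>\<^bsub>M\<^esub>"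
    then obtain x y where xy: "z = (x, y)" "x \<in> X" "y \<in> Y" by auto
    have c: "x \<in> carrier M" "y \<in> carrier M" using xy Xd Yd by auto
    have "y = \<ominus>\<^bsub>M\<^esub> x" using z0 c xy(1) by (metis M.a_comm M.minus_equality case_prod_conv)
    also have "\<dots> = x \<triangleleft>\<^bsub>M\<^esub> (\<ominus>\<^bsub>A\<^esub> \<one>\<^bsub>A\<^esub>)" using M.ract_minus_one c by simp
    finally have "y \<in> X" using Xd(4) xy by simp
    then have "y = \<zero>\<^bsub>M\<^esub>" using int xy by auto
    then show "z = \<zero>\<^bsub>?S\<^esub>" using z0 xy c by simp
  qed
  moreover have "?f ` carrier ?S = carrier M"
  proof
    show "carrier M \<subseteq> ?f ` carrier ?S"
    proof
      fix z assume "z \<in> carrier M"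
      then obtain x y where "x \<in> X" "y \<in> Y" "z = x \<oplus>\<^bsub>M\<^esub> y" using sum by blast
      then show "z \<in> ?f ` carrier ?S" by force
    qed
  qed (use Xd(1) Yd(1) in auto)
  ultimately have "rmod_iso A ?S M"
    using f unfolding rmod_iso_def bij_betw_def by blast
  then show ?thesis by (rule rmod_iso_sym[OF S])
qed

section \<open>Split algebras with radical square zero\<close>

text \<open>The field given by a type class is packed into a ring record, so that the linear algebra
  of carrier-based vector spaces applies to modules.\<close>

definition scalar_ring :: "'k::field ring" where
  "scalar_ring = \<lparr>carrier = UNIV, monoid.mult = (*), one = 1, zero = 0, add = (+)\<rparr>"

lemma scalar_ring_simps [simp]:
  "carrier scalar_ring = UNIV" "x \<otimes>\<^bsub>scalar_ring\<^esub> y = x * y" "\<one>\<^bsub>scalar_ring\<^esub> = 1"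
  "\<zero>\<^bsub>scalar_ring\<^esub> = 0" "x \<oplus>\<^bsub>scalar_ring\<^esub> y = x + y"
  by (simp_all add: scalar_ring_def)

lemma field_scalar_ring: "field (scalar_ring :: 'k::field ring)"
proof -
  have "cring (scalar_ring :: 'k ring)"
  proof (rule cringI)
    show "abelian_group (scalar_ring :: 'k ring)"
      by (rule abelian_groupI) (auto intro: exI[of _ "- x" for x] simp: add_ac)
    show "comm_monoid (scalar_ring :: 'k ring)"
      by (rule comm_monoidI) (auto simp: mult_ac)
  qed (auto simp: distrib_right)
  then interpret cring "scalar_ring :: 'k ring" .
  show ?thesis
  proof (rule cring_fieldI)
    have "x \<in> Units scalar_ring" if "x \<noteq> 0" for x :: 'k
      using that unfolding Units_def by (auto intro!: exI[of _ "inverse x"])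
    moreover have "0 \<notin> Units (scalar_ring :: 'k ring)" by (auto simp: Units_def)
    ultimately show "Units scalar_ring = carrier scalar_ring - {\<zero>\<^bsub>scalar_ring :: 'k ring\<^esub>}" by auto
  qed
qed

text \<open>The algebra as a right module over itself. Through it, subspaces of the algebra get a
  dimension and coordinates of vectors become module homomorphisms.\<close>

definition regular_rmod :: "('a, 'b) ring_scheme \<Rightarrow> ('a, 'a) rmod" where
  "regular_rmod A = \<lparr>carrier = carrier A, monoid.mult = undefined, one = undefined,
     zero = \<zero>\<^bsub>A\<^esub>, add = (\<oplus>\<^bsub>A\<^esub>), ract = (\<otimes>\<^bsub>A\<^esub>)\<rparr>"

lemma regular_rmod_simps [simp]:
  "carrier (regular_rmod A) = carrier A" "\<zero>\<^bsub>regular_rmod A\<^esub> = \<zero>\<^bsub>A\<^esub>"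
  "x \<oplus>\<^bsub>regular_rmod A\<^esub> y = x \<oplus>\<^bsub>A\<^esub> y" "x \<triangleleft>\<^bsub>regular_rmod A\<^esub> a = x \<otimes>\<^bsub>A\<^esub> a"
  by (simp_all add: regular_rmod_def)

lemma regular_right_module:
  assumes "ring A"
  shows "right_module A (regular_rmod A)"
proof -
  interpret ring A by fact
  show ?thesis
  proof (rule right_moduleI)
    show "abelian_group (regular_rmod A)"
    proof (rule abelian_groupI)
      fix x assume "x \<in> carrier (regular_rmod A)"
      then show "\<exists>y\<in>carrier (regular_rmod A). y \<oplus>\<^bsub>regular_rmod A\<^esub> x = \<zero>\<^bsub>regular_rmod A\<^esub>"
        by (auto intro!: bexI[of _ "\<ominus>\<^bsub>A\<^esub> x"] simp: l_neg)
    qed (auto simp: a_ac)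
  qed (auto simp: l_distr r_distr m_assoc intro: ring_axioms)
qed

text \<open>
  The algebras \<open>\<Oplus>\<^bsub>v\<^esub> k \<epsilon>\<^bsub>v\<^esub> \<oplus> J\<close> with \<open>J\<^sup>2 = 0\<close>: \<open>\<kappa>\<close> embeds the scalars, the \<open>\<epsilon> v\<close> are the primitive
  idempotents, \<open>\<chi> v\<close> reads off the coefficient of \<open>\<epsilon> v\<close> and \<open>J\<close> is the common kernel of the \<open>\<chi> v\<close>.
\<close>

locale split_rad_square_zero = ring A
  for A :: "('a, 'b) ring_scheme" (structure) +
  fixes V :: "'v set" and \<kappa> :: "'k::field \<Rightarrow> 'a" and \<epsilon> :: "'v \<Rightarrow> 'a" and \<chi> :: "'v \<Rightarrow> 'a \<Rightarrow> 'k"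
  assumes finite_V: "finite V"
    and \<kappa>_closed [simp]: "\<kappa> c \<in> carrier A"
    and \<kappa>_add: "\<kappa> (c + d) = \<kappa> c \<oplus> \<kappa> d"
    and \<kappa>_mult: "\<kappa> (c * d) = \<kappa> c \<otimes> \<kappa> d"
    and \<kappa>_one: "\<kappa> 1 = \<one>"
    and \<kappa>_central: "a \<in> carrier A \<Longrightarrow> \<kappa> c \<otimes> a = a \<otimes> \<kappa> c"
    and \<epsilon>_closed [simp]: "v \<in> V \<Longrightarrow> \<epsilon> v \<in> carrier A"
    and \<epsilon>_mult: "\<lbrakk>u \<in> V; v \<in> V\<rbrakk> \<Longrightarrow> \<epsilon> u \<otimes> \<epsilon> v = (if u = v then \<epsilon> u else \<zero>)"
    and \<epsilon>_sum: "finsum A \<epsilon> V = \<one>"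
    and \<chi>_add: "\<lbrakk>v \<in> V; a \<in> carrier A; b \<in> carrier A\<rbrakk> \<Longrightarrow> \<chi> v (a \<oplus> b) = \<chi> v a + \<chi> v b"
    and \<chi>_mult: "\<lbrakk>v \<in> V; a \<in> carrier A; b \<in> carrier A\<rbrakk> \<Longrightarrow> \<chi> v (a \<otimes> b) = \<chi> v a * \<chi> v b"
    and \<chi>_\<kappa>: "v \<in> V \<Longrightarrow> \<chi> v (\<kappa> c) = c"
    and \<chi>_\<epsilon>: "\<lbrakk>u \<in> V; v \<in> V\<rbrakk> \<Longrightarrow> \<chi> u (\<epsilon> v) = (if u = v then 1 else 0)"
    and rad_square_zero: "\<lbrakk>a \<in> carrier A; b \<in> carrier A; \<And>v. v \<in> V \<Longrightarrow> \<chi> v a = 0;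
      \<And>v. v \<in> V \<Longrightarrow> \<chi> v b = 0\<rbrakk> \<Longrightarrow> a \<otimes> b = \<zero>"
    and fin_spanning: "\<exists>B. finite B \<and> B \<subseteq> carrier A \<and>
      (\<forall>X. B \<subseteq> X \<and> \<zero> \<in> X \<and> (\<forall>x\<in>X. \<forall>y\<in>X. x \<oplus> y \<in> X) \<and> (\<forall>x\<in>X. \<forall>c. x \<otimes> \<kappa> c \<in> X) \<longrightarrow> carrier A \<subseteq> X)"
begin

lemma \<kappa>_zero: "\<kappa> 0 = \<zero>"
  using \<kappa>_add[of 0 0] by simp

lemma \<chi>_zero [simp]: "v \<in> V \<Longrightarrow> \<chi> v \<zero> = 0"
  using \<chi>_\<kappa>[of v 0] \<kappa>_zero by simp

lemma \<chi>_one [simp]: "v \<in> V \<Longrightarrow> \<chi> v \<one> = 1"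
  using \<chi>_\<kappa>[of v 1] \<kappa>_one by simp

definition J :: "'a set" where
  "J = {a \<in> carrier A. \<forall>v\<in>V. \<chi> v a = 0}"

lemma J_carrier: "j \<in> J \<Longrightarrow> j \<in> carrier A"
  by (simp add: J_def)

lemma J_mult: "i \<in> J \<Longrightarrow> j \<in> J \<Longrightarrow> i \<otimes> j = \<zero>"
  using rad_square_zero by (auto simp: J_def)

lemma J_ideal: "j \<in> J \<Longrightarrow> a \<in> carrier A \<Longrightarrow> j \<otimes> a \<in> J" "j \<in> J \<Longrightarrow> a \<in> carrier A \<Longrightarrow> a \<otimes> j \<in> J"
  by (auto simp: J_def \<chi>_mult)

lemma J_add: "i \<in> J \<Longrightarrow> j \<in> J \<Longrightarrow> i \<oplus> j \<in> J"
  by (auto simp: J_def \<chi>_add)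

lemma J_zero: "\<zero> \<in> J"
  by (auto simp: J_def)

section \<open>Modules as vector spaces over the scalars\<close>

definition vsp :: "('a, 'm) rmod \<Rightarrow> ('k, 'm) module" where
  "vsp M = \<lparr>carrier = carrier M, monoid.mult = undefined, one = undefined, zero = \<zero>\<^bsub>M\<^esub>,
     add = (\<oplus>\<^bsub>M\<^esub>), smult = (\<lambda>c x. x \<triangleleft>\<^bsub>M\<^esub> \<kappa> c)\<rparr>"

lemma vsp_simps [simp]:
  "carrier (vsp M) = carrier M" "\<zero>\<^bsub>vsp M\<^esub> = \<zero>\<^bsub>M\<^esub>"
  "x \<oplus>\<^bsub>vsp M\<^esub> y = x \<oplus>\<^bsub>M\<^esub> y" "c \<odot>\<^bsub>vsp M\<^esub> x = x \<triangleleft>\<^bsub>M\<^esub> \<kappa> c"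
  "vsp (M\<lparr>carrier := X\<rparr>) = (vsp M)\<lparr>carrier := X\<rparr>"
  by (simp_all add: vsp_def)

text \<open>Restriction of scalars along \<open>\<kappa>\<close>. The right action turns into a left
  one because the field is commutative.\<close>

lemma vsp_vectorspace:
  assumes "right_module A M"
  shows "vectorspace scalar_ring (vsp M)"
proof -
  interpret M: right_module A M by fact
  show ?thesis
  proof (rule vs_criteria[OF field_scalar_ring])
    show "\<forall>v\<in>carrier (vsp M). \<exists>neg_v\<in>carrier (vsp M). v \<oplus>\<^bsub>vsp M\<^esub> neg_v = \<zero>\<^bsub>vsp M\<^esub>"
      using M.r_neg by (auto intro!: bexI[of _ "\<ominus>\<^bsub>M\<^esub> v" for v])
    show "\<forall>a b v. a \<in> carrier scalar_ring \<and> b \<in> carrier scalar_ring \<and> v \<in> carrier (vsp M) \<longrightarrow>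
       (a \<otimes>\<^bsub>scalar_ring\<^esub> b) \<odot>\<^bsub>vsp M\<^esub> v = a \<odot>\<^bsub>vsp M\<^esub> (b \<odot>\<^bsub>vsp M\<^esub> v)"
      by (auto simp: M.ract_mult[symmetric] \<kappa>_mult[symmetric] mult.commute)
  qed (auto simp: M.ract_closed M.ract_add_left M.ract_add_right M.a_ac \<kappa>_add \<kappa>_one M.ract_one)
qed

definition ksub :: "('a, 'm) rmod \<Rightarrow> 'm set \<Rightarrow> bool" where
  "ksub M X \<longleftrightarrow> subspace scalar_ring X (vsp M)"

definition vdim :: "('a, 'm) rmod \<Rightarrow> 'm set \<Rightarrow> nat" where
  "vdim M X = vectorspace.sdim scalar_ring (vsp M) X"

definition fd :: "('a, 'm) rmod \<Rightarrow> bool" where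
  "fd M \<longleftrightarrow> vectorspace.fin_dim scalar_ring (vsp M)"

lemma ksubI:
  assumes "right_module A M"
    and "X \<subseteq> carrier M" "\<zero>\<^bsub>M\<^esub> \<in> X" "\<And>x y. x \<in> X \<Longrightarrow> y \<in> X \<Longrightarrow> x \<oplus>\<^bsub>M\<^esub> y \<in> X"
    "\<And>x c. x \<in> X \<Longrightarrow> x \<triangleleft>\<^bsub>M\<^esub> \<kappa> c \<in> X"
  shows "ksub M X"
  unfolding ksub_def using assms
  by (intro vectorspace.subspaceI[OF vsp_vectorspace[OF assms(1)]]) auto

lemma ksubD:
  assumes "ksub M X"
  shows "X \<subseteq> carrier M" "\<zero>\<^bsub>M\<^esub> \<in> X" "\<And>x y. x \<in> X \<Longrightarrow> y \<in> X \<Longrightarrow> x \<oplus>\<^bsub>M\<^esub> y \<in> X"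
    "\<And>x c. x \<in> X \<Longrightarrow> x \<triangleleft>\<^bsub>M\<^esub> \<kappa> c \<in> X"
proof -
  from assms interpret vectorspace scalar_ring "vsp M"
    by (simp add: ksub_def subspace_def)
  note * = subspaceD[OF assms[unfolded ksub_def]]
  show "X \<subseteq> carrier M" "\<zero>\<^bsub>M\<^esub> \<in> X" "\<And>x y. x \<in> X \<Longrightarrow> y \<in> X \<Longrightarrow> x \<oplus>\<^bsub>M\<^esub> y \<in> X"
    "\<And>x c. x \<in> X \<Longrightarrow> x \<triangleleft>\<^bsub>M\<^esub> \<kappa> c \<in> X"
    using * by auto
qed

lemma rsubmodule_ksub: "right_module A M \<Longrightarrow> rsubmodule A M X \<Longrightarrow> ksub M X"
  by (rule ksubI) (use rsubmoduleD[of A M X] in auto)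

lemma ksub_Int: "right_module A M \<Longrightarrow> ksub M X \<Longrightarrow> ksub M Y \<Longrightarrow> ksub M (X \<inter> Y)"
  using ksubD[of M X] ksubD[of M Y] by (intro ksubI) auto

lemma ksub_zero: "right_module A M \<Longrightarrow> ksub M {\<zero>\<^bsub>M\<^esub>}"
  by (simp add: rsubmodule_ksub rsubmodule_zero)

lemma ksub_carrier: "right_module A M \<Longrightarrow> ksub M (carrier M)"
  by (simp add: rsubmodule_ksub rsubmodule_carrier)

lemma rmod_hom_linear_map:
  assumes "right_module A M" "right_module A N" "f \<in> rmod_hom A M N"
  shows "linear_map scalar_ring (vsp M) (vsp N) f"
proof -
  interpret M: vectorspace scalar_ring "vsp M" by (rule vsp_vectorspace) fact
  interpret N: vectorspace scalar_ring "vsp N" by (rule vsp_vectorspace) fact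
  show ?thesis
    by unfold_locales (use rmod_homD[OF assms(3)] in \<open>auto simp: module_hom_def\<close>)
qed

lemma vdim_image_kernel:
  assumes "right_module A M" "right_module A N" "f \<in> rmod_hom A M N" "fd M" "ksub M X"
  shows "vdim M X = vdim N (f ` X) + vdim M {x \<in> X. f x = \<zero>\<^bsub>N\<^esub>}"
proof -
  interpret linear_map scalar_ring "vsp M" "vsp N" f
    by (rule rmod_hom_linear_map) fact+
  show ?thesis using sdim_image_kernel[of X] assms(4,5) by (simp add: fd_def ksub_def vdim_def)
qed

lemma vdim_zero: "right_module A M \<Longrightarrow> vdim M {\<zero>\<^bsub>M\<^esub>} = 0"
  using vectorspace.sdim_zero[OF vsp_vectorspace] by (simp add: vdim_def)

lemma vdim_mono: "right_module A M \<Longrightarrow> fd M \<Longrightarrow> ksub M X \<Longrightarrow> ksub M Y \<Longrightarrow> X \<subseteq> Y \<Longrightarrow> vdim M X \<le> vdim M Y"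
  using vectorspace.sdim_mono[OF vsp_vectorspace] by (simp add: vdim_def fd_def ksub_def)

lemma vdim_eq_imp_eq:
  "right_module A M \<Longrightarrow> fd M \<Longrightarrow> ksub M X \<Longrightarrow> ksub M Y \<Longrightarrow> X \<subseteq> Y \<Longrightarrow> vdim M X = vdim M Y \<Longrightarrow> X = Y"
  using vectorspace.sdim_eq_imp_eq[OF vsp_vectorspace] by (simp add: vdim_def fd_def ksub_def)

lemma ksub_sum_line:
  "right_module A M \<Longrightarrow> ksub M R \<Longrightarrow> x \<in> carrier M \<Longrightarrow> ksub M {r \<oplus>\<^bsub>M\<^esub> x \<triangleleft>\<^bsub>M\<^esub> \<kappa> c | r c. r \<in> R}"
  using vectorspace.subspace_sum_line[OF vsp_vectorspace, of M R x] by (simp add: ksub_def)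

lemma vdim_sum_line:
  "right_module A M \<Longrightarrow> fd M \<Longrightarrow> ksub M R \<Longrightarrow> x \<in> carrier M \<Longrightarrow> x \<notin> R \<Longrightarrow>
    vdim M {r \<oplus>\<^bsub>M\<^esub> x \<triangleleft>\<^bsub>M\<^esub> \<kappa> c | r c. r \<in> R} = Suc (vdim M R)"
  using vectorspace.sdim_sum_line[OF vsp_vectorspace, of M R x] by (simp add: ksub_def vdim_def fd_def)

lemma hyperplane_ksub:
  assumes M: "right_module A M" "fd M" and R: "ksub M R" and X: "ksub M X" and RX: "R \<subseteq> X"
    and x: "x \<in> X" "x \<notin> R"
  obtains H where "ksub M H" "R \<subseteq> H" "H \<subseteq> X" "x \<notin> H"
    "\<And>y. y \<in> X \<Longrightarrow> \<exists>h\<in>H. \<exists>c. y = h \<oplus>\<^bsub>M\<^esub> x \<triangleleft>\<^bsub>M\<^esub> \<kappa> c"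
  by (rule vectorspace.hyperplane_exists[OF vsp_vectorspace[OF M(1)], of R X x])
    (use assms in \<open>auto simp: ksub_def fd_def\<close>)

lemma vdim_restrict:
  assumes M: "right_module A M" and Y: "rsubmodule A M Y"
  shows "vdim (M\<lparr>carrier := Y\<rparr>) X = vdim M X"
proof -
  interpret M: vectorspace scalar_ring "vsp M" by (rule vsp_vectorspace) fact
  interpret Y: vectorspace scalar_ring "vsp (M\<lparr>carrier := Y\<rparr>)"
    by (rule vsp_vectorspace) (rule rsubmodule_right_module[OF M Y])
  show ?thesis using M.sdim_def[of X] Y.sdim_def[of X] by (simp add: vdim_def)
qed

lemma fd_restrict:
  assumes M: "right_module A M" and Y: "rsubmodule A M Y" and "fd M"
  shows "fd (M\<lparr>carrier := Y\<rparr>)"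
proof -
  interpret M: vectorspace scalar_ring "vsp M" by (rule vsp_vectorspace) fact
  show ?thesis
    using M.subspace_fin_dim[of Y] assms rsubmodule_ksub[OF M Y] by (simp add: fd_def ksub_def)
qed

lemma fd_image:
  assumes "right_module A M" "right_module A N" "f \<in> rmod_hom A M N" "fd M" "f ` carrier M = carrier N"
  shows "fd N"
proof -
  interpret linear_map scalar_ring "vsp M" "vsp N" f
    by (rule rmod_hom_linear_map) fact+
  show ?thesis using rank_nullity_main(2) assms(4,5) by (simp add: fd_def)
qed

text \<open>The products of finitely many module generators with a finite spanning set of
  \<open>A\<close> span a subspace. It contains the generators and is stable under \<open>A\<close>
  because the scalars are central, so it is everything.\<close>

lemma fd_if_finitely_generated:
  assumes M: "right_module A M" and fg: "finitely_generated A M"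
  shows "fd M"
proof -
  interpret M: right_module A M by fact
  interpret VM: vectorspace scalar_ring "vsp M" by (rule vsp_vectorspace) fact
  obtain S where S: "finite S" "S \<subseteq> carrier M" "\<And>X. rsubmodule A M X \<Longrightarrow> S \<subseteq> X \<Longrightarrow> X = carrier M"
    using fg by (auto simp: finitely_generated_def)
  obtain B where B: "finite B" "B \<subseteq> carrier A"
    "\<And>X. B \<subseteq> X \<Longrightarrow> \<zero> \<in> X \<Longrightarrow> \<forall>x\<in>X. \<forall>y\<in>X. x \<oplus> y \<in> X \<Longrightarrow> \<forall>x\<in>X. \<forall>c. x \<otimes> \<kappa> c \<in> X \<Longrightarrow> carrier A \<subseteq> X"
  proof -
    obtain B where B: "finite B \<and> B \<subseteq> carrier A \<and> (\<forall>X. B \<subseteq> X \<and> \<zero> \<in> X \<and> (\<forall>x\<in>X. \<forall>y\<in>X. x \<oplus> y \<in> X) \<and>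
        (\<forall>x\<in>X. \<forall>c. x \<otimes> \<kappa> c \<in> X) \<longrightarrow> carrier A \<subseteq> X)"
      using fin_spanning ..
    show thesis by (rule that[of B]) (use B in simp_all)
  qed
  define T where "T = (\<lambda>(s, b). s \<triangleleft>\<^bsub>M\<^esub> b) ` (S \<times> B)"
  define X where "X = VM.span T"
  have T: "finite T" "T \<subseteq> carrier M" using S(1,2) B(1,2) M.ract_closed by (auto simp: T_def)
  have kX: "ksub M X" using VM.span_is_subspace[of T] T by (simp add: X_def ksub_def)
  note Xd = ksubD[OF kX]
  \<comment> \<open>The elements \<open>a\<close> with this property include \<open>B\<close> and
    are closed under addition and scalars, so the spanning property of \<open>B\<close>
    applies.\<close>
  have SA: "s \<triangleleft>\<^bsub>M\<^esub> a \<in> X" if s: "s \<in> S" and a: "a \<in> carrier A" for s a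
  proof -
    have sM: "s \<in> carrier M" using s S(2) by auto
    have "carrier A \<subseteq> {a \<in> carrier A. s \<triangleleft>\<^bsub>M\<^esub> a \<in> X}"
    proof (rule B(3))
      have "T \<subseteq> X" unfolding X_def using VM.in_own_span[of T] T by simp
      then show "B \<subseteq> {a \<in> carrier A. s \<triangleleft>\<^bsub>M\<^esub> a \<in> X}" using B(2) s by (auto simp: T_def)
      show "\<forall>x\<in>{a \<in> carrier A. s \<triangleleft>\<^bsub>M\<^esub> a \<in> X}. \<forall>c. x \<otimes> \<kappa> c \<in> {a \<in> carrier A. s \<triangleleft>\<^bsub>M\<^esub> a \<in> X}"
        using Xd(4) sM by (auto simp: M.ract_mult)
    qed (use Xd sM in \<open>auto simp: M.ract_add_right\<close>)
    then show ?thesis using a by auto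
  qed
  have "rsubmodule A M X"
  proof (rule rsubmoduleI[OF M])
    fix x a assume xa: "x \<in> X" "a \<in> carrier A"
    \<comment> \<open>The elements of \<open>X\<close> that \<open>a\<close> keeps inside
      \<open>X\<close> form a subspace, as \<open>\<kappa> c\<close> commutes with \<open>a\<close>.
      It contains the spanning set \<open>T\<close>, hence all of \<open>X\<close>.\<close>
    let ?Y = "{x \<in> X. x \<triangleleft>\<^bsub>M\<^esub> a \<in> X}"
    have kY: "ksub M ?Y"
    proof (rule ksubI[OF M])
      fix y c assume "y \<in> ?Y"
      moreover from this have "y \<triangleleft>\<^bsub>M\<^esub> \<kappa> c \<triangleleft>\<^bsub>M\<^esub> a = y \<triangleleft>\<^bsub>M\<^esub> a \<triangleleft>\<^bsub>M\<^esub> \<kappa> c"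
        using Xd(1) xa(2) \<kappa>_central[OF xa(2)] by (auto simp: M.ract_mult[symmetric])
      ultimately show "y \<triangleleft>\<^bsub>M\<^esub> \<kappa> c \<in> ?Y" using Xd(4) by simp
    qed (use Xd xa(2) in \<open>auto simp: M.ract_add_left subset_iff\<close>)
    have "T \<subseteq> ?Y"
    proof
      fix t assume "t \<in> T"
      then obtain s b where t: "t = s \<triangleleft>\<^bsub>M\<^esub> b" "s \<in> S" "b \<in> B" by (auto simp: T_def)
      have "t \<triangleleft>\<^bsub>M\<^esub> a = s \<triangleleft>\<^bsub>M\<^esub> (b \<otimes> a)" using t S(2) B(2) xa(2) by (simp add: M.ract_mult subset_iff)
      then show "t \<in> ?Y" using SA[OF t(2)] B(2) t xa(2) by (auto simp: subset_iff)
    qed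
    then have "X \<subseteq> ?Y"
      unfolding X_def using VM.span_is_subset[of T ?Y] kY by (simp add: ksub_def X_def)
    then show "x \<triangleleft>\<^bsub>M\<^esub> a \<in> X" using xa by auto
  qed (use Xd in auto)
  moreover have "S \<subseteq> X" using SA[of _ "\<one>"] S(2) M.ract_one by force
  ultimately have "X = carrier M" by (rule S(3))
  then show ?thesis
    using T unfolding fd_def VM.fin_dim_def X_def by auto
qed

lemma finitely_generated_if_fd:
  assumes M: "right_module A M" and "fd M"
  shows "finitely_generated A M"
proof -
  interpret VM: vectorspace scalar_ring "vsp M" by (rule vsp_vectorspace) fact
  obtain T where T: "finite T" "T \<subseteq> carrier M" "VM.span T = carrier M"
    using \<open>fd M\<close> by (auto simp: fd_def VM.fin_dim_def)
  show ?thesis unfolding finitely_generated_def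
  proof (intro exI[of _ T] conjI allI impI)
    fix X assume X: "rsubmodule A M X \<and> T \<subseteq> X"
    then have "ksub M X" using rsubmodule_ksub[OF M] by auto
    then have "VM.span T \<subseteq> X" using VM.span_is_subset[of T X] X by (simp add: ksub_def)
    then show "X = carrier M" using T X rsubmoduleD(1) by blast
  qed (use T in auto)
qed

lemma finitely_generated_iff_fd:
  "right_module A M \<Longrightarrow> finitely_generated A M \<longleftrightarrow> fd M"
  using fd_if_finitely_generated finitely_generated_if_fd by blast

lemma fd_regular: "fd (regular_rmod A)"
proof (rule fd_if_finitely_generated)
  show M: "right_module A (regular_rmod A)" by (rule regular_right_module) (rule ring_axioms)
  show "finitely_generated A (regular_rmod A)" unfolding finitely_generated_def
  proof (intro exI[of _ "{\<one>}"] conjI allI impI)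
    fix X assume X: "rsubmodule A (regular_rmod A) X \<and> {\<one>} \<subseteq> X"
    have "x \<in> X" if "x \<in> carrier A" for x
      using rsubmoduleD(4)[of A "regular_rmod A" X \<one> x] X that by simp
    then show "X = carrier (regular_rmod A)"
      using rsubmoduleD(1)[of A "regular_rmod A" X] X by auto
  qed auto
qed

section \<open>Vertex components, radical and annihilator of J\<close>

definition vcomp :: "('a, 'm) rmod \<Rightarrow> 'v \<Rightarrow> 'm set" where
  "vcomp M v = {x \<in> carrier M. x \<triangleleft>\<^bsub>M\<^esub> \<epsilon> v = x}"

text \<open>The submodule M J. Taking the least submodule that contains all products lets inclusions
  of the radical be tested on single products.\<close>

definition rad :: "('a, 'm) rmod \<Rightarrow> 'm set" where
  "rad M = \<Inter>{X. rsubmodule A M X \<and> (\<forall>x\<in>carrier M. \<forall>j\<in>J. x \<triangleleft>\<^bsub>M\<^esub> j \<in> X)}"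

text \<open>The socle of \<open>M\<close>, since A / J is semisimple.\<close>

definition ann :: "('a, 'm) rmod \<Rightarrow> 'm set" where
  "ann M = {x \<in> carrier M. \<forall>j\<in>J. x \<triangleleft>\<^bsub>M\<^esub> j = \<zero>\<^bsub>M\<^esub>}"

lemma ksub_vcomp:
  assumes "right_module A M" "v \<in> V"
  shows "ksub M (vcomp M v)"
proof -
  interpret M: right_module A M by fact
  show ?thesis
  proof (rule ksubI[OF assms(1)])
    fix x c assume x: "x \<in> vcomp M v"
    have "x \<triangleleft>\<^bsub>M\<^esub> \<kappa> c \<triangleleft>\<^bsub>M\<^esub> \<epsilon> v = x \<triangleleft>\<^bsub>M\<^esub> (\<kappa> c \<otimes> \<epsilon> v)"
      using x assms(2) by (simp add: vcomp_def M.ract_mult)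
    also have "\<dots> = x \<triangleleft>\<^bsub>M\<^esub> \<epsilon> v \<triangleleft>\<^bsub>M\<^esub> \<kappa> c"
      using x assms(2) \<kappa>_central[of "\<epsilon> v" c] by (simp add: vcomp_def M.ract_mult)
    finally have "x \<triangleleft>\<^bsub>M\<^esub> \<kappa> c \<triangleleft>\<^bsub>M\<^esub> \<epsilon> v = x \<triangleleft>\<^bsub>M\<^esub> \<epsilon> v \<triangleleft>\<^bsub>M\<^esub> \<kappa> c" .
    then show "x \<triangleleft>\<^bsub>M\<^esub> \<kappa> c \<in> vcomp M v" using x by (simp add: vcomp_def M.ract_closed)
  qed (use assms(2) in \<open>auto simp: vcomp_def M.ract_add_left\<close>)
qed

lemma ract_vcomp:
  assumes "right_module A M" "v \<in> V" "x \<in> carrier M"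
  shows "x \<triangleleft>\<^bsub>M\<^esub> \<epsilon> v \<in> vcomp M v"
proof -
  interpret M: right_module A M by fact
  show ?thesis using assms(2,3) \<epsilon>_mult[of v v] by (simp add: vcomp_def M.ract_closed M.ract_mult[symmetric])
qed

lemma ract_vcomp_other:
  assumes "right_module A M" "v \<in> V" "u \<in> V" "x \<in> vcomp M u" "u \<noteq> v"
  shows "x \<triangleleft>\<^bsub>M\<^esub> \<epsilon> v = \<zero>\<^bsub>M\<^esub>"
proof -
  interpret M: right_module A M by fact
  have "x \<triangleleft>\<^bsub>M\<^esub> \<epsilon> v = x \<triangleleft>\<^bsub>M\<^esub> (\<epsilon> u \<otimes> \<epsilon> v)"
    using assms by (simp add: vcomp_def M.ract_mult)
  then show ?thesis using assms by (simp add: \<epsilon>_mult vcomp_def)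
qed

lemma vcomp_decompose:
  assumes "right_module A M" "x \<in> carrier M"
  shows "x = finsum M (\<lambda>v. x \<triangleleft>\<^bsub>M\<^esub> \<epsilon> v) V"
proof -
  interpret M: right_module A M by fact
  have "x = x \<triangleleft>\<^bsub>M\<^esub> finsum A \<epsilon> V" using assms by (simp add: \<epsilon>_sum M.ract_one)
  then show ?thesis using M.ract_finsum_right[of \<epsilon> V x] assms by auto
qed

lemma rsubmodule_memI:
  assumes "right_module A M" "rsubmodule A M X" "x \<in> carrier M" "\<And>v. v \<in> V \<Longrightarrow> x \<triangleleft>\<^bsub>M\<^esub> \<epsilon> v \<in> X"
  shows "x \<in> X"
  using rsubmodule_finsum[OF assms(1,2), of "\<lambda>v. x \<triangleleft>\<^bsub>M\<^esub> \<epsilon> v" V] assms(4) vcomp_decompose[OF assms(1,3)]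
  by auto

text \<open>Homomorphisms commute with the idempotents, and a preimage of a vector at
  \<open>v\<close> may be replaced by its own component at \<open>v\<close>. This lets rank-nullity
  be applied vertex by vertex.\<close>

lemma image_vcomp:
  assumes "right_module A M" "right_module A N" "f \<in> rmod_hom A M N" "rsubmodule A M X" "v \<in> V"
  shows "f ` (X \<inter> vcomp M v) = f ` X \<inter> vcomp N v"
proof
  note Xd = rsubmoduleD[OF assms(4)] and fh = rmod_homD[OF assms(3)]
  have "f x \<triangleleft>\<^bsub>N\<^esub> \<epsilon> v = f x" if "x \<in> vcomp M v" for x
    using fh(3)[of x "\<epsilon> v"] that assms(5) by (simp add: vcomp_def)
  then show "f ` (X \<inter> vcomp M v) \<subseteq> f ` X \<inter> vcomp N v" using fh(1) by (auto simp: vcomp_def)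
  show "f ` X \<inter> vcomp N v \<subseteq> f ` (X \<inter> vcomp M v)"
  proof
    fix y assume "y \<in> f ` X \<inter> vcomp N v"
    then obtain x where x: "y = f x" "x \<in> X" "y \<triangleleft>\<^bsub>N\<^esub> \<epsilon> v = y" by (auto simp: vcomp_def)
    have "y = f (x \<triangleleft>\<^bsub>M\<^esub> \<epsilon> v)" using fh(3)[of x "\<epsilon> v"] x assms(5) Xd(1) by auto
    moreover have "x \<triangleleft>\<^bsub>M\<^esub> \<epsilon> v \<in> X \<inter> vcomp M v"
      using Xd(1,4) x assms(5) ract_vcomp[OF assms(1,5)] by auto
    ultimately show "y \<in> f ` (X \<inter> vcomp M v)" by blast
  qed
qed

lemma rad_rsubmodule:
  assumes "right_module A M"
  shows "rsubmodule A M (rad M)"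
proof -
  interpret M: right_module A M by fact
  have "carrier M \<in> {X. rsubmodule A M X \<and> (\<forall>x\<in>carrier M. \<forall>j\<in>J. x \<triangleleft>\<^bsub>M\<^esub> j \<in> X)}"
    using rsubmodule_carrier[OF assms] M.ract_closed J_carrier by auto
  then have "rad M \<subseteq> carrier M" unfolding rad_def by (rule Inter_lower)
  then show ?thesis
    by (rule rsubmoduleI[OF assms]) (auto simp: rad_def rsubmoduleD)
qed

lemma rad_mem: "x \<in> carrier M \<Longrightarrow> j \<in> J \<Longrightarrow> x \<triangleleft>\<^bsub>M\<^esub> j \<in> rad M"
  by (auto simp: rad_def)

lemma rad_least:
  "rsubmodule A M X \<Longrightarrow> (\<And>x j. x \<in> carrier M \<Longrightarrow> j \<in> J \<Longrightarrow> x \<triangleleft>\<^bsub>M\<^esub> j \<in> X) \<Longrightarrow> rad M \<subseteq> X"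
  by (auto simp: rad_def)

lemma ann_rsubmodule:
  assumes "right_module A M"
  shows "rsubmodule A M (ann M)"
proof -
  interpret M: right_module A M by fact
  show ?thesis
    by (rule rsubmoduleI[OF assms])
      (auto simp: ann_def M.ract_add_left M.ract_closed J_carrier J_ideal M.ract_mult[symmetric])
qed

text \<open>The form in which J^2 = 0 is used for modules: a product x j is killed by all of
  \<open>J\<close>.\<close>

lemma rad_subset_ann:
  assumes "right_module A M"
  shows "rad M \<subseteq> ann M"
proof -
  interpret M: right_module A M by fact
  show ?thesis
    by (rule rad_least[OF ann_rsubmodule[OF assms]])
      (auto simp: ann_def M.ract_closed J_carrier J_mult M.ract_mult[symmetric])
qed

lemma rad_hom:
  assumes "right_module A M" "right_module A N" "f \<in> rmod_hom A M N"
  shows "f ` rad M \<subseteq> rad N"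
proof -
  have "rad M \<subseteq> {x \<in> carrier M. f x \<in> rad N}"
  proof (rule rad_least[OF rsubmodule_vimage[OF assms rad_rsubmodule[OF assms(2)]]])
    interpret M: right_module A M by fact
    show "x \<triangleleft>\<^bsub>M\<^esub> j \<in> {x \<in> carrier M. f x \<in> rad N}" if "x \<in> carrier M" "j \<in> J" for x j
      using that rmod_homD[OF assms(3)] rad_mem[of "f x" N j] M.ract_closed J_carrier by auto
  qed
  then show ?thesis by auto
qed

lemma rad_surj:
  assumes "right_module A M" "right_module A N" "f \<in> rmod_hom A M N" "f ` carrier M = carrier N"
  shows "f ` rad M = rad N"
proof
  show "rad N \<subseteq> f ` rad M"
  proof (rule rad_least[OF rsubmodule_image[OF assms(1-3) rad_rsubmodule[OF assms(1)]]])
    fix y j assume "y \<in> carrier N" "j \<in> J"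
    then obtain x where x: "y = f x" "x \<in> carrier M" using assms(4) by auto
    then have "y \<triangleleft>\<^bsub>N\<^esub> j = f (x \<triangleleft>\<^bsub>M\<^esub> j)" using rmod_homD(3)[OF assms(3)] J_carrier \<open>j \<in> J\<close> by auto
    then show "y \<triangleleft>\<^bsub>N\<^esub> j \<in> f ` rad M" using rad_mem[OF x(2) \<open>j \<in> J\<close>] by auto
  qed
qed (rule rad_hom[OF assms(1-3)])

lemma ann_iso:
  assumes "right_module A M" "right_module A N" "f \<in> rmod_hom A M N" "bij_betw f (carrier M) (carrier N)"
  shows "f ` ann M = ann N"
proof -
  interpret M: right_module A M by fact
  interpret N: right_module A N by fact
  have inj: "inj_on f (carrier M)" and im: "f ` carrier M = carrier N" using assms(4) by (auto simp: bij_betw_def)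
  have z: "f \<zero>\<^bsub>M\<^esub> = \<zero>\<^bsub>N\<^esub>" using rmod_hom_zero[OF M.abelian_group_axioms N.abelian_group_axioms assms(3)] .
  have "f x \<in> ann N \<longleftrightarrow> x \<in> ann M" if "x \<in> carrier M" for x
  proof -
    have "f x \<triangleleft>\<^bsub>N\<^esub> j = \<zero>\<^bsub>N\<^esub> \<longleftrightarrow> x \<triangleleft>\<^bsub>M\<^esub> j = \<zero>\<^bsub>M\<^esub>" if "j \<in> J" for j
      using rmod_homD(3)[OF assms(3) \<open>x \<in> carrier M\<close> J_carrier[OF that]] z
        inj_on_eq_iff[OF inj, of "x \<triangleleft>\<^bsub>M\<^esub> j" "\<zero>\<^bsub>M\<^esub>"] M.ract_closed[OF \<open>x \<in> carrier M\<close> J_carrier[OF that]] by auto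
    then show ?thesis using that rmod_homD(1)[OF assms(3)] by (auto simp: ann_def)
  qed
  note iff = this
  show ?thesis
  proof
    show "f ` ann M \<subseteq> ann N" using iff by (auto simp: ann_def[of M])
    show "ann N \<subseteq> f ` ann M"
    proof
      fix y assume y: "y \<in> ann N"
      then have "y \<in> f ` carrier M" using im by (simp add: ann_def)
      then show "y \<in> f ` ann M" using iff y by auto
    qed
  qed
qed

text \<open>Write y = x + r with \<open>r\<close> in \<open>rad M\<close>. Then r j = 0 because J^2
  = 0, so y j = x j lies in \<open>X\<close>; hence \<open>X\<close> contains the radical and with
  it everything.\<close>

lemma nakayama:
  assumes M: "right_module A M" and X: "rsubmodule A M X"
    and gen: "\<And>y. y \<in> carrier M \<Longrightarrow> \<exists>x\<in>X. \<exists>r\<in>rad M. y = x \<oplus>\<^bsub>M\<^esub> r"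
  shows "X = carrier M"
proof -
  interpret M: right_module A M by fact
  note Xd = rsubmoduleD[OF X]
  have "rad M \<subseteq> X"
  proof (rule rad_least[OF X])
    fix y j assume y: "y \<in> carrier M" "j \<in> J"
    then obtain x r where *: "x \<in> X" "r \<in> rad M" "y = x \<oplus>\<^bsub>M\<^esub> r" using gen by blast
    have r: "r \<in> ann M" using * rad_subset_ann[OF M] by auto
    have "y \<triangleleft>\<^bsub>M\<^esub> j = x \<triangleleft>\<^bsub>M\<^esub> j \<oplus>\<^bsub>M\<^esub> r \<triangleleft>\<^bsub>M\<^esub> j"
      using * r Xd(1) y J_carrier by (auto simp: ann_def M.ract_add_left)
    then show "y \<triangleleft>\<^bsub>M\<^esub> j \<in> X"
      using r y(2) * Xd(1,4) J_carrier[OF y(2)] M.ract_closed by (auto simp: ann_def)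
  qed
  then have "carrier M \<subseteq> X" using gen Xd(3) by blast
  then show ?thesis using Xd(1) by auto
qed

section \<open>Dimension vectors and their additivity\<close>

definition dimV :: "('a, 'm) rmod \<Rightarrow> 'v \<Rightarrow> nat" where "dimV M v = vdim M (vcomp M v)"
definition dimR :: "('a, 'm) rmod \<Rightarrow> 'v \<Rightarrow> nat" where "dimR M v = vdim M (rad M \<inter> vcomp M v)"
definition dimS :: "('a, 'm) rmod \<Rightarrow> 'v \<Rightarrow> nat" where "dimS M v = vdim M (ann M \<inter> vcomp M v)"

lemma vdim_inj_image:
  assumes "right_module A M" "right_module A N" "f \<in> rmod_hom A M N" "fd M" "ksub M X" "inj_on f X"
  shows "vdim N (f ` X) = vdim M X"
proof -
  interpret M: right_module A M by fact
  interpret N: right_module A N by fact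
  have z: "f \<zero>\<^bsub>M\<^esub> = \<zero>\<^bsub>N\<^esub>" using rmod_hom_zero[OF M.abelian_group_axioms N.abelian_group_axioms assms(3)] .
  have "{x \<in> X. f x = \<zero>\<^bsub>N\<^esub>} = {\<zero>\<^bsub>M\<^esub>}"
  proof safe
    fix x assume "x \<in> X" "f x = \<zero>\<^bsub>N\<^esub>"
    then show "x = \<zero>\<^bsub>M\<^esub>" using inj_onD[OF assms(6), of x "\<zero>\<^bsub>M\<^esub>"] z ksubD(2)[OF assms(5)] by simp
  qed (use z ksubD(2)[OF assms(5)] in auto)
  then show ?thesis using vdim_image_kernel[OF assms(1-5)] vdim_zero[OF assms(1)] by simp
qed

lemma dim_iso:
  assumes M: "right_module A M" and N: "right_module A N" and "fd M" and iso: "rmod_iso A M N" and v: "v \<in> V"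
  shows "dimV N v = dimV M v" "dimR N v = dimR M v" "dimS N v = dimS M v"
proof -
  obtain f where f: "f \<in> rmod_hom A M N" "bij_betw f (carrier M) (carrier N)"
    using iso by (auto simp: rmod_iso_def)
  have im: "f ` carrier M = carrier N" and inj: "inj_on f (carrier M)" using f(2) by (auto simp: bij_betw_def)
  have *: "vdim N (f ` X \<inter> vcomp N v) = vdim M (X \<inter> vcomp M v)" if X: "rsubmodule A M X" for X
  proof -
    have "ksub M (X \<inter> vcomp M v)" by (intro ksub_Int M rsubmodule_ksub X ksub_vcomp v)
    moreover have "inj_on f (X \<inter> vcomp M v)" using inj rsubmoduleD(1)[OF X] by (auto intro: inj_on_subset)
    ultimately show ?thesis
      using vdim_inj_image[OF M N f(1) \<open>fd M\<close>] image_vcomp[OF M N f(1) X v] by metis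
  qed
  have c: "carrier L \<inter> vcomp L v = vcomp L v" for L :: "('a, 'l) rmod" by (auto simp: vcomp_def)
  show "dimV N v = dimV M v" using *[OF rsubmodule_carrier[OF M]] im by (simp add: dimV_def c)
  show "dimR N v = dimR M v"
    using *[OF rad_rsubmodule[OF M]] rad_surj[OF M N f(1) im] by (simp add: dimR_def)
  show "dimS N v = dimS M v"
    using *[OF ann_rsubmodule[OF M]] ann_iso[OF M N f] by (simp add: dimS_def)
qed

text \<open>Rank-nullity for the first projection restricted to \<open>P \<times> Q\<close>: its
  image is \<open>P\<close>, and its kernel is a copy of \<open>Q\<close>.\<close>

lemma vdim_prod:
  assumes X: "right_module A X" and Y: "right_module A Y" and fd: "fd (rmod_sum X Y)"
    and P: "ksub X P" and Q: "ksub Y Q"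
  shows "vdim (rmod_sum X Y) (P \<times> Q) = vdim X P + vdim Y Q"
proof -
  note h = rmod_sum_homs[OF X Y] and S = rmod_sum_right_module[OF X Y]
  note Pd = ksubD[OF P] and Qd = ksubD[OF Q]
  interpret X: right_module A X by fact
  interpret Y: right_module A Y by fact
  have ne: "carrier X \<noteq> {}" using X.zero_closed by blast
  have fdY: "fd Y" using fd_image[OF S Y h(2) fd] by (simp add: snd_image_times ne)
  have "ksub (rmod_sum X Y) (P \<times> Q)"
    using Pd Qd by (intro ksubI[OF S]) auto
  from vdim_image_kernel[OF S X h(1) fd this]
  have "vdim (rmod_sum X Y) (P \<times> Q) = vdim X (fst ` (P \<times> Q)) + vdim (rmod_sum X Y) {x \<in> P \<times> Q. fst x = \<zero>\<^bsub>X\<^esub>}" .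
  moreover have "fst ` (P \<times> Q) = P" using Qd(2) by force
  moreover have "{x \<in> P \<times> Q. fst x = \<zero>\<^bsub>X\<^esub>} = (\<lambda>y. (\<zero>\<^bsub>X\<^esub>, y)) ` Q" using Pd(2) by auto
  moreover have "vdim (rmod_sum X Y) ((\<lambda>y. (\<zero>\<^bsub>X\<^esub>, y)) ` Q) = vdim Y Q"
    by (rule vdim_inj_image[OF Y S h(4) fdY Q]) (auto simp: inj_on_def)
  ultimately show ?thesis by simp
qed

text \<open>For the radical, functoriality is enough: the projections bound it from above and the
  injections from below.\<close>

lemma sum_structure:
  assumes X: "right_module A X" and Y: "right_module A Y"
  shows "vcomp (rmod_sum X Y) v = vcomp X v \<times> vcomp Y v"
    "rad (rmod_sum X Y) = rad X \<times> rad Y"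
    "ann (rmod_sum X Y) = ann X \<times> ann Y"
proof -
  note h = rmod_sum_homs[OF X Y] and S = rmod_sum_right_module[OF X Y]
  interpret X: right_module A X by fact
  interpret Y: right_module A Y by fact
  show "vcomp (rmod_sum X Y) v = vcomp X v \<times> vcomp Y v" by (auto simp: vcomp_def)
  show "ann (rmod_sum X Y) = ann X \<times> ann Y" by (auto simp: ann_def J_zero)
  have rX: "rad X \<subseteq> carrier X" and rY: "rad Y \<subseteq> carrier Y"
    using rsubmoduleD(1) rad_rsubmodule X Y by blast+
  show "rad (rmod_sum X Y) = rad X \<times> rad Y"
  proof
    show "rad (rmod_sum X Y) \<subseteq> rad X \<times> rad Y"
      using rad_hom[OF S X h(1)] rad_hom[OF S Y h(2)] by force
    show "rad X \<times> rad Y \<subseteq> rad (rmod_sum X Y)"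
    proof safe
      fix x y assume xy: "x \<in> rad X" "y \<in> rad Y"
      then have "(x, \<zero>\<^bsub>Y\<^esub>) \<in> rad (rmod_sum X Y)" "(\<zero>\<^bsub>X\<^esub>, y) \<in> rad (rmod_sum X Y)"
        using rad_hom[OF X S h(3)] rad_hom[OF Y S h(4)] by auto
      from rsubmoduleD(3)[OF rad_rsubmodule[OF S] this]
      show "(x, y) \<in> rad (rmod_sum X Y)" using xy rX rY by (auto simp: subset_iff)
    qed
  qed
qed

lemma dim_sum:
  assumes M: "right_module A M" and X: "right_module A X" and Y: "right_module A Y"
    and "fd M" and iso: "rmod_iso A M (rmod_sum X Y)" and v: "v \<in> V"
  shows "dimV M v = dimV X v + dimV Y v" "dimR M v = dimR X v + dimR Y v"
    "dimS M v = dimS X v + dimS Y v"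
proof -
  note S = rmod_sum_right_module[OF X Y]
  have fd: "fd (rmod_sum X Y)"
    using iso fd_image[OF M S _ \<open>fd M\<close>] unfolding rmod_iso_def bij_betw_def by blast
  note * = vdim_prod[OF X Y fd] and k = ksub_Int rsubmodule_ksub ksub_vcomp X Y rad_rsubmodule ann_rsubmodule v
  note i = dim_iso[OF M S \<open>fd M\<close> iso v]
  have "dimV (rmod_sum X Y) v = dimV X v + dimV Y v"
    unfolding dimV_def sum_structure[OF X Y] by (intro * k)
  then show "dimV M v = dimV X v + dimV Y v" using i(1) by simp
  have "dimR (rmod_sum X Y) v = dimR X v + dimR Y v"
    unfolding dimR_def sum_structure[OF X Y] Times_Int_Times by (intro * k)
  then show "dimR M v = dimR X v + dimR Y v" using i(2) by simp
  have "dimS (rmod_sum X Y) v = dimS X v + dimS Y v"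
    unfolding dimS_def sum_structure[OF X Y] Times_Int_Times by (intro * k)
  then show "dimS M v = dimS X v + dimS Y v" using i(3) by simp
qed

section \<open>Peirce components of the algebra\<close>

definition Auv :: "'v \<Rightarrow> 'v \<Rightarrow> 'a set" where
  "Auv u v = {a \<in> carrier A. \<epsilon> u \<otimes> a = a \<and> a \<otimes> \<epsilon> v = a}"

text \<open>\<open>bdim\<close> is the Cartan matrix, the dimension at \<open>v\<close> of the
  projective module \<open>\<epsilon> u\<close> A. Its part inside the radical is
  \<open>adim\<close>, for a quiver the number of arrows from \<open>u\<close> to \<open>v\<close>;
  this is the matrix T of the overview.\<close>

definition bdim :: "'v \<Rightarrow> 'v \<Rightarrow> nat" where "bdim u v = vdim (regular_rmod A) (Auv u v)"
definition adim :: "'v \<Rightarrow> 'v \<Rightarrow> nat" where "adim u v = vdim (regular_rmod A) (Auv u v \<inter> J)"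

lemma regular: "right_module A (regular_rmod A)"
  by (rule regular_right_module) (rule ring_axioms)

lemma \<kappa>_shift: "a \<in> carrier A \<Longrightarrow> b \<in> carrier A \<Longrightarrow> a \<otimes> \<kappa> c \<otimes> b = a \<otimes> b \<otimes> \<kappa> c"
  using \<kappa>_central[of b c] by (simp add: m_assoc)

lemma ksub_Auv: "u \<in> V \<Longrightarrow> v \<in> V \<Longrightarrow> ksub (regular_rmod A) (Auv u v)"
  by (rule ksubI[OF regular]) (auto simp: Auv_def l_distr r_distr \<kappa>_shift m_assoc[symmetric])

lemma rsubmodule_J: "rsubmodule A (regular_rmod A) J"
  by (rule rsubmoduleI[OF regular]) (auto simp: J_zero J_add J_ideal J_carrier)

text \<open>By multiplicativity, \<open>\<chi> w a\<close> equals
  \<open>\<chi> w (\<epsilon> u)\<close> times \<open>\<chi> w a\<close>, which vanishes for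
  \<open>w\<close> different from \<open>u\<close>; the same holds for \<open>v\<close> on the other
  side.\<close>

lemma Auv_\<chi>:
  assumes "u \<in> V" "v \<in> V" "w \<in> V" "a \<in> Auv u v" "\<chi> w a \<noteq> 0"
  shows "w = u \<and> w = v"
proof -
  have "\<chi> w (\<epsilon> u \<otimes> a) = \<chi> w a" "\<chi> w (a \<otimes> \<epsilon> v) = \<chi> w a" "a \<in> carrier A" using assms by (auto simp: Auv_def)
  then show ?thesis using assms by (auto simp: \<chi>_mult \<chi>_\<epsilon> split: if_splits)
qed

text \<open>Off the diagonal the Peirce component lies in \<open>J\<close>. On the diagonal the
  idempotent contributes exactly one further dimension.\<close>

lemma bdim_eq:
  assumes u: "u \<in> V" and v: "v \<in> V"
  shows "bdim u v = adim u v + (if u = v then 1 else 0)"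
proof (cases "u = v")
  case False
  have "Auv u v \<subseteq> J" using Auv_\<chi>[OF u v] False by (auto simp: J_def Auv_def)
  then show ?thesis using False by (simp add: bdim_def adim_def Int_absorb2)
next
  case True
  have k: "ksub (regular_rmod A) (Auv u u \<inter> J)"
    by (intro ksub_Int regular ksub_Auv u rsubmodule_ksub rsubmodule_J)
  have \<epsilon>: "\<epsilon> u \<in> Auv u u" "\<epsilon> u \<notin> J" using u by (auto simp: Auv_def \<epsilon>_mult J_def \<chi>_\<epsilon>)
  have "{r \<oplus> \<epsilon> u \<otimes> \<kappa> c | r c. r \<in> Auv u u \<inter> J} = Auv u u"
  proof
    show "{r \<oplus> \<epsilon> u \<otimes> \<kappa> c | r c. r \<in> Auv u u \<inter> J} \<subseteq> Auv u u"
      using ksubD(3,4)[OF ksub_Auv[OF u u]] \<epsilon>(1) by auto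
    show "Auv u u \<subseteq> {r \<oplus> \<epsilon> u \<otimes> \<kappa> c | r c. r \<in> Auv u u \<inter> J}"
    proof
      fix a assume a: "a \<in> Auv u u"
      then have aA: "a \<in> carrier A" by (simp add: Auv_def)
      \<comment> \<open>Removing the multiple \<open>\<chi> u a\<close> of the idempotent makes all
        characters vanish, so the remainder is in \<open>J\<close>.\<close>
      define r where "r = a \<oplus> \<epsilon> u \<otimes> \<kappa> (- \<chi> u a)"
      have r: "r \<in> Auv u u"
        unfolding r_def using ksubD(3,4)[OF ksub_Auv[OF u u]] \<epsilon>(1) a by auto
      have "\<chi> w r = 0" if w: "w \<in> V" for w
      proof (cases "w = u")
        case True
        then show ?thesis using u aA by (simp add: r_def \<chi>_add \<chi>_mult \<chi>_\<epsilon> \<chi>_\<kappa>)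
      qed (use Auv_\<chi>[OF u u w r] in auto)
      then have "r \<in> J" using r by (simp add: J_def Auv_def)
      moreover have "a = r \<oplus> \<epsilon> u \<otimes> \<kappa> (\<chi> u a)"
      proof -
        have "\<epsilon> u \<otimes> \<kappa> (- \<chi> u a) \<oplus> \<epsilon> u \<otimes> \<kappa> (\<chi> u a) = \<epsilon> u \<otimes> \<kappa> (- \<chi> u a + \<chi> u a)"
          using u by (simp only: \<kappa>_add r_distr \<epsilon>_closed \<kappa>_closed)
        also have "\<dots> = \<zero>" using u by (simp add: \<kappa>_zero)
        finally show ?thesis using u aA by (simp add: r_def a_assoc)
      qed
      ultimately show "a \<in> {r \<oplus> \<epsilon> u \<otimes> \<kappa> c | r c. r \<in> Auv u u \<inter> J}" using r by blast
    qed
  qed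
  moreover have "vdim (regular_rmod A) {r \<oplus> \<epsilon> u \<otimes> \<kappa> c | r c. r \<in> Auv u u \<inter> J} = Suc (adim u u)"
    using vdim_sum_line[OF regular fd_regular k, of "\<epsilon> u"] u \<epsilon> by (simp add: adim_def)
  ultimately show ?thesis using True by (simp add: bdim_def)
qed

text \<open>
  \<open>top_mult M v\<close> counts the copies of \<open>\<epsilon>\<^bsub>v\<^esub> A\<close> in the projective cover \<open>P\<close> of \<open>M\<close>, so \<open>syz_dim M v\<close> is
  \<open>dim P\<epsilon>\<^bsub>v\<^esub> - dim M\<epsilon>\<^bsub>v\<^esub> = dim (\<Omega> M)\<epsilon>\<^bsub>v\<^esub>\<close>. As \<open>J\<close> annihilates \<open>M J\<close>, \<open>soc_mult M v\<close> is the multiplicity of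
  the simple module at \<open>v\<close> as a direct summand of \<open>M\<close>; both are defined so as to be visibly
  additive, which makes the Krull-Schmidt theorem unnecessary.
\<close>

definition top_mult :: "('a, 'm) rmod \<Rightarrow> 'v \<Rightarrow> int" where
  "top_mult M v = int (dimV M v) - int (dimR M v)"

definition syz_dim :: "('a, 'm) rmod \<Rightarrow> 'v \<Rightarrow> int" where
  "syz_dim M v = (\<Sum>u\<in>V. top_mult M u * int (bdim u v)) - int (dimV M v)"

definition soc_mult :: "('a, 'm) rmod \<Rightarrow> 'v \<Rightarrow> int" where
  "soc_mult M v = int (dimS M v) - int (dimR M v)"

lemma
  assumes "right_module A M" "right_module A N" "fd M" "rmod_iso A M N" "v \<in> V"
  shows syz_dim_iso: "syz_dim N v = syz_dim M v"
    and soc_mult_iso: "soc_mult N v = soc_mult M v"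
  using dim_iso[OF assms(1-4)] assms(5) by (simp_all add: top_mult_def syz_dim_def soc_mult_def)

lemma
  assumes "right_module A M" "right_module A X" "right_module A Y"
    "fd M" "rmod_iso A M (rmod_sum X Y)" "v \<in> V"
  shows syz_dim_sum: "syz_dim M v = syz_dim X v + syz_dim Y v"
    and soc_mult_sum: "soc_mult M v = soc_mult X v + soc_mult Y v"
proof -
  have "top_mult M u = top_mult X u + top_mult Y u" if "u \<in> V" for u
    using dim_sum[OF assms(1-5) that] by (simp add: top_mult_def)
  then have "(\<Sum>u\<in>V. top_mult M u * int (bdim u v)) =
     (\<Sum>u\<in>V. top_mult X u * int (bdim u v)) + (\<Sum>u\<in>V. top_mult Y u * int (bdim u v))"
    by (simp add: sum.distrib[symmetric] distrib_right)
  then show "syz_dim M v = syz_dim X v + syz_dim Y v" using dim_sum[OF assms] by (simp add: syz_dim_def)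
  show "soc_mult M v = soc_mult X v + soc_mult Y v" using dim_sum[OF assms] by (simp add: soc_mult_def)
qed

section \<open>Projective covers and syzygies\<close>

text \<open>The characters other than \<open>\<chi> u\<close> vanish on \<open>\<epsilon> u\<close>
  A, so subtracting a multiple of the idempotent leads into \<open>J\<close>. Consequently
  \<open>\<epsilon> u\<close> A has a one-dimensional top.\<close>

lemma left_decomp:
  assumes u: "u \<in> V" and a: "a \<in> carrier A" "\<epsilon> u \<otimes> a = a"
  obtains r where "r \<in> J" "a = \<epsilon> u \<otimes> \<kappa> (\<chi> u a) \<oplus> r"
proof
  let ?r = "\<epsilon> u \<otimes> \<kappa> (- \<chi> u a) \<oplus> a"
  have "\<chi> w ?r = 0" if w: "w \<in> V" for w
  proof (cases "w = u")
    case False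
    then have "\<chi> w a = 0" using \<chi>_mult[OF w, of "\<epsilon> u" a] u a w by (simp add: \<chi>_\<epsilon>)
    then show ?thesis using False w u a by (simp add: \<chi>_add \<chi>_mult \<chi>_\<epsilon>)
  qed (use u a in \<open>simp add: \<chi>_add \<chi>_mult \<chi>_\<epsilon> \<chi>_\<kappa>\<close>)
  then show "?r \<in> J" using u a by (simp add: J_def)
  have "\<epsilon> u \<otimes> \<kappa> (\<chi> u a) \<oplus> \<epsilon> u \<otimes> \<kappa> (- \<chi> u a) = \<epsilon> u \<otimes> \<kappa> (\<chi> u a + - \<chi> u a)"
    using u by (simp only: \<kappa>_add r_distr \<epsilon>_closed \<kappa>_closed)
  also have "\<dots> = \<zero>" using u by (simp add: \<kappa>_zero)
  finally show "a = \<epsilon> u \<otimes> \<kappa> (\<chi> u a) \<oplus> ?r" using u a by (simp add: a_assoc[symmetric])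
qed

text \<open>The projective module \<open>\<Oplus>\<^bsub>i<n\<^esub> \<epsilon>\<^bsub>u i\<^esub> A\<close>, its vectors being extended by zero beyond \<open>n\<close>.\<close>

definition fmod :: "nat \<Rightarrow> (nat \<Rightarrow> 'v) \<Rightarrow> ('a, nat \<Rightarrow> 'a) rmod" where
  "fmod n u = \<lparr>carrier = {f. (\<forall>i<n. f i \<in> carrier A \<and> \<epsilon> (u i) \<otimes> f i = f i) \<and> (\<forall>i\<ge>n. f i = \<zero>)},
     monoid.mult = undefined, one = undefined, zero = (\<lambda>_. \<zero>), add = (\<lambda>f g i. f i \<oplus> g i),
     ract = (\<lambda>f a i. f i \<otimes> a)\<rparr>"

lemma fmod_simps:
  "carrier (fmod n u) = {f. (\<forall>i<n. f i \<in> carrier A \<and> \<epsilon> (u i) \<otimes> f i = f i) \<and> (\<forall>i\<ge>n. f i = \<zero>)}"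
  "\<zero>\<^bsub>fmod n u\<^esub> = (\<lambda>_. \<zero>)" "f \<oplus>\<^bsub>fmod n u\<^esub> g = (\<lambda>i. f i \<oplus> g i)" "f \<triangleleft>\<^bsub>fmod n u\<^esub> a = (\<lambda>i. f i \<otimes> a)"
  by (simp_all add: fmod_def)

lemma fmod_coord: "f \<in> carrier (fmod n u) \<Longrightarrow> f i \<in> carrier A"
  by (cases "i < n") (auto simp: fmod_simps)

lemma fmod_right_module:
  assumes u: "\<And>i. i < n \<Longrightarrow> u i \<in> V"
  shows "right_module A (fmod n u)"
proof (rule right_moduleI)
  show "abelian_group (fmod n u)"
  proof (rule abelian_groupI)
    fix f g assume fg: "f \<in> carrier (fmod n u)" "g \<in> carrier (fmod n u)"
    then show "f \<oplus>\<^bsub>fmod n u\<^esub> g \<in> carrier (fmod n u)" using u by (auto simp: fmod_simps r_distr)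
    show "f \<oplus>\<^bsub>fmod n u\<^esub> g = g \<oplus>\<^bsub>fmod n u\<^esub> f"
      using fmod_coord[OF fg(1)] fmod_coord[OF fg(2)] by (simp add: fmod_simps(3) a_comm)
  next
    fix f g h assume "f \<in> carrier (fmod n u)" "g \<in> carrier (fmod n u)" "h \<in> carrier (fmod n u)"
    then have "\<And>i. f i \<in> carrier A" "\<And>i. g i \<in> carrier A" "\<And>i. h i \<in> carrier A"
      by (simp_all add: fmod_coord)
    then show "f \<oplus>\<^bsub>fmod n u\<^esub> g \<oplus>\<^bsub>fmod n u\<^esub> h = f \<oplus>\<^bsub>fmod n u\<^esub> (g \<oplus>\<^bsub>fmod n u\<^esub> h)"
      by (simp add: fmod_simps(3) a_assoc)
  next
    show "\<zero>\<^bsub>fmod n u\<^esub> \<in> carrier (fmod n u)" using u by (simp add: fmod_simps)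
  next
    fix f assume f: "f \<in> carrier (fmod n u)"
    show "\<zero>\<^bsub>fmod n u\<^esub> \<oplus>\<^bsub>fmod n u\<^esub> f = f" using fmod_coord[OF f] by (simp add: fmod_simps(2,3))
    have "(\<lambda>i. \<ominus> f i) \<in> carrier (fmod n u)" using f u by (auto simp: fmod_simps(1) r_minus)
    moreover have "(\<lambda>i. \<ominus> f i) \<oplus>\<^bsub>fmod n u\<^esub> f = \<zero>\<^bsub>fmod n u\<^esub>"
      using fmod_coord[OF f] by (simp add: fmod_simps(2,3) l_neg)
    ultimately show "\<exists>g\<in>carrier (fmod n u). g \<oplus>\<^bsub>fmod n u\<^esub> f = \<zero>\<^bsub>fmod n u\<^esub>" by blast
  qed
next
  fix f a assume fa: "f \<in> carrier (fmod n u)" "a \<in> carrier A"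
  then show "f \<triangleleft>\<^bsub>fmod n u\<^esub> a \<in> carrier (fmod n u)" using u by (auto simp: fmod_simps m_assoc[symmetric])
  note f = fmod_coord[OF fa(1)]
  fix b assume b: "b \<in> carrier A"
  show "f \<triangleleft>\<^bsub>fmod n u\<^esub> (a \<oplus> b) = (f \<triangleleft>\<^bsub>fmod n u\<^esub> a) \<oplus>\<^bsub>fmod n u\<^esub> (f \<triangleleft>\<^bsub>fmod n u\<^esub> b)"
    "f \<triangleleft>\<^bsub>fmod n u\<^esub> (a \<otimes> b) = f \<triangleleft>\<^bsub>fmod n u\<^esub> a \<triangleleft>\<^bsub>fmod n u\<^esub> b"
    using f fa(2) b by (simp_all add: fmod_simps(3,4) r_distr m_assoc)
next
  fix f g a assume "f \<in> carrier (fmod n u)" "g \<in> carrier (fmod n u)" "a \<in> carrier A"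
  then show "(f \<oplus>\<^bsub>fmod n u\<^esub> g) \<triangleleft>\<^bsub>fmod n u\<^esub> a = (f \<triangleleft>\<^bsub>fmod n u\<^esub> a) \<oplus>\<^bsub>fmod n u\<^esub> (g \<triangleleft>\<^bsub>fmod n u\<^esub> a)"
    using fmod_coord[of f n u] fmod_coord[of g n u] by (simp add: fmod_simps(3,4) l_distr)
next
  fix f assume "f \<in> carrier (fmod n u)"
  then show "f \<triangleleft>\<^bsub>fmod n u\<^esub> \<one> = f" using fmod_coord by (simp add: fmod_simps(4))
qed (rule ring_axioms)

lemma fmod_coord_hom: "(\<lambda>f. f i) \<in> rmod_hom A (fmod n u) (regular_rmod A)"
  by (rule rmod_homI) (auto simp: fmod_coord fmod_simps(3,4))

definition fbasis :: "(nat \<Rightarrow> 'v) \<Rightarrow> nat \<Rightarrow> nat \<Rightarrow> 'a" where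
  "fbasis u i = (\<lambda>j. if j = i then \<epsilon> (u i) else \<zero>)"

lemma fbasis_carrier: "(\<And>i. i < n \<Longrightarrow> u i \<in> V) \<Longrightarrow> i < n \<Longrightarrow> fbasis u i \<in> carrier (fmod n u)"
  by (auto simp: fbasis_def fmod_simps \<epsilon>_mult)

text \<open>Compared coordinate by coordinate: the coordinates are homomorphisms to the regular
  module, and only the summand with the same index contributes.\<close>

lemma fmod_decompose:
  assumes u: "\<And>i. i < n \<Longrightarrow> u i \<in> V" and f: "f \<in> carrier (fmod n u)"
  shows "f = finsum (fmod n u) (\<lambda>i. fbasis u i \<triangleleft>\<^bsub>fmod n u\<^esub> f i) {..<n}"
proof
  fix j
  interpret F: right_module A "fmod n u" by (rule fmod_right_module) (rule u)
  interpret R: right_module A "regular_rmod A" by (rule regular)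
  have c: "(\<lambda>i. fbasis u i \<triangleleft>\<^bsub>fmod n u\<^esub> f i) \<in> {..<n} \<rightarrow> carrier (fmod n u)"
    using fbasis_carrier[of n u] u fmod_coord[OF f] F.ract_closed by auto
  have "finsum (fmod n u) (\<lambda>i. fbasis u i \<triangleleft>\<^bsub>fmod n u\<^esub> f i) {..<n} j =
        finsum (regular_rmod A) (\<lambda>i. (fbasis u i \<triangleleft>\<^bsub>fmod n u\<^esub> f i) j) {..<n}"
    by (rule rmod_hom_finsum[OF F.abelian_group_axioms R.abelian_group_axioms fmod_coord_hom c])
  also have "\<dots> = finsum (regular_rmod A) (\<lambda>i. if j = i then f i else \<zero>\<^bsub>regular_rmod A\<^esub>) {..<n}"
    using f by (intro R.M.finsum_cong') (auto simp: fbasis_def fmod_simps fmod_coord[OF f])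
  also have "\<dots> = f j"
  proof (cases "j < n")
    case True
    then show ?thesis using fmod_coord[OF f] by (intro R.M.finsum_singleton) auto
  next
    case False
    have "finsum (regular_rmod A) (\<lambda>i. if j = i then f i else \<zero>\<^bsub>regular_rmod A\<^esub>) {..<n} = \<zero>\<^bsub>regular_rmod A\<^esub>"
      using False by (intro R.M.finsum_all0) auto
    then show ?thesis using False f by (simp add: fmod_simps)
  qed
  finally show "f j = finsum (fmod n u) (\<lambda>i. fbasis u i \<triangleleft>\<^bsub>fmod n u\<^esub> f i) {..<n} j" by simp
qed

lemma fd_fmod:
  assumes u: "\<And>i. i < n \<Longrightarrow> u i \<in> V"
  shows "fd (fmod n u)"
proof (rule fd_if_finitely_generated)
  show F: "right_module A (fmod n u)" by (rule fmod_right_module) (rule u)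
  show "finitely_generated A (fmod n u)" unfolding finitely_generated_def
  proof (intro exI[of _ "fbasis u ` {..<n}"] conjI allI impI)
    show "fbasis u ` {..<n} \<subseteq> carrier (fmod n u)" using fbasis_carrier[of n u] u by auto
    fix X assume X: "rsubmodule A (fmod n u) X \<and> fbasis u ` {..<n} \<subseteq> X"
    have "f \<in> X" if f: "f \<in> carrier (fmod n u)" for f
    proof -
      have "(\<lambda>i. fbasis u i \<triangleleft>\<^bsub>fmod n u\<^esub> f i) \<in> {..<n} \<rightarrow> X"
        using X fmod_coord[OF f] rsubmoduleD(4)[of A "fmod n u" X] by auto
      from rsubmodule_finsum[OF F conjunct1[OF X] this] show ?thesis
        by (simp only: fmod_decompose[OF u f, symmetric])
    qed
    then show "X = carrier (fmod n u)" using X rsubmoduleD(1) by blast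
  qed simp
qed

text \<open>The homomorphism out of \<open>fmod n u\<close> that sends the basis vector
  \<open>fbasis u i\<close> to \<open>x i\<close> times \<open>\<epsilon> (u i)\<close>.\<close>

definition fhom :: "('a, 'm) rmod \<Rightarrow> nat \<Rightarrow> (nat \<Rightarrow> 'm) \<Rightarrow> (nat \<Rightarrow> 'a) \<Rightarrow> 'm" where
  "fhom M n x f = finsum M (\<lambda>i. x i \<triangleleft>\<^bsub>M\<^esub> f i) {..<n}"

lemma fhom_hom:
  assumes M: "right_module A M" and x: "\<And>i. i < n \<Longrightarrow> x i \<in> carrier M"
  shows "fhom M n x \<in> rmod_hom A (fmod n u) M"
proof -
  interpret M: right_module A M by fact
  have c: "(\<lambda>i. x i \<triangleleft>\<^bsub>M\<^esub> f i) \<in> {..<n} \<rightarrow> carrier M" if "f \<in> carrier (fmod n u)" for f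
    using x fmod_coord[OF that] M.ract_closed by auto
  show ?thesis
  proof (rule rmod_homI)
    fix f assume f: "f \<in> carrier (fmod n u)"
    then show "fhom M n x f \<in> carrier M" unfolding fhom_def by (intro M.M.finsum_closed c)
    show "fhom M n x (f \<triangleleft>\<^bsub>fmod n u\<^esub> a) = fhom M n x f \<triangleleft>\<^bsub>M\<^esub> a" if a: "a \<in> carrier A" for a
      unfolding fhom_def M.ract_finsum_left[OF c[OF f] a]
      using x fmod_coord[OF f] a M.ract_closed
      by (intro M.M.finsum_cong') (auto simp: fmod_simps(4) M.ract_mult)
    fix g assume g: "g \<in> carrier (fmod n u)"
    show "fhom M n x (f \<oplus>\<^bsub>fmod n u\<^esub> g) = fhom M n x f \<oplus>\<^bsub>M\<^esub> fhom M n x g"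
      unfolding fhom_def M.M.finsum_addf[OF c[OF f] c[OF g], symmetric]
      using x fmod_coord[OF f] fmod_coord[OF g] M.ract_closed
      by (intro M.M.finsum_cong') (auto simp: fmod_simps(3) M.ract_add_right)
  qed
qed

text \<open>Projectivity of \<open>fmod n u\<close>: preimages of the images of the basis vectors
  are chosen, and the basis vectors determine a homomorphism. The source here may have any carrier
  type, in contrast to \<open>projective\<close>.\<close>

lemma fmod_lifting:
  assumes u: "\<And>i. i < n \<Longrightarrow> u i \<in> V"
    and M: "right_module A M" and N: "right_module A N" and f: "f \<in> rmod_hom A M N"
    and surj: "f ` carrier M = carrier N" and g: "g \<in> rmod_hom A (fmod n u) N"
  obtains h where "h \<in> rmod_hom A (fmod n u) M" "\<And>p. p \<in> carrier (fmod n u) \<Longrightarrow> f (h p) = g p"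
proof -
  interpret M: right_module A M by fact
  interpret N: right_module A N by fact
  interpret F: right_module A "fmod n u" by (rule fmod_right_module) (rule u)
  have fb: "\<And>i. i < n \<Longrightarrow> fbasis u i \<in> carrier (fmod n u)" using fbasis_carrier[of n u] u by auto
  have "\<exists>y. y \<in> carrier M \<and> f y = g (fbasis u i)" if "i < n" for i
    using surj rmod_homD(1)[OF g fb[OF that]] by (metis image_iff)
  then obtain x where x: "\<And>i. i < n \<Longrightarrow> x i \<in> carrier M" "\<And>i. i < n \<Longrightarrow> f (x i) = g (fbasis u i)"
    by metis
  show thesis
  proof (rule that[OF fhom_hom[OF M x(1)]])
    fix p assume p: "p \<in> carrier (fmod n u)"
    have "f (fhom M n x p) = finsum N (\<lambda>i. f (x i \<triangleleft>\<^bsub>M\<^esub> p i)) {..<n}"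
      unfolding fhom_def using x(1) fmod_coord[OF p] M.ract_closed
      by (intro rmod_hom_finsum[OF M.abelian_group_axioms N.abelian_group_axioms f]) auto
    also have "\<dots> = finsum N (\<lambda>i. g (fbasis u i \<triangleleft>\<^bsub>fmod n u\<^esub> p i)) {..<n}"
      using x fb fmod_coord[OF p] rmod_homD[OF g] rmod_homD(3)[OF f] F.ract_closed N.ract_closed
      by (intro N.M.finsum_cong') auto
    also have "\<dots> = g (finsum (fmod n u) (\<lambda>i. fbasis u i \<triangleleft>\<^bsub>fmod n u\<^esub> p i) {..<n})"
      using fb fmod_coord[OF p] F.ract_closed
      by (intro rmod_hom_finsum[OF F.abelian_group_axioms N.abelian_group_axioms g, symmetric]) auto
    finally show "f (fhom M n x p) = g p" by (simp only: fmod_decompose[OF u p, symmetric])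
  qed auto
qed

lemma fmod_J_subset_rad:
  assumes u: "\<And>i. i < n \<Longrightarrow> u i \<in> V" and f: "f \<in> carrier (fmod n u)" "\<And>i. i < n \<Longrightarrow> f i \<in> J"
  shows "f \<in> rad (fmod n u)"
proof -
  have F: "right_module A (fmod n u)" by (rule fmod_right_module) (rule u)
  have "(\<lambda>i. fbasis u i \<triangleleft>\<^bsub>fmod n u\<^esub> f i) \<in> {..<n} \<rightarrow> rad (fmod n u)"
    using f(2) fbasis_carrier[of n u] u by (auto intro!: rad_mem)
  from rsubmodule_finsum[OF F rad_rsubmodule[OF F] this] show ?thesis
    by (simp only: fmod_decompose[OF u f(1), symmetric])
qed

text \<open>States that \<open>\<epsilon> v\<close> J is nonzero. As paths are read from left to
  right, for a quiver this means that some arrow starts at \<open>v\<close>.\<close>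

definition nonsink :: "'v \<Rightarrow> bool" where
  "nonsink v \<longleftrightarrow> (\<exists>j\<in>J. \<epsilon> v \<otimes> j = j \<and> j \<noteq> \<zero>)"

text \<open>Suppose a vector at \<open>v\<close> is killed by \<open>J\<close> but has a coordinate
  outside \<open>J\<close>. Modulo \<open>J\<close> that coordinate is a nonzero multiple c of
  \<open>\<epsilon> v\<close>, so multiplying it by an element \<open>j\<close> of
  \<open>\<epsilon> v\<close> J gives c j, which is nonzero. Hence annihilator and radical agree at
  \<open>v\<close>.\<close>

lemma soc_mult_fmod:
  assumes u: "\<And>i. i < n \<Longrightarrow> u i \<in> V" and v: "v \<in> V" "nonsink v"
  shows "soc_mult (fmod n u) v = 0"
proof -
  have F: "right_module A (fmod n u)" by (rule fmod_right_module) (rule u)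
  obtain j where j: "j \<in> J" "\<epsilon> v \<otimes> j = j" "j \<noteq> \<zero>" using v(2) by (auto simp: nonsink_def)
  have "f \<in> rad (fmod n u)" if f: "f \<in> ann (fmod n u)" "f \<in> vcomp (fmod n u) v" for f
  proof (rule fmod_J_subset_rad[OF u])
    show fc: "f \<in> carrier (fmod n u)" using f by (simp add: ann_def)
    fix i assume i: "i < n"
    have "\<And>j. j \<in> J \<Longrightarrow> (\<lambda>i. f i \<otimes> j) = (\<lambda>_. \<zero>)" using f(1) by (simp add: ann_def fmod_simps(2,4))
    then have fj: "f i \<otimes> j = \<zero>" using j(1) by (metis (mono_tags))
    have "(\<lambda>i. f i \<otimes> \<epsilon> v) = f" using f(2) by (simp add: vcomp_def fmod_simps(4))
    then have fv: "f i \<otimes> \<epsilon> v = f i" by (metis (mono_tags))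
    have fu: "f i \<in> carrier A" "\<epsilon> (u i) \<otimes> f i = f i" using fc i by (auto simp: fmod_simps)
    then have fA: "f i \<in> Auv (u i) v" using fv by (simp add: Auv_def)
    show "f i \<in> J"
    proof (rule ccontr)
      assume "f i \<notin> J"
      then obtain w where w: "w \<in> V" "\<chi> w (f i) \<noteq> 0" using fu by (auto simp: J_def)
      with Auv_\<chi>[OF u[OF i] v(1) w(1) fA w(2)] have uv: "u i = v" "\<chi> v (f i) \<noteq> 0" by auto
      define c where "c = \<chi> v (f i)"
      obtain r where r: "r \<in> J" "f i = \<epsilon> v \<otimes> \<kappa> c \<oplus> r"
        using left_decomp[OF v(1) fu(1)] fu(2) uv(1) c_def by metis
      note cl = J_carrier[OF r(1)] J_carrier[OF j(1)]
      have "\<zero> = \<epsilon> v \<otimes> \<kappa> c \<otimes> j \<oplus> r \<otimes> j" using fj r v(1) cl by (simp add: l_distr)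
      also have "\<dots> = j \<otimes> \<kappa> c" using J_mult[OF r(1) j(1)] cl v(1) j(2) by (simp add: \<kappa>_shift)
      finally have "j \<otimes> \<kappa> c = \<zero>" by (rule sym)
      then have "j \<otimes> \<kappa> c \<otimes> \<kappa> (inverse c) = \<zero>" by simp
      then have "j \<otimes> \<kappa> (c * inverse c) = \<zero>" using cl by (simp add: \<kappa>_mult m_assoc)
      then show False using uv(2) j(3) cl by (simp add: c_def \<kappa>_one)
    qed
  qed
  then have "ann (fmod n u) \<inter> vcomp (fmod n u) v = rad (fmod n u) \<inter> vcomp (fmod n u) v"
    using rad_subset_ann[OF F] by auto
  then show ?thesis by (simp add: soc_mult_def dimS_def dimR_def)
qed

text \<open>Rank-nullity for the last coordinate: its image is a Peirce component, its kernel is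
  \<open>fmod\<close> with one summand fewer.\<close>

lemma dimV_fmod:
  assumes v: "v \<in> V"
  shows "(\<And>i. i < n \<Longrightarrow> u i \<in> V) \<Longrightarrow> dimV (fmod n u) v = (\<Sum>i<n. bdim (u i) v)"
proof (induction n)
  case 0
  have "vcomp (fmod 0 u) v = {\<zero>\<^bsub>fmod 0 u\<^esub>}" using v by (auto simp: vcomp_def fmod_simps)
  then show ?case using vdim_zero[OF fmod_right_module[of 0 u]] by (simp add: dimV_def)
next
  case (Suc n)
  let ?F = "fmod (Suc n) u" and ?G = "fmod n u"
  have u: "\<And>i. i < Suc n \<Longrightarrow> u i \<in> V" "\<And>i. i < n \<Longrightarrow> u i \<in> V" using Suc.prems by auto
  have F: "right_module A ?F" and G: "right_module A ?G" by (rule fmod_right_module; rule u; simp)+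
  have GF: "carrier ?G \<subseteq> carrier ?F" using u(1)[of n] by (auto simp: fmod_simps less_Suc_eq le_Suc_eq)
  have eq: "?G = ?F\<lparr>carrier := carrier ?G\<rparr>" by (simp add: fmod_def)
  have sub: "rsubmodule A ?F (carrier ?G)"
    using GF rsubmoduleD[OF rsubmodule_carrier[OF G]] by (intro rsubmoduleI[OF F]) (auto simp: fmod_simps(2-4))
  have "dimV ?F v = vdim (regular_rmod A) ((\<lambda>f. f n) ` vcomp ?F v) +
      vdim ?F {f \<in> vcomp ?F v. f n = \<zero>\<^bsub>regular_rmod A\<^esub>}"
    unfolding dimV_def
    by (rule vdim_image_kernel[OF F regular fmod_coord_hom fd_fmod ksub_vcomp[OF F v]]) (rule u)
  moreover have "(\<lambda>f. f n) ` vcomp ?F v = Auv (u n) v"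
  proof
    have "f n \<in> Auv (u n) v" if "f \<in> vcomp ?F v" for f
    proof -
      have "(\<lambda>i. f i \<otimes> \<epsilon> v) = f" using that by (simp add: vcomp_def fmod_simps(4))
      then have "f n \<otimes> \<epsilon> v = f n" by (metis (mono_tags))
      then show ?thesis using that by (auto simp: vcomp_def fmod_simps Auv_def)
    qed
    then show "(\<lambda>f. f n) ` vcomp ?F v \<subseteq> Auv (u n) v" by auto
    show "Auv (u n) v \<subseteq> (\<lambda>f. f n) ` vcomp ?F v"
    proof
      fix a assume "a \<in> Auv (u n) v"
      then have "(\<lambda>i. if i = n then a else \<zero>) \<in> vcomp ?F v"
        using u v by (auto simp: vcomp_def fmod_simps Auv_def)
      then show "a \<in> (\<lambda>f. f n) ` vcomp ?F v" by (rule rev_image_eqI) simp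
    qed
  qed
  moreover have "{f \<in> vcomp ?F v. f n = \<zero>\<^bsub>regular_rmod A\<^esub>} = vcomp ?G v"
    using GF u(1)[of n] by (auto simp: vcomp_def fmod_simps less_Suc_eq Suc_le_eq dest: le_neq_implies_less)
  moreover have "vdim ?F (vcomp ?G v) = dimV ?G v"
    unfolding dimV_def using vdim_restrict[OF F sub, of "vcomp ?G v"] eq by simp
  ultimately show ?case using Suc.IH u(2) by (simp add: bdim_def)
qed

text \<open>For \<open>R = rad M\<close> this yields a minimal homogeneous generating set; general
  \<open>R\<close> is needed for the induction on the codimension of \<open>R\<close>. The vectors
  \<open>x i\<close> lift a basis of M / R adapted to the vertices: together with \<open>R\<close>
  they generate \<open>M\<close>, they are independent modulo \<open>R\<close>, and their number at
  each vertex is the codimension of \<open>R\<close> there.\<close>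

lemma minimal_generators:
  assumes M: "right_module A M" and fdM: "fd M"
  shows "rsubmodule A M R \<Longrightarrow> rad M \<subseteq> R \<Longrightarrow>
    \<exists>(n :: nat) u x. (\<forall>i<n. u i \<in> V \<and> x i \<in> vcomp M (u i)) \<and>
      (\<forall>X. rsubmodule A M X \<and> R \<subseteq> X \<and> (\<forall>i<n. x i \<in> X) \<longrightarrow> X = carrier M) \<and>
      (\<forall>c. finsum M (\<lambda>i. x i \<triangleleft>\<^bsub>M\<^esub> \<kappa> (c i)) {..<n} \<in> R \<longrightarrow> (\<forall>i<n. c i = 0)) \<and>
      (\<forall>v\<in>V. card {i. i < n \<and> u i = v} + vdim M (R \<inter> vcomp M v) = dimV M v)"
proof (induction "vdim M (carrier M) - vdim M R" arbitrary: R rule: less_induct)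
  case (less R)
  interpret M: right_module A M by fact
  note R = less.prems(1) note Rd = rsubmoduleD[OF R]
  show ?case
  proof (cases "R = carrier M")
    case True
    have c: "\<And>v. carrier M \<inter> vcomp M v = vcomp M v" by (auto simp: vcomp_def)
    show ?thesis
      by (rule exI[of _ "0 :: nat"], rule exI, rule exI)
        (use True c in \<open>auto simp: dimV_def dest: rsubmoduleD(1)\<close>)
  next
    case False
    \<comment> \<open>An element is the sum of its vertex components, so if \<open>R\<close> is
      proper, some component of some element lies outside \<open>R\<close>.\<close>
    then obtain y v where y: "y \<in> carrier M" "v \<in> V" "y \<triangleleft>\<^bsub>M\<^esub> \<epsilon> v \<notin> R"
      using rsubmodule_memI[OF M R] Rd(1) by blast
    define x0 where "x0 = y \<triangleleft>\<^bsub>M\<^esub> \<epsilon> v"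
    have x0: "x0 \<in> vcomp M v" "x0 \<notin> R" "x0 \<in> carrier M"
      using y ract_vcomp[OF M y(2,1)] M.ract_closed by (auto simp: x0_def)
    have x0v: "x0 \<triangleleft>\<^bsub>M\<^esub> \<epsilon> v = x0" using x0 by (simp add: vcomp_def)
    define R' where "R' = {r \<oplus>\<^bsub>M\<^esub> x0 \<triangleleft>\<^bsub>M\<^esub> \<kappa> c | r c. r \<in> R}"
    have R'I: "\<And>r c. r \<in> R \<Longrightarrow> r \<oplus>\<^bsub>M\<^esub> x0 \<triangleleft>\<^bsub>M\<^esub> \<kappa> c \<in> R'" by (auto simp: R'_def)
    have kR: "ksub M R" by (rule rsubmodule_ksub[OF M R])
    have kR': "ksub M R'" unfolding R'_def by (rule ksub_sum_line[OF M kR x0(3)])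
    note R'd = ksubD[OF kR']
    have RR': "R \<subseteq> R'"
    proof
      fix r assume r: "r \<in> R"
      then have "r \<oplus>\<^bsub>M\<^esub> x0 \<triangleleft>\<^bsub>M\<^esub> \<kappa> 0 = r" using x0 Rd(1) by (simp add: \<kappa>_zero subset_iff)
      then show "r \<in> R'" using R'I[OF r, of 0] by simp
    qed
    \<comment> \<open>Modulo \<open>J\<close>, every element of \<open>\<epsilon> v\<close> A is a
      multiple of \<open>\<epsilon> v\<close>. So \<open>a\<close> moves \<open>x0\<close> to a
      multiple of \<open>x0\<close> plus an element of \<open>rad M\<close>, and \<open>R\<close>
      contains the radical.\<close>
    have R': "rsubmodule A M R'"
    proof (rule rsubmoduleI[OF M])
      fix z a assume z: "z \<in> R'" and a: "a \<in> carrier A"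
      then obtain r c where rc: "z = r \<oplus>\<^bsub>M\<^esub> x0 \<triangleleft>\<^bsub>M\<^esub> \<kappa> c" "r \<in> R" by (auto simp: R'_def)
      have rM: "r \<in> carrier M" using rc Rd(1) by auto
      let ?b = "\<epsilon> v \<otimes> (\<kappa> c \<otimes> a)"
      have b: "?b \<in> carrier A" "\<epsilon> v \<otimes> ?b = ?b"
        using a y(2) by (simp_all add: m_assoc[symmetric] \<epsilon>_mult)
      obtain s where s: "s \<in> J" "?b = \<epsilon> v \<otimes> \<kappa> (\<chi> v ?b) \<oplus> s" by (rule left_decomp[OF y(2) b])
      have "x0 \<triangleleft>\<^bsub>M\<^esub> \<kappa> c \<triangleleft>\<^bsub>M\<^esub> a = x0 \<triangleleft>\<^bsub>M\<^esub> ?b"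
        using x0 x0v a y(2) by (simp add: M.ract_mult)
      also have "\<dots> = x0 \<triangleleft>\<^bsub>M\<^esub> (\<epsilon> v \<otimes> \<kappa> (\<chi> v ?b) \<oplus> s)" using s(2) by simp
      also have "\<dots> = x0 \<triangleleft>\<^bsub>M\<^esub> (\<epsilon> v \<otimes> \<kappa> (\<chi> v ?b)) \<oplus>\<^bsub>M\<^esub> x0 \<triangleleft>\<^bsub>M\<^esub> s"
        using x0(3) y(2) J_carrier[OF s(1)] by (intro M.ract_add_right) auto
      also have "\<dots> = x0 \<triangleleft>\<^bsub>M\<^esub> \<kappa> (\<chi> v ?b) \<oplus>\<^bsub>M\<^esub> x0 \<triangleleft>\<^bsub>M\<^esub> s"
        using x0(3) x0v y(2) by (simp add: M.ract_mult)
      finally have *: "x0 \<triangleleft>\<^bsub>M\<^esub> \<kappa> c \<triangleleft>\<^bsub>M\<^esub> a = x0 \<triangleleft>\<^bsub>M\<^esub> \<kappa> (\<chi> v ?b) \<oplus>\<^bsub>M\<^esub> x0 \<triangleleft>\<^bsub>M\<^esub> s" .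
      have sR: "x0 \<triangleleft>\<^bsub>M\<^esub> s \<in> R" using rad_mem[OF x0(3) s(1)] less.prems(2) by auto
      have "z \<triangleleft>\<^bsub>M\<^esub> a = r \<triangleleft>\<^bsub>M\<^esub> a \<oplus>\<^bsub>M\<^esub> (x0 \<triangleleft>\<^bsub>M\<^esub> \<kappa> (\<chi> v ?b) \<oplus>\<^bsub>M\<^esub> x0 \<triangleleft>\<^bsub>M\<^esub> s)"
        unfolding *[symmetric] rc(1) using rM x0(3) a M.ract_closed by (intro M.ract_add_left) auto
      also have "\<dots> = (r \<triangleleft>\<^bsub>M\<^esub> a \<oplus>\<^bsub>M\<^esub> x0 \<triangleleft>\<^bsub>M\<^esub> s) \<oplus>\<^bsub>M\<^esub> x0 \<triangleleft>\<^bsub>M\<^esub> \<kappa> (\<chi> v ?b)"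
        using rM x0(3) a J_carrier[OF s(1)] M.ract_closed by (simp add: M.M.a_ac)
      finally show "z \<triangleleft>\<^bsub>M\<^esub> a \<in> R'" using R'I Rd(3)[OF Rd(4)[OF rc(2) a] sR] by simp
    qed (use R'd in auto)
    have "vdim M R' = Suc (vdim M R)"
      unfolding R'_def by (rule vdim_sum_line[OF M fdM kR x0(3,2)])
    moreover have "vdim M R' \<le> vdim M (carrier M)"
      by (rule vdim_mono[OF M fdM kR' ksub_carrier[OF M] R'd(1)])
    ultimately have lt: "vdim M (carrier M) - vdim M R' < vdim M (carrier M) - vdim M R" by simp
    \<comment> \<open>The new vector sits at the vertex \<open>v\<close>, so the dimension grows by
      one at \<open>v\<close> and nowhere else.\<close>
    have dimv: "vdim M (R' \<inter> vcomp M v) = Suc (vdim M (R \<inter> vcomp M v))"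
    proof -
      have "R' \<inter> vcomp M v = {r \<oplus>\<^bsub>M\<^esub> x0 \<triangleleft>\<^bsub>M\<^esub> \<kappa> c | r c. r \<in> R \<inter> vcomp M v}"
      proof
        show "{r \<oplus>\<^bsub>M\<^esub> x0 \<triangleleft>\<^bsub>M\<^esub> \<kappa> c | r c. r \<in> R \<inter> vcomp M v} \<subseteq> R' \<inter> vcomp M v"
          using R'I ksubD(3,4)[OF ksub_vcomp[OF M y(2)]] x0(1) by auto
        show "R' \<inter> vcomp M v \<subseteq> {r \<oplus>\<^bsub>M\<^esub> x0 \<triangleleft>\<^bsub>M\<^esub> \<kappa> c | r c. r \<in> R \<inter> vcomp M v}"
        proof
          fix z assume z: "z \<in> R' \<inter> vcomp M v"
          then obtain r c where rc: "z = r \<oplus>\<^bsub>M\<^esub> x0 \<triangleleft>\<^bsub>M\<^esub> \<kappa> c" "r \<in> R" by (auto simp: R'_def)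
          have rM: "r \<in> carrier M" using rc Rd(1) by auto
          have xc: "x0 \<triangleleft>\<^bsub>M\<^esub> \<kappa> c \<in> vcomp M v" using ksubD(4)[OF ksub_vcomp[OF M y(2)] x0(1)] .
          have "z = z \<triangleleft>\<^bsub>M\<^esub> \<epsilon> v" using z by (simp add: vcomp_def)
          also have "\<dots> = r \<triangleleft>\<^bsub>M\<^esub> \<epsilon> v \<oplus>\<^bsub>M\<^esub> x0 \<triangleleft>\<^bsub>M\<^esub> \<kappa> c"
            using rc(1) rM xc y(2) by (simp add: M.ract_add_left vcomp_def)
          finally show "z \<in> {r \<oplus>\<^bsub>M\<^esub> x0 \<triangleleft>\<^bsub>M\<^esub> \<kappa> c | r c. r \<in> R \<inter> vcomp M v}"
            using Rd(4)[OF rc(2)] ract_vcomp[OF M y(2) rM] y(2) by auto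
        qed
      qed
      then show ?thesis
        using vdim_sum_line[OF M fdM ksub_Int[OF M kR ksub_vcomp[OF M y(2)]] x0(3)] x0(2) by simp
    qed
    have dimw: "R' \<inter> vcomp M w = R \<inter> vcomp M w" if w: "w \<in> V" "w \<noteq> v" for w
    proof
      show "R' \<inter> vcomp M w \<subseteq> R \<inter> vcomp M w"
      proof
        fix z assume z: "z \<in> R' \<inter> vcomp M w"
        then obtain r c where rc: "z = r \<oplus>\<^bsub>M\<^esub> x0 \<triangleleft>\<^bsub>M\<^esub> \<kappa> c" "r \<in> R" by (auto simp: R'_def)
        have rM: "r \<in> carrier M" using rc Rd(1) by auto
        have xc: "x0 \<triangleleft>\<^bsub>M\<^esub> \<kappa> c \<in> vcomp M v" using ksubD(4)[OF ksub_vcomp[OF M y(2)] x0(1)] .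
        have "z = z \<triangleleft>\<^bsub>M\<^esub> \<epsilon> w" using z by (simp add: vcomp_def)
        also have "\<dots> = r \<triangleleft>\<^bsub>M\<^esub> \<epsilon> w \<oplus>\<^bsub>M\<^esub> x0 \<triangleleft>\<^bsub>M\<^esub> \<kappa> c \<triangleleft>\<^bsub>M\<^esub> \<epsilon> w"
          using rc(1) rM xc w(1) by (simp add: M.ract_add_left vcomp_def)
        also have "\<dots> = r \<triangleleft>\<^bsub>M\<^esub> \<epsilon> w"
          using ract_vcomp_other[OF M w(1) y(2) xc] w rM M.ract_closed by simp
        finally show "z \<in> R \<inter> vcomp M w" using Rd(4)[OF rc(2)] w(1) z by auto
      qed
    qed (use RR' in auto)
    obtain n u x where n0: "\<forall>i<(n::nat). u i \<in> V \<and> x i \<in> vcomp M (u i)"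
      "\<forall>X. rsubmodule A M X \<and> R' \<subseteq> X \<and> (\<forall>i<n. x i \<in> X) \<longrightarrow> X = carrier M"
      "\<forall>c. finsum M (\<lambda>i. x i \<triangleleft>\<^bsub>M\<^esub> \<kappa> (c i)) {..<n} \<in> R' \<longrightarrow> (\<forall>i<n. c i = 0)"
      "\<forall>v\<in>V. card {i. i < n \<and> u i = v} + vdim M (R' \<inter> vcomp M v) = dimV M v"
      using less.hyps[OF lt R' subset_trans[OF less.prems(2) RR']] by (elim exE conjE) (erule (3) that)
    have n: "\<And>i. i < n \<Longrightarrow> u i \<in> V \<and> x i \<in> vcomp M (u i)"
      "\<And>X. rsubmodule A M X \<Longrightarrow> R' \<subseteq> X \<Longrightarrow> (\<forall>i<n. x i \<in> X) \<Longrightarrow> X = carrier M"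
      "\<And>c. finsum M (\<lambda>i. x i \<triangleleft>\<^bsub>M\<^esub> \<kappa> (c i)) {..<n} \<in> R' \<Longrightarrow> \<forall>i<n. c i = 0"
      "\<And>v. v \<in> V \<Longrightarrow> card {i. i < n \<and> u i = v} + vdim M (R' \<inter> vcomp M v) = dimV M v"
      using n0 by simp_all
    have xM: "\<And>i. i < n \<Longrightarrow> x i \<in> carrier M" using n(1) by (auto simp: vcomp_def)
    let ?u = "u(n := v)" and ?x = "x(n := x0)"
    show ?thesis
    proof (intro exI[of _ "Suc n"] exI[of _ ?u] exI[of _ ?x] conjI allI impI ballI)
      fix i assume "i < Suc n"
      then show "?u i \<in> V" "?x i \<in> vcomp M (?u i)" using n(1) y(2) x0(1) by (auto simp: less_Suc_eq)
    next
      fix X assume X: "rsubmodule A M X \<and> R \<subseteq> X \<and> (\<forall>i<Suc n. ?x i \<in> X)"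
      note Xd = rsubmoduleD[OF conjunct1[OF X]]
      have "x0 \<in> X" using X by (metis fun_upd_same lessI)
      then have "R' \<subseteq> X" using X Xd(3,4) by (auto simp: R'_def)
      moreover have "\<forall>i<n. x i \<in> X" using X by (metis fun_upd_other less_SucI less_irrefl)
      ultimately show "X = carrier M" using n(2) X by blast
    next
      fix c i assume mem: "finsum M (\<lambda>i. ?x i \<triangleleft>\<^bsub>M\<^esub> \<kappa> (c i)) {..<Suc n} \<in> R" and i: "i < Suc n"
      \<comment> \<open>The part of the relation that involves the old vectors. It lies in
        \<open>R'\<close>, so its coefficients vanish by the induction hypothesis; what remains is a
        multiple of \<open>x0\<close> in \<open>R\<close>, which forces the last coefficient to
        vanish too.\<close>
      define s where "s = finsum M (\<lambda>i. x i \<triangleleft>\<^bsub>M\<^esub> \<kappa> (c i)) {..<n}"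
      have cl: "(\<lambda>i. x i \<triangleleft>\<^bsub>M\<^esub> \<kappa> (c i)) \<in> {..<n} \<rightarrow> carrier M" using xM M.ract_closed by auto
      have sM: "s \<in> carrier M" unfolding s_def by (rule M.M.finsum_closed[OF cl])
      have "finsum M (\<lambda>i. ?x i \<triangleleft>\<^bsub>M\<^esub> \<kappa> (c i)) {..<n} = s"
        unfolding s_def using cl by (intro M.M.finsum_cong') auto
      then have sum: "finsum M (\<lambda>i. ?x i \<triangleleft>\<^bsub>M\<^esub> \<kappa> (c i)) {..<Suc n} = x0 \<triangleleft>\<^bsub>M\<^esub> \<kappa> (c n) \<oplus>\<^bsub>M\<^esub> s"
        using cl x0(3) M.ract_closed by (simp add: lessThan_Suc M.M.finsum_insert Pi_iff)
      have neg: "x0 \<triangleleft>\<^bsub>M\<^esub> \<kappa> (c n) \<oplus>\<^bsub>M\<^esub> x0 \<triangleleft>\<^bsub>M\<^esub> \<kappa> (- c n) = \<zero>\<^bsub>M\<^esub>"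
        using x0(3) M.ract_add_right[of x0 "\<kappa> (c n)" "\<kappa> (- c n)"] by (simp add: \<kappa>_add[symmetric] \<kappa>_zero)
      have "s = (x0 \<triangleleft>\<^bsub>M\<^esub> \<kappa> (c n) \<oplus>\<^bsub>M\<^esub> x0 \<triangleleft>\<^bsub>M\<^esub> \<kappa> (- c n)) \<oplus>\<^bsub>M\<^esub> s" using neg sM by simp
      also have "\<dots> = (x0 \<triangleleft>\<^bsub>M\<^esub> \<kappa> (c n) \<oplus>\<^bsub>M\<^esub> s) \<oplus>\<^bsub>M\<^esub> x0 \<triangleleft>\<^bsub>M\<^esub> \<kappa> (- c n)"
        using x0(3) sM M.ract_closed by (simp add: M.M.a_ac)
      finally have seq: "s = (x0 \<triangleleft>\<^bsub>M\<^esub> \<kappa> (c n) \<oplus>\<^bsub>M\<^esub> s) \<oplus>\<^bsub>M\<^esub> x0 \<triangleleft>\<^bsub>M\<^esub> \<kappa> (- c n)" .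
      have "s \<in> R'" by (subst seq, rule R'I) (use mem sum in simp)
      then have c0: "\<forall>i<n. c i = 0" unfolding s_def by (rule n(3))
      then have "s = \<zero>\<^bsub>M\<^esub>" unfolding s_def using xM by (intro M.M.finsum_all0) (auto simp: \<kappa>_zero)
      then have x0R: "x0 \<triangleleft>\<^bsub>M\<^esub> \<kappa> (c n) \<in> R" using mem sum x0(3) M.ract_closed by simp
      have "c n = 0"
      proof (rule ccontr)
        assume cn: "c n \<noteq> 0"
        have "x0 \<triangleleft>\<^bsub>M\<^esub> \<kappa> (c n) \<triangleleft>\<^bsub>M\<^esub> \<kappa> (inverse (c n)) = x0 \<triangleleft>\<^bsub>M\<^esub> \<kappa> (c n * inverse (c n))"
          using x0(3) by (simp add: \<kappa>_mult M.ract_mult)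
        also have "\<dots> = x0" using cn x0(3) by (simp add: \<kappa>_one M.ract_one)
        finally show False using Rd(4)[OF x0R, of "\<kappa> (inverse (c n))"] x0(2) by simp
      qed
      with c0 i show "c i = 0" by (auto simp: less_Suc_eq)
    next
      fix w assume w: "w \<in> V"
      have "{i. i < Suc n \<and> ?u i = w} = (if w = v then insert n {i. i < n \<and> u i = w} else {i. i < n \<and> u i = w})"
        by (auto simp: less_Suc_eq)
      then have "card {i. i < Suc n \<and> ?u i = w} = card {i. i < n \<and> u i = w} + (if w = v then 1 else 0)"
        by simp
      then show "card {i. i < Suc n \<and> ?u i = w} + vdim M (R \<inter> vcomp M w) = dimV M w"
        using n(4)[OF w] dimv dimw[OF w] by (cases "w = v") auto
    qed
  qed
qed

text \<open>A generating set that is minimal modulo the radical defines a map from a standard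
  projective module. Nakayama's lemma makes it surjective, and independence modulo the radical
  pushes its kernel into the radical.\<close>

lemma cover_fmod:
  assumes M: "right_module A M" and fdM: "fd M"
  obtains n u x where "\<And>i. i < n \<Longrightarrow> u i \<in> V" "fhom M n x \<in> rmod_hom A (fmod n u) M"
    "fhom M n x ` carrier (fmod n u) = carrier M"
    "{f \<in> carrier (fmod n u). fhom M n x f = \<zero>\<^bsub>M\<^esub>} \<subseteq> rad (fmod n u)"
    "\<And>v. v \<in> V \<Longrightarrow> int (card {i. i < n \<and> u i = v}) = top_mult M v"
proof -
  interpret M: right_module A M by fact
  have radM: "rsubmodule A M (rad M)" by (rule rad_rsubmodule[OF M])
  note radD = rsubmoduleD[OF radM]
  obtain n u x where n0: "\<forall>i<(n::nat). u i \<in> V \<and> x i \<in> vcomp M (u i)"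
    "\<forall>X. rsubmodule A M X \<and> rad M \<subseteq> X \<and> (\<forall>i<n. x i \<in> X) \<longrightarrow> X = carrier M"
    "\<forall>c. finsum M (\<lambda>i. x i \<triangleleft>\<^bsub>M\<^esub> \<kappa> (c i)) {..<n} \<in> rad M \<longrightarrow> (\<forall>i<n. c i = 0)"
    "\<forall>v\<in>V. card {i. i < n \<and> u i = v} + vdim M (rad M \<inter> vcomp M v) = dimV M v"
    using minimal_generators[OF M fdM radM subset_refl] by (elim exE conjE) (erule (3) that)
  have n: "\<And>i. i < n \<Longrightarrow> u i \<in> V \<and> x i \<in> vcomp M (u i)"
    "\<And>X. rsubmodule A M X \<Longrightarrow> rad M \<subseteq> X \<Longrightarrow> (\<forall>i<n. x i \<in> X) \<Longrightarrow> X = carrier M"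
    "\<And>c. finsum M (\<lambda>i. x i \<triangleleft>\<^bsub>M\<^esub> \<kappa> (c i)) {..<n} \<in> rad M \<Longrightarrow> \<forall>i<n. c i = 0"
    "\<And>v. v \<in> V \<Longrightarrow> card {i. i < n \<and> u i = v} + vdim M (rad M \<inter> vcomp M v) = dimV M v"
    using n0 by simp_all
  have u: "\<And>i. i < n \<Longrightarrow> u i \<in> V" and xM: "\<And>i. i < n \<Longrightarrow> x i \<in> carrier M"
    and xu: "\<And>i. i < n \<Longrightarrow> x i \<triangleleft>\<^bsub>M\<^esub> \<epsilon> (u i) = x i" using n(1) by (auto simp: vcomp_def)
  let ?F = "fmod n u" and ?p = "fhom M n x"
  have F: "right_module A ?F" by (rule fmod_right_module) (rule u)
  interpret F: right_module A ?F by (rule F)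
  have p: "?p \<in> rmod_hom A ?F M" by (rule fhom_hom[OF M xM])
  define X where "X = ?p ` carrier ?F"
  have X: "rsubmodule A M X" unfolding X_def by (rule rsubmodule_image[OF F M p rsubmodule_carrier[OF F]])
  note Xd = rsubmoduleD[OF X]
  have xX: "x i \<in> X" if i: "i < n" for i
  proof -
    have "?p (fbasis u i) = finsum M (\<lambda>j. if i = j then x j else \<zero>\<^bsub>M\<^esub>) {..<n}"
      unfolding fhom_def using xM xu by (intro M.M.finsum_cong') (auto simp: fbasis_def)
    also have "\<dots> = x i" using i xM by (intro M.M.finsum_singleton) auto
    finally show ?thesis using fbasis_carrier[of n u i] u i by (auto simp: X_def intro!: image_eqI[of _ _ "fbasis u i"])
  qed
  \<comment> \<open>\<open>Y\<close> contains the radical and all generators, so it is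
    \<open>M\<close>; this is the hypothesis of Nakayama's lemma for the image
    \<open>X\<close>.\<close>
  define Y where "Y = {z \<oplus>\<^bsub>M\<^esub> r | z r. z \<in> X \<and> r \<in> rad M}"
  have Y: "rsubmodule A M Y" unfolding Y_def by (rule rsubmodule_sum[OF M X radM])
  have "rad M \<subseteq> Y"
  proof
    fix r assume r: "r \<in> rad M"
    then have "r = \<zero>\<^bsub>M\<^esub> \<oplus>\<^bsub>M\<^esub> r" using radD(1) by auto
    then show "r \<in> Y" using r Xd(2) unfolding Y_def by blast
  qed
  moreover have "x i \<in> Y" if "i < n" for i
  proof -
    have "x i = x i \<oplus>\<^bsub>M\<^esub> \<zero>\<^bsub>M\<^esub>" using xM[OF that] by simp
    then show ?thesis using xX[OF that] radD(2) unfolding Y_def by blast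
  qed
  ultimately have "Y = carrier M" using n(2)[OF Y] by blast
  then have "\<exists>z\<in>X. \<exists>r\<in>rad M. y = z \<oplus>\<^bsub>M\<^esub> r" if "y \<in> carrier M" for y
    using that unfolding Y_def by blast
  then have "X = carrier M" by (rule nakayama[OF M X])
  moreover have "f \<in> rad ?F" if f: "f \<in> carrier ?F" "?p f = \<zero>\<^bsub>M\<^esub>" for f
  proof -
    have "\<exists>r. r \<in> J \<and> f i = \<epsilon> (u i) \<otimes> \<kappa> (\<chi> (u i) (f i)) \<oplus> r" if "i < n" for i
      using left_decomp[OF u[OF that], of "f i"] f(1) that by (auto simp: fmod_simps) metis
    then obtain r where r: "\<And>i. i < n \<Longrightarrow> r i \<in> J"
      "\<And>i. i < n \<Longrightarrow> f i = \<epsilon> (u i) \<otimes> \<kappa> (\<chi> (u i) (f i)) \<oplus> r i" by metis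
    \<comment> \<open>The scalar part of the coordinate \<open>f i\<close>; the rest
      \<open>r i\<close> lies in \<open>J\<close>.\<close>
    define c where "c i = \<chi> (u i) (f i)" for i
    have rA: "\<And>i. i < n \<Longrightarrow> r i \<in> carrier A" using r(1) J_carrier by auto
    have xf: "x i \<triangleleft>\<^bsub>M\<^esub> f i = x i \<triangleleft>\<^bsub>M\<^esub> \<kappa> (c i) \<oplus>\<^bsub>M\<^esub> x i \<triangleleft>\<^bsub>M\<^esub> r i" if i: "i < n" for i
    proof -
      have "x i \<triangleleft>\<^bsub>M\<^esub> f i = x i \<triangleleft>\<^bsub>M\<^esub> (\<epsilon> (u i) \<otimes> \<kappa> (c i) \<oplus> r i)" using r(2)[OF i] by (simp add: c_def)
      also have "\<dots> = x i \<triangleleft>\<^bsub>M\<^esub> (\<epsilon> (u i) \<otimes> \<kappa> (c i)) \<oplus>\<^bsub>M\<^esub> x i \<triangleleft>\<^bsub>M\<^esub> r i"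
        using xM[OF i] u[OF i] rA[OF i] by (intro M.ract_add_right) auto
      also have "x i \<triangleleft>\<^bsub>M\<^esub> (\<epsilon> (u i) \<otimes> \<kappa> (c i)) = x i \<triangleleft>\<^bsub>M\<^esub> \<kappa> (c i)"
        using xM[OF i] u[OF i] xu[OF i] by (simp add: M.ract_mult)
      finally show ?thesis .
    qed
    \<comment> \<open>The image of \<open>f\<close> is \<open>S\<close> plus \<open>T\<close>, with
      \<open>T\<close> in the radical. Since the image is zero, \<open>S\<close> lies in the radical
      as well, and independence modulo the radical kills all \<open>c i\<close>.\<close>
    define S where "S = finsum M (\<lambda>i. x i \<triangleleft>\<^bsub>M\<^esub> \<kappa> (c i)) {..<n}"
    define T where "T = finsum M (\<lambda>i. x i \<triangleleft>\<^bsub>M\<^esub> r i) {..<n}"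
    have cS: "(\<lambda>i. x i \<triangleleft>\<^bsub>M\<^esub> \<kappa> (c i)) \<in> {..<n} \<rightarrow> carrier M" using xM M.ract_closed by auto
    have cT: "(\<lambda>i. x i \<triangleleft>\<^bsub>M\<^esub> r i) \<in> {..<n} \<rightarrow> carrier M" using xM rA M.ract_closed by auto
    have SM: "S \<in> carrier M" unfolding S_def by (rule M.M.finsum_closed[OF cS])
    have T: "T \<in> rad M"
      unfolding T_def using r(1) xM by (intro rsubmodule_finsum[OF M radM]) (auto intro!: rad_mem)
    have TM: "T \<in> carrier M" using T radD(1) by auto
    have "?p f = finsum M (\<lambda>i. x i \<triangleleft>\<^bsub>M\<^esub> \<kappa> (c i) \<oplus>\<^bsub>M\<^esub> x i \<triangleleft>\<^bsub>M\<^esub> r i) {..<n}"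
      unfolding fhom_def using xf cS cT by (intro M.M.finsum_cong') (auto simp: Pi_iff)
    also have "\<dots> = S \<oplus>\<^bsub>M\<^esub> T" unfolding S_def T_def by (rule M.M.finsum_addf[OF cS cT])
    finally have "S \<oplus>\<^bsub>M\<^esub> T = \<zero>\<^bsub>M\<^esub>" using f(2) by simp
    then have "S = \<ominus>\<^bsub>M\<^esub> T" using SM TM by (simp add: M.M.minus_equality)
    also have "\<dots> = T \<triangleleft>\<^bsub>M\<^esub> (\<ominus> \<one>)" using M.ract_minus_one[OF TM] by simp
    finally have "S \<in> rad M" using radD(4)[OF T] by simp
    then have c0: "\<And>i. i < n \<Longrightarrow> c i = 0" using n(3) unfolding S_def by blast
    show ?thesis
    proof (rule fmod_J_subset_rad[OF u f(1)])
      fix i assume i: "i < n"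
      have "f i = r i" using r(2)[OF i] c0[OF i] u[OF i] rA[OF i] by (simp add: c_def \<kappa>_zero)
      then show "f i \<in> J" using r(1)[OF i] by simp
    qed
  qed
  moreover have "int (card {i. i < n \<and> u i = v}) = top_mult M v" if "v \<in> V" for v
    using n(4)[OF that] by (simp add: top_mult_def dimR_def)
  ultimately show thesis
    using that[of n u x] u p unfolding X_def by blast
qed

lemma superfluous_if_subset_rad:
  assumes M: "right_module A M" and K: "rsubmodule A M K" "K \<subseteq> rad M"
  shows "superfluous A M K"
  unfolding superfluous_def
proof (intro conjI allI impI)
  fix N assume N: "rsubmodule A M N \<and> N <+>\<^bsub>M\<^esub> K = carrier M"
  have "\<exists>x\<in>N. \<exists>r\<in>rad M. y = x \<oplus>\<^bsub>M\<^esub> r" if "y \<in> carrier M" for y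
  proof -
    have "y \<in> N <+>\<^bsub>M\<^esub> K" using N that by simp
    then show ?thesis using K(2) unfolding set_add_def' by blast
  qed
  with N show "N = carrier M" by (intro nakayama[OF M]) auto
qed (rule K)

text \<open>A hyperplane \<open>H\<close> of the component at \<open>v\<close> contains the radical
  part there and misses \<open>x\<close>; \<open>N\<close> consists of all \<open>z\<close> whose
  component at \<open>v\<close> lies in \<open>H\<close>. This maximal submodule serves to detect
  vectors outside the radical and to split simple summands off semisimple modules.\<close>

lemma complement_line:
  assumes M: "right_module A M" and fdM: "fd M" and v: "v \<in> V"
    and x: "x \<in> vcomp M v" "x \<notin> rad M"
  obtains N where "rsubmodule A M N" "x \<notin> N"
    "\<And>z. z \<in> carrier M \<Longrightarrow> \<exists>y\<in>N. \<exists>c. z = y \<oplus>\<^bsub>M\<^esub> x \<triangleleft>\<^bsub>M\<^esub> \<kappa> c"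
proof -
  interpret M: right_module A M by fact
  note R = rad_rsubmodule[OF M]
  note Rd = rsubmoduleD[OF R]
  have kV: "ksub M (vcomp M v)" and kR: "ksub M (rad M \<inter> vcomp M v)"
    by (intro ksub_Int ksub_vcomp M v rsubmodule_ksub R)+
  obtain H where H: "ksub M H" "rad M \<inter> vcomp M v \<subseteq> H" "H \<subseteq> vcomp M v" "x \<notin> H"
    "\<And>y. y \<in> vcomp M v \<Longrightarrow> \<exists>h\<in>H. \<exists>c. y = h \<oplus>\<^bsub>M\<^esub> x \<triangleleft>\<^bsub>M\<^esub> \<kappa> c"
    using hyperplane_ksub[OF M fdM kR kV _ x(1)] x(2) by blast
  note Hd = ksubD[OF H(1)]
  define N where "N = {z \<in> carrier M. z \<triangleleft>\<^bsub>M\<^esub> \<epsilon> v \<in> H}"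
  have RN: "z \<in> N" if "z \<in> rad M" for z
  proof -
    have zM: "z \<in> carrier M" using that Rd(1) by auto
    then have "z \<triangleleft>\<^bsub>M\<^esub> \<epsilon> v \<in> rad M \<inter> vcomp M v" using ract_vcomp[OF M v] Rd(4) that v by auto
    then show ?thesis using zM H(2) by (auto simp: N_def)
  qed
  have Nadd: "z \<oplus>\<^bsub>M\<^esub> w \<in> N" if "z \<in> N" "w \<in> N" for z w
    using that v Hd(3) by (auto simp: N_def M.ract_add_left)
  have N: "rsubmodule A M N"
  proof (rule rsubmoduleI[OF M])
    show "\<zero>\<^bsub>M\<^esub> \<in> N" using Hd(2) v by (simp add: N_def)
    fix z a assume z: "z \<in> N" and a: "a \<in> carrier A"
    have zM: "z \<in> carrier M" "z \<triangleleft>\<^bsub>M\<^esub> \<epsilon> v \<in> H" using z by (auto simp: N_def)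
    have "z \<triangleleft>\<^bsub>M\<^esub> a \<triangleleft>\<^bsub>M\<^esub> \<epsilon> w \<in> N" if w: "w \<in> V" for w
    proof (cases "w = v")
      case False
      have "z \<triangleleft>\<^bsub>M\<^esub> a \<triangleleft>\<^bsub>M\<^esub> \<epsilon> w \<triangleleft>\<^bsub>M\<^esub> \<epsilon> v = \<zero>\<^bsub>M\<^esub>"
        using ract_vcomp_other[OF M v w ract_vcomp[OF M w]] False zM a M.ract_closed by auto
      then show ?thesis using zM a w Hd(2) M.ract_closed by (simp add: N_def)
    next
      case True
      \<comment> \<open>The element \<open>a \<otimes> \<epsilon> v\<close> is \<open>d\<close>
        times \<open>\<epsilon> v\<close> plus an element \<open>s\<close> of \<open>J\<close>. The
        action of \<open>s\<close> ends in the radical, hence in \<open>N\<close>, and the action of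
        a scalar preserves \<open>H\<close>.\<close>
      define d where "d = \<chi> v (a \<otimes> \<epsilon> v)"
      define s where "s = a \<otimes> \<epsilon> v \<oplus> \<kappa> (- d) \<otimes> \<epsilon> v"
      have "\<chi> u (a \<otimes> \<epsilon> v) = (if u = v then d else 0)" if "u \<in> V" for u
        using that v a by (simp add: d_def \<chi>_mult \<chi>_\<epsilon>)
      then have sJ: "s \<in> J" using v a by (simp add: s_def J_def \<chi>_add \<chi>_mult[of _ "\<kappa> (- d)"] \<chi>_\<epsilon> \<chi>_\<kappa>)
      have "\<kappa> d \<otimes> \<epsilon> v \<oplus> \<kappa> (- d) \<otimes> \<epsilon> v = (\<kappa> d \<oplus> \<kappa> (- d)) \<otimes> \<epsilon> v" using v by (simp add: l_distr)
      also have "\<dots> = \<zero>" using v by (simp add: \<kappa>_add[symmetric] \<kappa>_zero)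
      finally have d0: "\<kappa> d \<otimes> \<epsilon> v \<oplus> \<kappa> (- d) \<otimes> \<epsilon> v = \<zero>" .
      have "s \<oplus> \<epsilon> v \<otimes> \<kappa> d = a \<otimes> \<epsilon> v \<oplus> (\<kappa> d \<otimes> \<epsilon> v \<oplus> \<kappa> (- d) \<otimes> \<epsilon> v)"
        using v a \<kappa>_central[of "\<epsilon> v" d] by (simp add: s_def a_ac)
      then have aeq: "a \<otimes> \<epsilon> v = s \<oplus> \<epsilon> v \<otimes> \<kappa> d" using d0 a v by simp
      have "z \<triangleleft>\<^bsub>M\<^esub> a \<triangleleft>\<^bsub>M\<^esub> \<epsilon> v = z \<triangleleft>\<^bsub>M\<^esub> (a \<otimes> \<epsilon> v)" using zM a v by (simp add: M.ract_mult)
      also have "\<dots> = z \<triangleleft>\<^bsub>M\<^esub> s \<oplus>\<^bsub>M\<^esub> z \<triangleleft>\<^bsub>M\<^esub> \<epsilon> v \<triangleleft>\<^bsub>M\<^esub> \<kappa> d"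
        unfolding aeq using zM v J_carrier[OF sJ] by (simp add: M.ract_add_right M.ract_mult)
      finally have eq: "z \<triangleleft>\<^bsub>M\<^esub> a \<triangleleft>\<^bsub>M\<^esub> \<epsilon> w = z \<triangleleft>\<^bsub>M\<^esub> s \<oplus>\<^bsub>M\<^esub> z \<triangleleft>\<^bsub>M\<^esub> \<epsilon> v \<triangleleft>\<^bsub>M\<^esub> \<kappa> d" using True by simp
      have "z \<triangleleft>\<^bsub>M\<^esub> \<epsilon> v \<triangleleft>\<^bsub>M\<^esub> \<kappa> d \<in> H" using Hd(4) zM by simp
      then have "z \<triangleleft>\<^bsub>M\<^esub> \<epsilon> v \<triangleleft>\<^bsub>M\<^esub> \<kappa> d \<in> N" using H(3) Hd(1) by (auto simp: N_def vcomp_def)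
      from Nadd[OF RN[OF rad_mem[OF zM(1) sJ]] this] show ?thesis unfolding eq .
    qed
    note * = this
    define t where "t = z \<triangleleft>\<^bsub>M\<^esub> a"
    have tM: "t \<in> carrier M" using zM a M.ract_closed by (simp add: t_def)
    have "t \<triangleleft>\<^bsub>M\<^esub> \<epsilon> v \<triangleleft>\<^bsub>M\<^esub> \<epsilon> v = t \<triangleleft>\<^bsub>M\<^esub> \<epsilon> v" using ract_vcomp[OF M v tM] by (simp add: vcomp_def)
    then show "z \<triangleleft>\<^bsub>M\<^esub> a \<in> N" using *[OF v] tM by (simp add: N_def t_def)
  qed (use Nadd in \<open>auto simp: N_def\<close>)
  show thesis
  proof (rule that[OF N])
    show "x \<notin> N" using x H(4) by (auto simp: N_def vcomp_def)
    fix z assume z: "z \<in> carrier M"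
    obtain h c where hc: "h \<in> H" "z \<triangleleft>\<^bsub>M\<^esub> \<epsilon> v = h \<oplus>\<^bsub>M\<^esub> x \<triangleleft>\<^bsub>M\<^esub> \<kappa> c"
      using H(5)[OF ract_vcomp[OF M v z]] by blast
    \<comment> \<open>Subtracting this multiple of \<open>x\<close> moves the component of
      \<open>z\<close> at \<open>v\<close> into \<open>H\<close>.\<close>
    define k where "k = x \<triangleleft>\<^bsub>M\<^esub> \<kappa> c"
    have k: "k \<in> carrier M" "k \<triangleleft>\<^bsub>M\<^esub> \<epsilon> v = k"
      using ksubD(4)[OF kV x(1)] by (auto simp: k_def vcomp_def)
    have hM: "h \<in> carrier M" using hc Hd(1) by auto
    have zk: "z \<ominus>\<^bsub>M\<^esub> k \<in> carrier M" using z k by simp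
    have zeq: "z = (z \<ominus>\<^bsub>M\<^esub> k) \<oplus>\<^bsub>M\<^esub> k" using z k by (simp add: M.M.minus_eq M.M.a_assoc M.M.l_neg)
    then have "z \<triangleleft>\<^bsub>M\<^esub> \<epsilon> v = (z \<ominus>\<^bsub>M\<^esub> k) \<triangleleft>\<^bsub>M\<^esub> \<epsilon> v \<oplus>\<^bsub>M\<^esub> k"
      using M.ract_add_left[OF zk k(1), of "\<epsilon> v"] v k(2) by simp
    then have "(z \<ominus>\<^bsub>M\<^esub> k) \<triangleleft>\<^bsub>M\<^esub> \<epsilon> v \<oplus>\<^bsub>M\<^esub> k = h \<oplus>\<^bsub>M\<^esub> k" using hc(2) by (simp add: k_def)
    then have "(z \<ominus>\<^bsub>M\<^esub> k) \<triangleleft>\<^bsub>M\<^esub> \<epsilon> v = h"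
      using zk k hM v M.ract_closed by simp
    then have "z \<ominus>\<^bsub>M\<^esub> k \<in> N" using zk hc(1) by (simp add: N_def)
    then show "\<exists>y\<in>N. \<exists>c. z = y \<oplus>\<^bsub>M\<^esub> x \<triangleleft>\<^bsub>M\<^esub> \<kappa> c" using zeq unfolding k_def by blast
  qed
qed

text \<open>If some element of \<open>K\<close> were outside the radical, so would be one of its
  vertex components \<open>x\<close>. The complement of the line through \<open>x\<close> would be a
  proper submodule whose sum with \<open>K\<close> is \<open>M\<close>.\<close>

lemma subset_rad_if_superfluous:
  assumes M: "right_module A M" and fdM: "fd M" and sup: "superfluous A M K"
  shows "K \<subseteq> rad M"
proof (rule ccontr)
  interpret M: right_module A M by fact
  have K: "rsubmodule A M K"
    and Kmax: "\<And>N. rsubmodule A M N \<Longrightarrow> N <+>\<^bsub>M\<^esub> K = carrier M \<Longrightarrow> N = carrier M"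
    using sup by (auto simp: superfluous_def)
  note Kd = rsubmoduleD[OF K] and R = rad_rsubmodule[OF M]
  assume "\<not> K \<subseteq> rad M"
  then obtain y where y: "y \<in> K" "y \<notin> rad M" by auto
  then obtain v where v: "v \<in> V" "y \<triangleleft>\<^bsub>M\<^esub> \<epsilon> v \<notin> rad M"
    using rsubmodule_memI[OF M R, of y] Kd(1) by auto
  define x where "x = y \<triangleleft>\<^bsub>M\<^esub> \<epsilon> v"
  have x: "x \<in> vcomp M v" "x \<notin> rad M" "x \<in> K" "x \<in> carrier M"
    using ract_vcomp[OF M v(1), of y] y Kd(1,4) v by (auto simp: x_def)
  obtain N where N: "rsubmodule A M N" "x \<notin> N"
    "\<And>z. z \<in> carrier M \<Longrightarrow> \<exists>y\<in>N. \<exists>c. z = y \<oplus>\<^bsub>M\<^esub> x \<triangleleft>\<^bsub>M\<^esub> \<kappa> c"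
    by (rule complement_line[OF M fdM v(1) x(1,2)]) blast
  have "carrier M \<subseteq> N <+>\<^bsub>M\<^esub> K"
  proof
    fix z assume "z \<in> carrier M"
    then obtain y c where "y \<in> N" "z = y \<oplus>\<^bsub>M\<^esub> x \<triangleleft>\<^bsub>M\<^esub> \<kappa> c" using N(3) by blast
    moreover have "x \<triangleleft>\<^bsub>M\<^esub> \<kappa> c \<in> K" using Kd(4) x(3) by simp
    ultimately show "z \<in> N <+>\<^bsub>M\<^esub> K" unfolding set_add_def' by blast
  qed
  moreover have "N <+>\<^bsub>M\<^esub> K \<subseteq> carrier M" using Kd(1) rsubmoduleD(1)[OF N(1)] by (auto simp: set_add_def')
  ultimately have "N = carrier M" using Kmax[OF N(1)] by blast
  then show False using x(4) N(2) by simp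
qed

section \<open>Projective covers and syzygies in the fixed carrier type\<close>

lemma fgmod_iff: "M \<in> fgmod A \<longleftrightarrow> right_module A M \<and> fd M"
  using finitely_generated_iff_fd by (auto simp: fgmod_def)

lemma fgmod_restrict: "M \<in> fgmod A \<Longrightarrow> rsubmodule A M X \<Longrightarrow> M\<lparr>carrier := X\<rparr> \<in> fgmod A"
  by (auto simp: fgmod_iff fd_restrict rsubmodule_right_module)

lemma rmod_iso_fd:
  assumes "right_module A M" "right_module A N" "rmod_iso A M N" "fd M"
  shows "fd N"
  using assms fd_image unfolding rmod_iso_def bij_betw_def by blast

lemma sum_by_vertex:
  fixes n :: nat
  assumes u: "\<And>i. i < n \<Longrightarrow> u i \<in> V"
  shows "(\<Sum>i<n. f (u i)) = (\<Sum>w\<in>V. card {i. i < n \<and> u i = w} * f w :: nat)"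
proof -
  have "(\<Sum>i<n. f (u i)) = (\<Sum>w\<in>V. \<Sum>i\<in>{i \<in> {..<n}. u i = w}. f (u i))"
    by (rule sum.group[symmetric]) (use u finite_V in auto)
  also have "\<dots> = (\<Sum>w\<in>V. card {i. i < n \<and> u i = w} * f w)"
    by (intro sum.cong) auto
  finally show ?thesis .
qed

text \<open>The cover by a standard projective module, moved to the fixed carrier type. Its
  dimension at \<open>v\<close> adds up Cartan entries, with \<open>\<epsilon> u\<close> A occurring
  as often as \<open>top_mult M u\<close> says.\<close>

lemma projective_cover_exists:
  assumes M: "M \<in> fgmod A"
  obtains P p where "projective_cover A M P p"
    "\<And>v. v \<in> V \<Longrightarrow> int (dimV P v) = (\<Sum>u\<in>V. top_mult M u * int (bdim u v))"
    "\<And>v. v \<in> V \<Longrightarrow> nonsink v \<Longrightarrow> soc_mult P v = 0"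
proof -
  have M': "right_module A M" "fd M" using M by (auto simp: fgmod_iff)
  obtain n u x where u: "\<And>i. i < n \<Longrightarrow> u i \<in> V"
    and q: "fhom M n x \<in> rmod_hom A (fmod n u) M" "fhom M n x ` carrier (fmod n u) = carrier M"
    and ker: "{f \<in> carrier (fmod n u). fhom M n x f = \<zero>\<^bsub>M\<^esub>} \<subseteq> rad (fmod n u)"
    and count: "\<And>v. v \<in> V \<Longrightarrow> int (card {i. i < n \<and> u i = v}) = top_mult M v"
    by (rule cover_fmod[OF M']) blast
  let ?F = "fmod n u" and ?q = "fhom M n x"
  \<comment> \<open>The carrier type consists of sets of vectors, so a vector is represented by its
    singleton.\<close>
  define s :: "(nat \<Rightarrow> 'a) \<Rightarrow> (nat \<Rightarrow> 'a) set" where "s f = {f}" for f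
  define P where "P = rmod_transport s ?F"
  have F: "right_module A ?F" by (rule fmod_right_module) (rule u)
  have "inj_on s (carrier ?F)" by (auto simp: s_def inj_on_def)
  note T = rmod_transport[OF F this, folded P_def]
  define t where "t = inv_into (carrier ?F) s"
  have t: "t \<in> rmod_hom A P ?F" unfolding t_def by (rule rmod_hom_inverse[OF F T(2,3)])
  have tb: "bij_betw t (carrier P) (carrier ?F)" unfolding t_def by (rule bij_betw_inv_into[OF T(3)])
  have ts: "\<And>f. f \<in> carrier ?F \<Longrightarrow> t (s f) = f" "\<And>y. y \<in> carrier P \<Longrightarrow> s (t y) = y"
    using T(3) unfolding t_def by (auto simp: bij_betw_def f_inv_into_f)
  have isoFP: "rmod_iso A ?F P" using T by (auto simp: rmod_iso_def)
  have fdF: "fd ?F" by (rule fd_fmod) (rule u)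
  have P: "P \<in> fgmod A" using T(1) rmod_iso_fd[OF F T(1) isoFP fdF] by (simp add: fgmod_iff)
  have proj: "projective A P" unfolding projective_def
  proof (intro conjI allI ballI impI)
    fix M' N :: "'a std_rmod" and f g
    assume f: "f \<in> rmod_hom A M' N" and g: "g \<in> rmod_hom A P N"
      and *: "right_module A M' \<and> right_module A N \<and> f ` carrier M' = carrier N"
    obtain h where h: "h \<in> rmod_hom A ?F M'" "\<And>y. y \<in> carrier ?F \<Longrightarrow> f (h y) = g (s y)"
      using fmod_lifting[of n u M' N f "\<lambda>y. g (s y)"] u * f rmod_hom_compose[OF T(2) g] by metis
    show "\<exists>h\<in>rmod_hom A P M'. \<forall>x\<in>carrier P. f (h x) = g x"
      using rmod_hom_compose[OF t h(1)] h(2) ts(2) rmod_homD(1)[OF t]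
      by (intro bexI[of _ "\<lambda>y. h (t y)"]) auto
  qed (rule T(1))
  define p where "p y = ?q (t y)" for y
  have p: "p \<in> rmod_hom A P M" unfolding p_def by (rule rmod_hom_compose[OF t q(1)])
  have "p ` carrier P = ?q ` (t ` carrier P)" by (auto simp: p_def)
  then have surj: "p ` carrier P = carrier M" using tb q(2) by (simp add: bij_betw_def)
  have K: "rsubmodule A P (a_kernel P M p)"
    unfolding a_kernel_def' by (rule rsubmodule_kernel[OF T(1) M'(1) p])
  have "a_kernel P M p \<subseteq> rad P"
  proof
    fix y assume y: "y \<in> a_kernel P M p"
    then have yP: "y \<in> carrier P" "?q (t y) = \<zero>\<^bsub>M\<^esub>" by (auto simp: a_kernel_def' p_def)
    then have "t y \<in> rad ?F" using ker rmod_homD(1)[OF t] by blast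
    then have "s (t y) \<in> rad P" using rad_hom[OF F T(1,2)] by blast
    then show "y \<in> rad P" using ts(2) yP by simp
  qed
  then have sup: "superfluous A P (a_kernel P M p)" by (rule superfluous_if_subset_rad[OF T(1) K])
  show thesis
  proof
    show "projective_cover A M P p"
      using P proj p surj sup by (simp add: projective_cover_def)
    fix v assume v: "v \<in> V"
    have "dimV P v = (\<Sum>w\<in>V. card {i. i < n \<and> u i = w} * bdim w v)"
      using dim_iso(1)[OF F T(1) fdF isoFP v] dimV_fmod[OF v, of n u] u sum_by_vertex[of n u "\<lambda>w. bdim w v"]
      by simp
    then show "int (dimV P v) = (\<Sum>u\<in>V. top_mult M u * int (bdim u v))"
      by (simp add: count[symmetric])
    assume "nonsink v"
    then show "soc_mult P v = 0"
      using soc_mult_iso[OF F T(1) fdF isoFP v] soc_mult_fmod[OF u v] by simp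
  qed
qed

lemma syzygy_exists:
  assumes M: "M \<in> fgmod A"
  obtains N where "N \<in> fgmod A" "is_syzygy A M N"
proof -
  obtain P p where P: "projective_cover A M P p" by (rule projective_cover_exists[OF M])
  then have K: "rsubmodule A P (a_kernel P M p)" and "P \<in> fgmod A"
    by (auto simp: projective_cover_def superfluous_def)
  then have "P\<lparr>carrier := a_kernel P M p\<rparr> \<in> fgmod A" by (intro fgmod_restrict)
  then show thesis using that P rmod_iso_refl unfolding is_syzygy_def by blast
qed

text \<open>The cover of a projective module splits, and by Nakayama's lemma the section is onto; so
  the module is isomorphic to its cover, whose invariants are known.\<close>

lemma projective_dims:
  assumes P: "P \<in> fgmod A" "projective A P" and v: "v \<in> V"
  shows "syz_dim P v = 0" "nonsink v \<Longrightarrow> soc_mult P v = 0"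
proof -
  obtain F p where cov: "projective_cover A P F p"
    and dims: "\<And>v. v \<in> V \<Longrightarrow> int (dimV F v) = (\<Sum>u\<in>V. top_mult P u * int (bdim u v))"
      "\<And>v. v \<in> V \<Longrightarrow> nonsink v \<Longrightarrow> soc_mult F v = 0"
    by (rule projective_cover_exists[OF P(1)]) blast
  have P': "right_module A P" "fd P" using P(1) by (auto simp: fgmod_iff)
  have F: "right_module A F" "fd F" and p: "p \<in> rmod_hom A F P" "p ` carrier F = carrier P"
    and sup: "superfluous A F (a_kernel F P p)"
    using cov by (auto simp: projective_cover_def fgmod_iff)
  interpret F: right_module A F by (rule F(1))
  interpret PP: right_module A P by (rule P'(1))
  have id: "id \<in> rmod_hom A P P" by (rule rmod_homI) auto
  have lift: "\<exists>h\<in>rmod_hom A P M. \<forall>x\<in>carrier P. f (h x) = g x"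
    if "f \<in> rmod_hom A M N" "g \<in> rmod_hom A P N" "right_module A M" "right_module A N" "f ` carrier M = carrier N"
    for M N :: "'a std_rmod" and f g
    using P(2) that by (simp add: projective_def)
  \<comment> \<open>The identity of \<open>P\<close> is lifted through the cover. The image of this
    section, together with the kernel of \<open>p\<close>, gives all of \<open>F\<close>, and the
    kernel lies in the radical.\<close>
  obtain s where s: "s \<in> rmod_hom A P F" "\<And>x. x \<in> carrier P \<Longrightarrow> p (s x) = x"
    using lift[OF p(1) id F(1) P'(1) p(2)] by auto
  have ker: "a_kernel F P p \<subseteq> rad F" by (rule subset_rad_if_superfluous[OF F sup])
  have "s ` carrier P = carrier F"
  proof (rule nakayama[OF F(1) rsubmodule_image[OF P'(1) F(1) s(1) rsubmodule_carrier[OF P'(1)]]])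
    fix y assume y: "y \<in> carrier F"
    define z where "z = s (p y)"
    have pyP: "p y \<in> carrier P" using rmod_homD(1)[OF p(1)] y by simp
    have z: "z \<in> carrier F" "p y = p z" unfolding z_def using rmod_homD(1)[OF s(1)] s(2) pyP by auto
    have "p (y \<ominus>\<^bsub>F\<^esub> z) = \<zero>\<^bsub>P\<^esub>"
      by (rule rmod_hom_diff[OF F.abelian_group_axioms PP.abelian_group_axioms p(1) y z])
    then have "y \<ominus>\<^bsub>F\<^esub> z \<in> rad F" using ker y z by (auto simp: a_kernel_def')
    moreover have "y = z \<oplus>\<^bsub>F\<^esub> (y \<ominus>\<^bsub>F\<^esub> z)"
      using y z by (simp add: F.M.minus_eq F.M.a_lcomm F.M.r_neg)
    ultimately show "\<exists>x\<in>s ` carrier P. \<exists>r\<in>rad F. y = x \<oplus>\<^bsub>F\<^esub> r" using pyP by (auto simp: z_def)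
  qed
  moreover have "inj_on s (carrier P)" using s(2) by (rule inj_on_inverseI)
  ultimately have iso: "rmod_iso A P F" using s(1) unfolding rmod_iso_def bij_betw_def by blast
  show "syz_dim P v = 0"
    using dim_iso(1)[OF P'(1) F(1) P'(2) iso v] dims(1)[OF v] by (simp add: syz_dim_def)
  show "soc_mult P v = 0" if "nonsink v"
    using soc_mult_iso[OF P'(1) F(1) P'(2) iso v] dims(2)[OF v that] by simp
qed

lemma rad_iso_zero:
  assumes M: "right_module A M" and N: "right_module A N" and iso: "rmod_iso A M N" and "rad N = {\<zero>\<^bsub>N\<^esub>}"
  shows "rad M = {\<zero>\<^bsub>M\<^esub>}"
proof -
  interpret M: right_module A M by fact
  interpret N: right_module A N by fact
  obtain f where f: "f \<in> rmod_hom A M N" "inj_on f (carrier M)" "f ` carrier M = carrier N"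
    using iso by (auto simp: rmod_iso_def bij_betw_def)
  have z: "f \<zero>\<^bsub>M\<^esub> = \<zero>\<^bsub>N\<^esub>" by (rule rmod_hom_zero[OF M.abelian_group_axioms N.abelian_group_axioms f(1)])
  note R = rsubmoduleD[OF rad_rsubmodule[OF M]]
  have "x = \<zero>\<^bsub>M\<^esub>" if x: "x \<in> rad M" for x
  proof -
    have "f x = f \<zero>\<^bsub>M\<^esub>" using x rad_hom[OF M N f(1)] assms(4) z by auto
    then show ?thesis using inj_onD[OF f(2)] x R(1) by auto
  qed
  then show ?thesis using R(2) by blast
qed

text \<open>Valid for every projective cover. The kernel lies in the radical of \<open>P\<close>, so
  \<open>J\<close> kills it; its dimension at \<open>v\<close> is that of \<open>P\<close> minus
  that of \<open>M\<close>, and the former is known because \<open>P\<close> is projective with the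
  same top as \<open>M\<close>.\<close>

lemma syzygy_dims:
  assumes M: "M \<in> fgmod A" and N: "N \<in> fgmod A" and syz: "is_syzygy A M N"
  shows "rad N = {\<zero>\<^bsub>N\<^esub>}" "\<And>v. v \<in> V \<Longrightarrow> int (dimV N v) = syz_dim M v"
proof -
  obtain P p where cov: "projective_cover A M P p" and iso: "rmod_iso A N (P\<lparr>carrier := a_kernel P M p\<rparr>)"
    using syz by (auto simp: is_syzygy_def)
  have M': "right_module A M" "fd M" and N': "right_module A N" "fd N" using M N by (auto simp: fgmod_iff)
  have PF: "P \<in> fgmod A" "projective A P" using cov by (auto simp: projective_cover_def)
  have P: "right_module A P" "fd P" and p: "p \<in> rmod_hom A P M" "p ` carrier P = carrier M"
    and sup: "superfluous A P (a_kernel P M p)"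
    using cov by (auto simp: projective_cover_def fgmod_iff)
  interpret P: right_module A P by (rule P(1))
  define K where "K = a_kernel P M p"
  have K: "rsubmodule A P K" using sup by (simp add: superfluous_def K_def)
  have KR: "K \<subseteq> rad P" unfolding K_def by (rule subset_rad_if_superfluous[OF P sup])
  let ?L = "P\<lparr>carrier := K\<rparr>"
  have L: "right_module A ?L" "fd ?L" using fgmod_restrict[OF PF(1) K] by (auto simp: fgmod_iff)
  have "rad ?L \<subseteq> {\<zero>\<^bsub>?L\<^esub>}"
  proof (rule rad_least[OF rsubmodule_zero[OF L(1)]])
    fix x j assume "x \<in> carrier ?L" "j \<in> J"
    then have "x \<in> ann P" "j \<in> J" using KR rad_subset_ann[OF P(1)] by auto
    then show "x \<triangleleft>\<^bsub>?L\<^esub> j \<in> {\<zero>\<^bsub>?L\<^esub>}" by (simp add: ann_def)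
  qed
  then have "rad ?L = {\<zero>\<^bsub>?L\<^esub>}" using rsubmoduleD(2)[OF rad_rsubmodule[OF L(1)]] by auto
  then show "rad N = {\<zero>\<^bsub>N\<^esub>}" by (intro rad_iso_zero[OF N'(1) L(1)]) (use iso in \<open>simp_all add: K_def\<close>)
  have Kdef: "K = {x \<in> carrier P. p x = \<zero>\<^bsub>M\<^esub>}" by (simp add: K_def a_kernel_def')
  have ker: "{x \<in> X \<inter> vcomp P v. p x = \<zero>\<^bsub>M\<^esub>} = K \<inter> vcomp P v" if "K \<subseteq> X" "X \<subseteq> carrier P" for X v
    using that by (auto simp: Kdef)
  have cV: "\<And>v. carrier P \<inter> vcomp P v = vcomp P v" "\<And>v. carrier M \<inter> vcomp M v = vcomp M v" by (auto simp: vcomp_def)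
  have radP: "rsubmodule A P (rad P)" by (rule rad_rsubmodule[OF P(1)])
  \<comment> \<open>Rank-nullity on \<open>P\<close> and on \<open>rad P\<close>, whose images are
    \<open>M\<close> and \<open>rad M\<close>, subtracts the same kernel. Hence the tops of
    \<open>P\<close> and \<open>M\<close> have equal dimensions.\<close>
  have dims: "dimV P v = dimV M v + vdim P (K \<inter> vcomp P v)" "dimR P v = dimR M v + vdim P (K \<inter> vcomp P v)"
    if v: "v \<in> V" for v
  proof -
    have "vdim P (X \<inter> vcomp P v) = vdim M (p ` X \<inter> vcomp M v) + vdim P (K \<inter> vcomp P v)"
      if X: "rsubmodule A P X" "K \<subseteq> X" for X
    proof -
      have "ksub P (X \<inter> vcomp P v)" by (intro ksub_Int P rsubmodule_ksub X ksub_vcomp v)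
      from vdim_image_kernel[OF P(1) M'(1) p(1) P(2) this] show ?thesis
        using ker[OF X(2) rsubmoduleD(1)[OF X(1)]] image_vcomp[OF P(1) M'(1) p(1) X(1) v] by simp
    qed
    from this[OF rsubmodule_carrier[OF P(1)] rsubmoduleD(1)[OF K]] this[OF radP KR]
    show "dimV P v = dimV M v + vdim P (K \<inter> vcomp P v)" "dimR P v = dimR M v + vdim P (K \<inter> vcomp P v)"
      using p(2) rad_surj[OF P(1) M'(1) p] by (simp_all add: dimV_def dimR_def cV)
  qed
  fix v assume v: "v \<in> V"
  have "top_mult P u = top_mult M u" if "u \<in> V" for u
    using dims[OF that] by (simp add: top_mult_def)
  then have "int (dimV P v) = (\<Sum>u\<in>V. top_mult M u * int (bdim u v))"
    using projective_dims(1)[OF PF v] by (simp add: syz_dim_def)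
  then have "int (vdim P (K \<inter> vcomp P v)) = syz_dim M v"
    using dims(1)[OF v] by (simp add: syz_dim_def)
  moreover have "vcomp ?L v = K \<inter> vcomp P v" using rsubmoduleD(1)[OF K] by (auto simp: vcomp_def)
  then have "dimV ?L v = vdim P (K \<inter> vcomp P v)"
    using vdim_restrict[OF P(1) K] by (simp add: dimV_def)
  moreover have "dimV ?L v = dimV N v"
    using dim_iso(1)[OF N'(1) L(1) N'(2) _ v] iso by (simp add: K_def)
  ultimately show "int (dimV N v) = syz_dim M v" by simp
qed

section \<open>Simple modules at the vertices\<close>

definition simple_field :: "'v \<Rightarrow> ('a, 'k) rmod" where
  "simple_field v = \<lparr>carrier = UNIV, monoid.mult = undefined, one = undefined, zero = 0, add = (+),
     ract = (\<lambda>x a. x * \<chi> v a)\<rparr>"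

lemma simple_field_simps [simp]:
  "carrier (simple_field v) = UNIV" "\<zero>\<^bsub>simple_field v\<^esub> = 0" "x \<oplus>\<^bsub>simple_field v\<^esub> y = x + y"
  "x \<triangleleft>\<^bsub>simple_field v\<^esub> a = x * \<chi> v a"
  by (simp_all add: simple_field_def)

lemma simple_field_right_module:
  assumes "v \<in> V"
  shows "right_module A (simple_field v)"
proof (rule right_moduleI)
  show "abelian_group (simple_field v)"
    by (rule abelian_groupI) (auto intro: exI[of _ "- x" for x] simp: add_ac)
qed (use assms in \<open>auto simp: \<chi>_add \<chi>_mult distrib_left distrib_right intro: ring_axioms\<close>)

text \<open>A copy in the fixed carrier type: the scalar c becomes the singleton of the constant
  vector with entry \<open>\<epsilon> v \<otimes> \<kappa> c\<close>, from which
  \<open>\<chi> v\<close> recovers c.\<close>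

definition simple_rmod :: "'v \<Rightarrow> 'a std_rmod" where
  "simple_rmod v = rmod_transport (\<lambda>c. {\<lambda>_. \<epsilon> v \<otimes> \<kappa> c}) (simple_field v)"

lemma simple_transport:
  assumes v: "v \<in> V"
  shows "right_module A (simple_rmod v)" "rmod_iso A (simple_field v) (simple_rmod v)"
proof -
  have "c = d" if "\<epsilon> v \<otimes> \<kappa> c = \<epsilon> v \<otimes> \<kappa> d" for c d
    using arg_cong[OF that, of "\<chi> v"] v by (simp add: \<chi>_mult \<chi>_\<kappa> \<chi>_\<epsilon>)
  then have "inj_on (\<lambda>c. {\<lambda>_ :: nat. \<epsilon> v \<otimes> \<kappa> c}) (carrier (simple_field v))"
    by (auto simp: inj_on_def dest: fun_cong)
  note T = rmod_transport[OF simple_field_right_module[OF v] this, folded simple_rmod_def]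
  show "right_module A (simple_rmod v)" "rmod_iso A (simple_field v) (simple_rmod v)"
    using T by (auto simp: rmod_iso_def)
qed

lemma fd_simple_field:
  assumes v: "v \<in> V"
  shows "fd (simple_field v)"
proof (rule fd_if_finitely_generated[OF simple_field_right_module[OF v]])
  show "finitely_generated A (simple_field v)" unfolding finitely_generated_def
  proof (intro exI[of _ "{1}"] conjI allI impI)
    fix X assume X: "rsubmodule A (simple_field v) X \<and> {1} \<subseteq> X"
    have "c \<in> X" for c
      using rsubmoduleD(4)[of A "simple_field v" X 1 "\<kappa> c"] X v by (simp add: \<chi>_\<kappa>)
    then show "X = carrier (simple_field v)" by auto
  qed auto
qed

lemma simple_rmod_fgmod: "v \<in> V \<Longrightarrow> simple_rmod v \<in> fgmod A"
  using simple_transport[of v] rmod_iso_fd[OF simple_field_right_module[of v]] fd_simple_field[of v]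
  by (auto simp: fgmod_iff)

lemma simple_dims:
  assumes v: "v \<in> V" and w: "w \<in> V"
  shows "dimV (simple_rmod v) w = (if v = w then 1 else 0)" "dimR (simple_rmod v) w = 0"
    "dimS (simple_rmod v) w = (if v = w then 1 else 0)"
proof -
  let ?S = "simple_field v"
  have S: "right_module A ?S" "fd ?S" by (rule simple_field_right_module[OF v], rule fd_simple_field[OF v])
  have comp: "vcomp ?S w = (if v = w then UNIV else {0})"
    using v w by (auto simp: vcomp_def \<chi>_\<epsilon>)
  have "{c \<odot>\<^bsub>vsp ?S\<^esub> 1 | c. c \<in> carrier (scalar_ring :: 'k ring)} = UNIV" using v by (auto simp: \<chi>_\<kappa>)
  then have one: "vdim ?S UNIV = 1"
    using vectorspace.sdim_line[OF vsp_vectorspace[OF S(1)], of 1] S(2) by (simp add: vdim_def fd_def)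
  have zero: "vdim ?S {0} = 0" using vdim_zero[OF S(1)] by simp
  have "rad ?S \<subseteq> {\<zero>\<^bsub>?S\<^esub>}"
    by (rule rad_least[OF rsubmodule_zero[OF S(1)]]) (use v in \<open>auto simp: J_def\<close>)
  then have rad: "rad ?S = {0}" using rsubmoduleD(2)[OF rad_rsubmodule[OF S(1)]] by auto
  have ann: "ann ?S = UNIV" using v by (auto simp: ann_def J_def)
  have "dimV ?S w = (if v = w then 1 else 0)" "dimR ?S w = 0" "dimS ?S w = (if v = w then 1 else 0)"
    using one zero by (auto simp: dimV_def dimR_def dimS_def comp rad ann)
  then show "dimV (simple_rmod v) w = (if v = w then 1 else 0)" "dimR (simple_rmod v) w = 0"
    "dimS (simple_rmod v) w = (if v = w then 1 else 0)"
    using dim_iso[OF S(1) simple_transport(1)[OF v] S(2) simple_transport(2)[OF v] w] by simp_all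
qed

text \<open>The top of the simple module at \<open>v\<close> selects row \<open>v\<close> of the
  Cartan matrix. Subtracting the simple module itself removes the diagonal unit, so row
  \<open>v\<close> of \<open>adim\<close> remains.\<close>

lemma simple_mults:
  assumes v: "v \<in> V" and w: "w \<in> V"
  shows "syz_dim (simple_rmod v) w = int (adim v w)" "soc_mult (simple_rmod v) w = (if v = w then 1 else 0)"
proof -
  have "(\<Sum>u\<in>V. top_mult (simple_rmod v) u * int (bdim u w)) = (\<Sum>u\<in>V. if u = v then int (bdim v w) else 0)"
    using simple_dims[OF v] by (intro sum.cong) (auto simp: top_mult_def)
  also have "\<dots> = int (bdim v w)" using v finite_V by simp
  finally show "syz_dim (simple_rmod v) w = int (adim v w)"
    using simple_dims(1)[OF v w] bdim_eq[OF v w] by (simp add: syz_dim_def)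
  show "soc_mult (simple_rmod v) w = (if v = w then 1 else 0)"
    using simple_dims[OF v w] by (simp add: soc_mult_def)
qed

end

section \<open>The syzygy operator on $K_0$\<close>

lemma K0_relations_subset: "K0_relations A \<subseteq> carrier (K0_free A)"
proof
  fix r assume "r \<in> K0_relations A"
  then show "r \<in> carrier (K0_free A)"
    unfolding K0_relations_def K0_free_def
    by (auto dest!: subsetD[OF keys_diff])
qed

lemma K0_normal: "generate (K0_free A) (K0_relations A) \<lhd> K0_free A"
proof -
  interpret comm_group "K0_free A" unfolding K0_free_def by (rule abelian_free_Abelian_group)
  show ?thesis by (rule subgroup_imp_normal) (rule generate_is_subgroup[OF K0_relations_subset])
qed

lemma comm_group_K0: "comm_group (K0 A)"
proof -
  interpret comm_group "K0_free A" unfolding K0_free_def by (rule abelian_free_Abelian_group)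
  show ?thesis unfolding K0_def
    by (rule abelian_FactGroup) (rule generate_is_subgroup[OF K0_relations_subset])
qed

lemma K0_proj_hom:
  "(\<lambda>x. generate (K0_free A) (K0_relations A) #>\<^bsub>K0_free A\<^esub> x) \<in> hom (K0_free A) (K0 A)"
  unfolding K0_def by (rule normal.r_coset_hom_Mod[OF K0_normal])

lemma frag_of_iso_class: "M \<in> fgmod A \<Longrightarrow> frag_of (iso_class A M) \<in> carrier (K0_free A)"
  by (simp add: K0_free_def)

lemma K0_class_closed: "M \<in> fgmod A \<Longrightarrow> K0_class A M \<in> carrier (K0 A)"
  unfolding K0_class_def using hom_in_carrier[OF K0_proj_hom frag_of_iso_class] by blast

text \<open>The classes of modules generate the group, so closure under differences, written
  multiplicatively, is enough.\<close>

lemma K0_induct: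
  assumes x: "x \<in> carrier (K0 A)"
    and one: "Q \<one>\<^bsub>K0 A\<^esub>"
    and diff: "\<And>x y. x \<in> carrier (K0 A) \<Longrightarrow> y \<in> carrier (K0 A) \<Longrightarrow> Q x \<Longrightarrow> Q y \<Longrightarrow> Q (x \<otimes>\<^bsub>K0 A\<^esub> inv\<^bsub>K0 A\<^esub> y)"
    and gen: "\<And>M. M \<in> fgmod A \<Longrightarrow> Q (K0_class A M)"
  shows "Q x"
proof -
  let ?F = "K0_free A"
  define \<pi> where "\<pi> y = generate ?F (K0_relations A) #>\<^bsub>?F\<^esub> y" for y
  interpret F: comm_group ?F unfolding K0_free_def by (rule abelian_free_Abelian_group)
  interpret G: comm_group "K0 A" by (rule comm_group_K0)
  interpret \<pi>: group_hom ?F "K0 A" \<pi>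
    by unfold_locales (use K0_proj_hom in \<open>simp add: \<pi>_def[abs_def]\<close>)
  obtain f where f: "f \<in> carrier ?F" "x = \<pi> f"
    using x by (auto simp: K0_def carrier_FactGroup \<pi>_def)
  have "Poly_Mapping.keys f \<subseteq> iso_class A ` fgmod A" using f(1) by (simp add: K0_free_def)
  then have "Q (\<pi> f)"
  proof (rule free_Abelian_group_induct)
    show "Q (\<pi> 0)" using \<pi>.hom_one one by (simp add: K0_free_def)
    fix c assume "c \<in> iso_class A ` fgmod A"
    then show "Q (\<pi> (frag_of c))" using gen by (auto simp: K0_class_def \<pi>_def)
  next
    fix y z assume yz: "Poly_Mapping.keys y \<subseteq> iso_class A ` fgmod A" "Poly_Mapping.keys z \<subseteq> iso_class A ` fgmod A"
      and Q: "Q (\<pi> y)" "Q (\<pi> z)"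
    have c: "y \<in> carrier ?F" "z \<in> carrier ?F" using yz by (simp_all add: K0_free_def)
    have "y - z = y \<otimes>\<^bsub>?F\<^esub> inv\<^bsub>?F\<^esub> z" using yz by (simp add: K0_free_def)
    then have "\<pi> (y - z) = \<pi> y \<otimes>\<^bsub>K0 A\<^esub> inv\<^bsub>K0 A\<^esub> \<pi> z" using c by simp
    then show "Q (\<pi> (y - z))" using diff Q c by simp
  qed
  then show ?thesis using f(2) by simp
qed

lemma K0_hom_eq:
  assumes G: "group G" and g: "g \<in> hom (K0 A) G" and h: "h \<in> hom (K0 A) G"
    and eq: "\<And>M. M \<in> fgmod A \<Longrightarrow> g (K0_class A M) = h (K0_class A M)"
    and x: "x \<in> carrier (K0 A)"
  shows "g x = h x"
proof -
  interpret K: comm_group "K0 A" by (rule comm_group_K0)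
  interpret g: group_hom "K0 A" G g using G g by (simp add: group_hom_def group_hom_axioms_def)
  interpret h: group_hom "K0 A" G h using G h by (simp add: group_hom_def group_hom_axioms_def)
  show ?thesis using x by (rule K0_induct) (auto simp: eq)
qed

lemma iso_class_eqI:
  assumes M: "M \<in> fgmod A" and iso: "rmod_iso A M N"
  shows "iso_class A M = iso_class A N"
proof -
  have "right_module A M" using M by (simp add: fgmod_def)
  then show ?thesis
    using rmod_iso_trans[OF iso] rmod_iso_trans[OF rmod_iso_sym[OF _ iso]] by (auto simp: iso_class_def)
qed

lemma K0_class_iso: "M \<in> fgmod A \<Longrightarrow> rmod_iso A M N \<Longrightarrow> K0_class A M = K0_class A N"
  by (simp add: K0_class_def iso_class_eqI)

lemma K0_coset_one:
  assumes "r \<in> K0_relations A"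
  shows "generate (K0_free A) (K0_relations A) #>\<^bsub>K0_free A\<^esub> r = \<one>\<^bsub>K0 A\<^esub>"
proof -
  interpret F: comm_group "K0_free A" unfolding K0_free_def by (rule abelian_free_Abelian_group)
  have "r \<in> generate (K0_free A) (K0_relations A)" using assms by (rule generate.incl)
  then show ?thesis
    unfolding K0_def
    using F.coset_join2[of r] assms K0_relations_subset F.generate_is_subgroup[OF K0_relations_subset] by auto
qed

lemma K0_class_projective:
  "P \<in> fgmod A \<Longrightarrow> projective A P \<Longrightarrow> K0_class A P = \<one>\<^bsub>K0 A\<^esub>"
  unfolding K0_class_def by (rule K0_coset_one) (auto simp: K0_relations_def)

lemma K0_class_sum:
  assumes "M \<in> fgmod A" "X \<in> fgmod A" "Y \<in> fgmod A" "rmod_iso A M (rmod_sum X Y)"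
  shows "K0_class A M = K0_class A X \<otimes>\<^bsub>K0 A\<^esub> K0_class A Y"
proof -
  let ?F = "K0_free A"
  define \<pi> where "\<pi> y = generate ?F (K0_relations A) #>\<^bsub>?F\<^esub> y" for y
  interpret G: comm_group "K0 A" by (rule comm_group_K0)
  define m x y where "m = frag_of (iso_class A M)" and "x = frag_of (iso_class A X)" and "y = frag_of (iso_class A Y)"
  have r: "m - x - y \<in> K0_relations A" using assms unfolding K0_relations_def m_def x_def y_def by blast
  then have rc: "m - x - y \<in> carrier ?F" using K0_relations_subset by auto
  have c: "x \<in> carrier ?F" "y \<in> carrier ?F" using assms frag_of_iso_class by (auto simp: x_def y_def)
  interpret F: comm_group ?F unfolding K0_free_def by (rule abelian_free_Abelian_group)
  have plus: "\<And>a b. a \<otimes>\<^bsub>?F\<^esub> b = a + b" by (simp add: K0_free_def)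
  have hom: "\<And>a b. a \<in> carrier ?F \<Longrightarrow> b \<in> carrier ?F \<Longrightarrow> \<pi> (a + b) = \<pi> a \<otimes>\<^bsub>K0 A\<^esub> \<pi> b"
    using hom_mult[OF K0_proj_hom[of A]] by (simp add: \<pi>_def plus)
  have cl: "\<And>a. a \<in> carrier ?F \<Longrightarrow> \<pi> a \<in> carrier (K0 A)"
    using hom_in_carrier[OF K0_proj_hom] by (simp add: \<pi>_def)
  have "\<pi> m = \<pi> ((m - x - y) + (x + y))" by simp
  also have "\<dots> = \<pi> (m - x - y) \<otimes>\<^bsub>K0 A\<^esub> \<pi> (x + y)"
    using F.m_closed[OF c] by (intro hom rc) (simp add: plus)
  also have "\<dots> = \<pi> x \<otimes>\<^bsub>K0 A\<^esub> \<pi> y"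
    using K0_coset_one[OF r] hom[OF c] cl[OF c(1)] cl[OF c(2)] by (simp add: \<pi>_def)
  finally show ?thesis by (simp add: K0_class_def \<pi>_def m_def x_def y_def)
qed

text \<open>A zero module is isomorphic to the direct sum of two copies of itself, so its class is
  idempotent in a group.\<close>

lemma K0_class_zero:
  assumes M: "M \<in> fgmod A" and z: "carrier M = {\<zero>\<^bsub>M\<^esub>}"
  shows "K0_class A M = \<one>\<^bsub>K0 A\<^esub>"
proof -
  interpret G: comm_group "K0 A" by (rule comm_group_K0)
  have M': "right_module A M" using M by (simp add: fgmod_def)
  then interpret M: right_module A M .
  have "rmod_iso A M (rmod_sum M M)" unfolding rmod_iso_def
  proof (rule bexI)
    show "(\<lambda>x. (x, x)) \<in> rmod_hom A M (rmod_sum M M)" by (rule rmod_homI) auto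
    show "bij_betw (\<lambda>x. (x, x)) (carrier M) (carrier (rmod_sum M M))" by (simp add: z bij_betw_def)
  qed
  from K0_class_sum[OF M M M this] show ?thesis using K0_class_closed[OF M] by simp
qed

text \<open>Additive isomorphism invariants that are trivial on projectives factor through the
  presentation. The syzygy operator and the functionals that separate the simple classes both arise
  in this way.\<close>

lemma K0_hom_exists:
  fixes f :: "'a std_rmod \<Rightarrow> 'g"
  assumes G: "comm_group G" and closed: "\<And>M. M \<in> fgmod A \<Longrightarrow> f M \<in> carrier G"
    and iso: "\<And>M N. M \<in> fgmod A \<Longrightarrow> N \<in> fgmod A \<Longrightarrow> rmod_iso A M N \<Longrightarrow> f M = f N"
    and add: "\<And>M X Y. M \<in> fgmod A \<Longrightarrow> X \<in> fgmod A \<Longrightarrow> Y \<in> fgmod A \<Longrightarrow> rmod_iso A M (rmod_sum X Y) \<Longrightarrow>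
      f M = f X \<otimes>\<^bsub>G\<^esub> f Y"
    and proj: "\<And>P. P \<in> fgmod A \<Longrightarrow> projective A P \<Longrightarrow> f P = \<one>\<^bsub>G\<^esub>"
  obtains g where "g \<in> hom (K0 A) G" "\<And>M. M \<in> fgmod A \<Longrightarrow> g (K0_class A M) = f M"
proof -
  let ?F = "K0_free A"
  interpret G: comm_group G by fact
  interpret F: comm_group ?F unfolding K0_free_def by (rule abelian_free_Abelian_group)
  \<comment> \<open>The free group is based on isomorphism classes, so \<open>f\<close> is evaluated
    on a chosen representative; invariance makes the choice harmless.\<close>
  define F where "F c = f (SOME M. M \<in> fgmod A \<and> iso_class A M = c)" for c
  have Ff: "F (iso_class A M) = f M" if M: "M \<in> fgmod A" for M
  proof -
    define N where "N = (SOME N. N \<in> fgmod A \<and> iso_class A N = iso_class A M)"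
    have N: "N \<in> fgmod A \<and> iso_class A N = iso_class A M"
      unfolding N_def by (rule someI) (use M in simp)
    have "M \<in> iso_class A M" using M rmod_iso_refl by (auto simp: iso_class_def)
    then have "rmod_iso A N M" using N by (auto simp: iso_class_def)
    then show ?thesis using iso[of N M] N M by (simp add: F_def N_def)
  qed
  have "F ` (iso_class A ` fgmod A) \<subseteq> carrier G" using Ff closed by auto
  then obtain h where h: "h \<in> hom ?F G" "\<And>c. c \<in> iso_class A ` fgmod A \<Longrightarrow> h (frag_of c) = F c"
    unfolding K0_free_def by (rule G.free_Abelian_group_universal) blast
  interpret h: group_hom ?F G h using h(1) by unfold_locales
  have hM: "h (frag_of (iso_class A M)) = f M" if "M \<in> fgmod A" for M
    using h(2) Ff[OF that] that by auto
  have "h r = \<one>\<^bsub>G\<^esub>" if r: "r \<in> K0_relations A" for r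
  proof -
    have rc: "r \<in> carrier ?F" using r K0_relations_subset by auto
    from r consider (sum) M X Y where "r = frag_of (iso_class A M) - frag_of (iso_class A X) - frag_of (iso_class A Y)"
        "M \<in> fgmod A" "X \<in> fgmod A" "Y \<in> fgmod A" "rmod_iso A M (rmod_sum X Y)"
      | (proj) P where "r = frag_of (iso_class A P)" "P \<in> fgmod A" "projective A P"
      unfolding K0_relations_def by blast
    then show ?thesis
    proof cases
      case sum
      have plus: "\<And>a b. a \<otimes>\<^bsub>?F\<^esub> b = a + b" by (simp add: K0_free_def)
      note c = frag_of_iso_class[OF sum(3)] frag_of_iso_class[OF sum(4)]
      have "frag_of (iso_class A M) = r \<otimes>\<^bsub>?F\<^esub> (frag_of (iso_class A X) \<otimes>\<^bsub>?F\<^esub> frag_of (iso_class A Y))"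
        using sum(1) by (simp add: plus)
      then have "f M = h r \<otimes>\<^bsub>G\<^esub> (f X \<otimes>\<^bsub>G\<^esub> f Y)"
        using h.hom_mult rc c hM sum by (metis F.m_closed)
      then have "f M = h r \<otimes>\<^bsub>G\<^esub> f M" using add[OF sum(2-5)] by simp
      then show ?thesis using closed[OF sum(2)] rc by (simp add: G.r_cancel_one')
    next
      case proj
      then show ?thesis using hM assms(5) by simp
    qed
  qed
  then have "generate ?F (K0_relations A) \<subseteq> kernel ?F G h"
    using K0_relations_subset by (intro F.generate_subgroup_incl h.subgroup_kernel) (auto simp: kernel_def)
  then obtain g where g: "g \<in> hom (?F Mod generate ?F (K0_relations A)) G"
    "\<And>x. x \<in> carrier ?F \<Longrightarrow> g (generate ?F (K0_relations A) #>\<^bsub>?F\<^esub> x) = h x"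
    using h.FactGroup_universal_kernel[OF K0_normal] by blast
  show thesis
  proof
    show "g \<in> hom (K0 A) G" using g(1) by (simp add: K0_def)
    show "g (K0_class A M) = f M" if "M \<in> fgmod A" for M
      using g(2)[OF frag_of_iso_class[OF that]] hM[OF that] by (simp add: K0_class_def)
  qed
qed

lemma hom_finprod:
  assumes G: "comm_group G" and H: "comm_group H" and h: "h \<in> hom G H" and f: "f \<in> I \<rightarrow> carrier G"
  shows "h (finprod G f I) = finprod H (\<lambda>i. h (f i)) I"
proof -
  interpret G: comm_group G by fact
  interpret H: comm_group H by fact
  interpret h: group_hom G H h using h by unfold_locales
  show ?thesis using f by (induct I rule: infinite_finite_induct) (auto simp: Pi_iff)
qed

lemma finprod_integer_group: "finite I \<Longrightarrow> finprod integer_group f I = sum f I"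
proof -
  interpret comm_group integer_group by (rule abelian_integer_group)
  have Z: "\<one>\<^bsub>integer_group\<^esub> = 0" "\<And>x y. x \<otimes>\<^bsub>integer_group\<^esub> y = x + y" "carrier integer_group = UNIV"
    by (simp_all add: integer_group_def)
  show "finite I \<Longrightarrow> ?thesis" by (induct I rule: finite_induct) (auto simp: Z)
qed

context split_rad_square_zero
begin

text \<open>The integer combination of the simple classes with coefficients \<open>x v\<close>; the
  group is written multiplicatively, whence the product of powers.\<close>

definition simple_prod :: "('v \<Rightarrow> int) \<Rightarrow> ('a std_rmod set \<Rightarrow>\<^sub>0 int) set" where
  "simple_prod x = finprod (K0 A) (\<lambda>v. K0_class A (simple_rmod v) [^]\<^bsub>K0 A\<^esub> x v) V"

lemma simple_class_closed: "v \<in> V \<Longrightarrow> K0_class A (simple_rmod v) \<in> carrier (K0 A)"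
  by (rule K0_class_closed[OF simple_rmod_fgmod])

lemma simple_pow_closed: "(\<lambda>v. K0_class A (simple_rmod v) [^]\<^bsub>K0 A\<^esub> (x v :: int)) \<in> V \<rightarrow> carrier (K0 A)"
proof -
  interpret G: comm_group "K0 A" by (rule comm_group_K0)
  show ?thesis using simple_class_closed by auto
qed

lemma simple_prod_closed [simp]: "simple_prod x \<in> carrier (K0 A)"
proof -
  interpret G: comm_group "K0 A" by (rule comm_group_K0)
  show ?thesis unfolding simple_prod_def by (rule G.finprod_closed) (rule simple_pow_closed)
qed

lemma simple_prod_cong: "(\<And>v. v \<in> V \<Longrightarrow> x v = y v) \<Longrightarrow> simple_prod x = simple_prod y"
proof -
  interpret G: comm_group "K0 A" by (rule comm_group_K0)
  show "(\<And>v. v \<in> V \<Longrightarrow> x v = y v) \<Longrightarrow> ?thesis"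
    unfolding simple_prod_def by (intro G.finprod_cong') (auto simp: simple_class_closed)
qed

lemma simple_prod_add: "simple_prod (\<lambda>v. x v + y v) = simple_prod x \<otimes>\<^bsub>K0 A\<^esub> simple_prod y"
proof -
  interpret G: comm_group "K0 A" by (rule comm_group_K0)
  show ?thesis
    unfolding simple_prod_def G.finprod_multf[OF simple_pow_closed simple_pow_closed, symmetric]
    by (intro G.finprod_cong') (auto simp: simple_class_closed G.int_pow_mult)
qed

lemma simple_prod_zero: "simple_prod (\<lambda>_. 0) = \<one>\<^bsub>K0 A\<^esub>"
proof -
  interpret G: comm_group "K0 A" by (rule comm_group_K0)
  show ?thesis unfolding simple_prod_def by simp
qed

lemma simple_prod_inv: "simple_prod (\<lambda>v. - x v) = inv\<^bsub>K0 A\<^esub> simple_prod x"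
proof -
  interpret G: comm_group "K0 A" by (rule comm_group_K0)
  have "simple_prod (\<lambda>v. - x v) \<otimes>\<^bsub>K0 A\<^esub> simple_prod x = \<one>\<^bsub>K0 A\<^esub>"
    by (simp add: simple_prod_add[symmetric] simple_prod_zero)
  then show ?thesis using G.inv_equality by simp
qed

lemma simple_prod_pow: "simple_prod (\<lambda>v. k * x v) = simple_prod x [^]\<^bsub>K0 A\<^esub> (k :: int)"
proof -
  interpret G: comm_group "K0 A" by (rule comm_group_K0)
  have h: "(\<lambda>y. y [^]\<^bsub>K0 A\<^esub> k) \<in> hom (K0 A) (K0 A)" by (auto simp: hom_def G.int_pow_distrib)
  show ?thesis
    unfolding simple_prod_def hom_finprod[OF comm_group_K0 comm_group_K0 h simple_pow_closed]
    by (intro G.finprod_cong') (auto simp: simple_class_closed G.int_pow_pow mult.commute)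
qed

lemma simple_prod_finprod:
  "finite I \<Longrightarrow> finprod (K0 A) (\<lambda>i. simple_prod (x i)) I = simple_prod (\<lambda>v. \<Sum>i\<in>I. x i v)"
proof -
  interpret G: comm_group "K0 A" by (rule comm_group_K0)
  show "finite I \<Longrightarrow> ?thesis"
    by (induct I rule: finite_induct) (auto simp: simple_prod_zero simple_prod_add)
qed

text \<open>Induction on the total dimension: a nonzero vector at \<open>v\<close> spans a copy of
  the simple module at \<open>v\<close>, and this line has a complement because the radical is
  zero.\<close>

lemma K0_class_semisimple:
  "N \<in> fgmod A \<Longrightarrow> rad N = {\<zero>\<^bsub>N\<^esub>} \<Longrightarrow> K0_class A N = simple_prod (\<lambda>v. int (dimV N v))"
proof (induction "\<Sum>v\<in>V. dimV N v" arbitrary: N rule: less_induct)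
  case (less N)
  have N: "right_module A N" "fd N" using less.prems by (auto simp: fgmod_iff)
  interpret G: comm_group "K0 A" by (rule comm_group_K0)
  interpret N: right_module A N by (rule N)
  have sub: "\<And>v. v \<in> V \<Longrightarrow> ksub N (vcomp N v)" by (rule ksub_vcomp[OF N(1)])
  show ?case
  proof (cases "\<forall>v\<in>V. vcomp N v = {\<zero>\<^bsub>N\<^esub>}")
    case True
    have "x = \<zero>\<^bsub>N\<^esub>" if x: "x \<in> carrier N" for x
    proof -
      have "x = finsum N (\<lambda>v. x \<triangleleft>\<^bsub>N\<^esub> \<epsilon> v) V" by (rule vcomp_decompose[OF N(1) x])
      also have "\<dots> = \<zero>\<^bsub>N\<^esub>" using True ract_vcomp[OF N(1) _ x] by (intro N.M.finsum_all0) auto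
      finally show ?thesis .
    qed
    then have "carrier N = {\<zero>\<^bsub>N\<^esub>}" by auto
    moreover have "simple_prod (\<lambda>v. int (dimV N v)) = simple_prod (\<lambda>_. 0)"
      using True vdim_zero[OF N(1)] by (intro simple_prod_cong) (simp add: dimV_def)
    ultimately show ?thesis using K0_class_zero[OF less.prems(1)] simple_prod_zero by simp
  next
    case False
    then obtain v x where v: "v \<in> V" and x: "x \<in> vcomp N v" "x \<noteq> \<zero>\<^bsub>N\<^esub>"
      using ksubD(2)[OF sub] by blast
    have xN: "x \<in> carrier N" "x \<triangleleft>\<^bsub>N\<^esub> \<epsilon> v = x" using x by (auto simp: vcomp_def)
    obtain Y where Y: "rsubmodule A N Y" "x \<notin> Y"
      "\<And>z. z \<in> carrier N \<Longrightarrow> \<exists>y\<in>Y. \<exists>c. z = y \<oplus>\<^bsub>N\<^esub> x \<triangleleft>\<^bsub>N\<^esub> \<kappa> c"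
      \<comment> \<open>As the radical is zero, the nonzero vector \<open>x\<close> lies outside
        it.\<close>
      by (rule complement_line[OF N v x(1)]) (use x(2) less.prems(2) in blast)+
    define e where "e c = x \<triangleleft>\<^bsub>N\<^esub> \<kappa> c" for c
    \<comment> \<open>\<open>J\<close> acts as zero on \<open>N\<close> and \<open>x\<close> sits at
      \<open>v\<close>, so \<open>a\<close> acts on \<open>x\<close> through its character at
      \<open>v\<close>.\<close>
    have xa: "x \<triangleleft>\<^bsub>N\<^esub> a = x \<triangleleft>\<^bsub>N\<^esub> \<kappa> (\<chi> v a)" if a: "a \<in> carrier A" for a
    proof -
      have b: "\<epsilon> v \<otimes> a \<in> carrier A" "\<epsilon> v \<otimes> (\<epsilon> v \<otimes> a) = \<epsilon> v \<otimes> a"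
        using a v by (simp_all add: m_assoc[symmetric] \<epsilon>_mult)
      obtain r where r: "r \<in> J" "\<epsilon> v \<otimes> a = \<epsilon> v \<otimes> \<kappa> (\<chi> v (\<epsilon> v \<otimes> a)) \<oplus> r" by (rule left_decomp[OF v b])
      have \<chi>: "\<chi> v (\<epsilon> v \<otimes> a) = \<chi> v a" using v a by (simp add: \<chi>_mult \<chi>_\<epsilon>)
      have "x \<triangleleft>\<^bsub>N\<^esub> r = \<zero>\<^bsub>N\<^esub>" using rad_mem[OF xN(1) r(1)] less.prems(2) by auto
      moreover have "x \<triangleleft>\<^bsub>N\<^esub> a = x \<triangleleft>\<^bsub>N\<^esub> (\<epsilon> v \<otimes> a)" using xN v a by (simp add: N.ract_mult)
      moreover have "x \<triangleleft>\<^bsub>N\<^esub> (\<epsilon> v \<otimes> \<kappa> (\<chi> v a) \<oplus> r) = x \<triangleleft>\<^bsub>N\<^esub> (\<epsilon> v \<otimes> \<kappa> (\<chi> v a)) \<oplus>\<^bsub>N\<^esub> x \<triangleleft>\<^bsub>N\<^esub> r"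
        using xN(1) v J_carrier[OF r(1)] by (intro N.ract_add_right) auto
      ultimately show ?thesis using r(2) xN v N.ract_closed by (simp add: \<chi> N.ract_mult)
    qed
    have e: "e \<in> rmod_hom A (simple_field v) N"
    proof (rule rmod_homI)
      fix c a assume a: "a \<in> carrier A"
      have "e c \<triangleleft>\<^bsub>N\<^esub> a = x \<triangleleft>\<^bsub>N\<^esub> (\<kappa> c \<otimes> a)" using xN a by (simp add: e_def N.ract_mult)
      also have "\<dots> = e (c * \<chi> v a)" using xa[of "\<kappa> c \<otimes> a"] a v by (simp add: e_def \<chi>_mult \<chi>_\<kappa>)
      finally show "e (c \<triangleleft>\<^bsub>simple_field v\<^esub> a) = e c \<triangleleft>\<^bsub>N\<^esub> a" by simp
    qed (use xN in \<open>auto simp: e_def N.ract_closed \<kappa>_add N.ract_add_right\<close>)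
    have e_notin: "e c \<notin> Y" if "c \<noteq> 0" for c
    proof
      assume "e c \<in> Y"
      then have "e c \<triangleleft>\<^bsub>N\<^esub> \<kappa> (inverse c) \<in> Y" using rsubmoduleD(4)[OF Y(1)] by simp
      moreover have "e c \<triangleleft>\<^bsub>N\<^esub> \<kappa> (inverse c) = x \<triangleleft>\<^bsub>N\<^esub> \<kappa> (c * inverse c)"
        using xN by (simp add: e_def \<kappa>_mult N.ract_mult)
      ultimately show False using that Y(2) xN by (simp add: \<kappa>_one N.ract_one)
    qed
    define X where "X = e ` UNIV"
    note S = simple_field_right_module[OF v]
    interpret S: right_module A "simple_field v" by (rule S)
    have X: "rsubmodule A N X"
      using rsubmodule_image[OF S N(1) e rsubmodule_carrier[OF S]] by (simp add: X_def)
    have Yd: "\<zero>\<^bsub>N\<^esub> \<in> Y" using rsubmoduleD(2)[OF Y(1)] .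
    have e0: "e 0 = \<zero>\<^bsub>N\<^esub>" using xN by (simp add: e_def \<kappa>_zero)
    have "inj_on e (carrier (simple_field v))"
      by (rule rmod_hom_inj_onI[OF S.abelian_group_axioms N.abelian_group_axioms e]) (use e_notin Yd in force)
    then have "rmod_iso A (simple_field v) (N\<lparr>carrier := X\<rparr>)"
      using e unfolding rmod_iso_def
      by (intro bexI[of _ e]) (auto simp: bij_betw_def X_def rmod_hom_def)
    then have isoX: "rmod_iso A (simple_rmod v) (N\<lparr>carrier := X\<rparr>)"
      using rmod_iso_trans[OF rmod_iso_sym[OF S simple_transport(2)[OF v]]] by blast
    have iso: "rmod_iso A N (rmod_sum (N\<lparr>carrier := X\<rparr>) (N\<lparr>carrier := Y\<rparr>))"
    proof (rule rmod_sum_internal[OF N(1) X Y(1)])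
      have "e c = \<zero>\<^bsub>N\<^esub>" if "e c \<in> Y" for c using e_notin[of c] e0 that by (cases "c = 0") auto
      then show "X \<inter> Y \<subseteq> {\<zero>\<^bsub>N\<^esub>}" unfolding X_def by blast
      fix z assume "z \<in> carrier N"
      then obtain y c where "y \<in> Y" "z = y \<oplus>\<^bsub>N\<^esub> e c" using Y(3) unfolding e_def by blast
      moreover from this have "y \<oplus>\<^bsub>N\<^esub> e c = e c \<oplus>\<^bsub>N\<^esub> y"
        using rsubmoduleD(1)[OF Y(1)] rmod_homD(1)[OF e] by (intro N.M.a_comm) auto
      ultimately show "\<exists>x\<in>X. \<exists>y\<in>Y. z = x \<oplus>\<^bsub>N\<^esub> y" by (auto simp: X_def)
    qed
    let ?X = "N\<lparr>carrier := X\<rparr>" and ?Y = "N\<lparr>carrier := Y\<rparr>"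
    have fg: "?X \<in> fgmod A" "?Y \<in> fgmod A" using fgmod_restrict[OF less.prems(1)] X Y(1) by auto
    have XY: "right_module A ?X" "right_module A ?Y" using fg by (auto simp: fgmod_iff)
    have dX: "dimV ?X w = (if v = w then 1 else 0)" if "w \<in> V" for w
      using dim_iso(1)[OF simple_transport(1)[OF v] XY(1) _ isoX that] simple_rmod_fgmod[OF v] simple_dims(1)[OF v that]
      by (simp add: fgmod_iff)
    have dN: "dimV N w = dimV ?X w + dimV ?Y w" if "w \<in> V" for w
      by (rule dim_sum(1)[OF N(1) XY N(2) iso that])
    \<comment> \<open>The dimension drops by one at \<open>v\<close> and stays the same at the other
      vertices.\<close>
    have "(\<Sum>w\<in>V. dimV ?Y w) < (\<Sum>w\<in>V. dimV N w)"
      by (rule sum_strict_mono_ex1[OF finite_V]) (use dN dX v in auto)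
    moreover have "rad ?Y = {\<zero>\<^bsub>?Y\<^esub>}"
    proof -
      have "x \<triangleleft>\<^bsub>N\<^esub> j = \<zero>\<^bsub>N\<^esub>" if "x \<in> carrier N" "j \<in> J" for x j
        using rad_mem[OF that] less.prems(2) by auto
      then have "rad ?Y \<subseteq> {\<zero>\<^bsub>?Y\<^esub>}"
        using rsubmoduleD(1)[OF Y(1)] by (intro rad_least[OF rsubmodule_zero[OF XY(2)]]) auto
      then show ?thesis using rsubmoduleD(2)[OF rad_rsubmodule[OF XY(2)]] by auto
    qed
    ultimately have IH: "K0_class A ?Y = simple_prod (\<lambda>w. int (dimV ?Y w))"
      using less.hyps fg(2) by blast
    have "K0_class A ?X = simple_prod (\<lambda>w. int (dimV ?X w))"
    proof -
      have "simple_prod (\<lambda>w. int (dimV ?X w)) =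
          finprod (K0 A) (\<lambda>w. if v = w then K0_class A (simple_rmod w) else \<one>\<^bsub>K0 A\<^esub>) V"
        unfolding simple_prod_def by (intro G.finprod_cong') (auto simp: dX simple_class_closed)
      also have "\<dots> = K0_class A (simple_rmod v)"
        using v finite_V simple_class_closed by (intro G.finprod_singleton) auto
      finally show ?thesis using K0_class_iso[OF simple_rmod_fgmod[OF v] isoX] by simp
    qed
    then have "K0_class A N = simple_prod (\<lambda>w. int (dimV ?X w) + int (dimV ?Y w))"
      using K0_class_sum[OF less.prems(1) fg iso] IH by (simp add: simple_prod_add)
    also have "\<dots> = simple_prod (\<lambda>w. int (dimV N w))" by (intro simple_prod_cong) (simp add: dN)
    finally show ?thesis .
  qed
qed

text \<open>The definite description has to be shown to denote. Every syzygy of \<open>M\<close> has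
  the class with coefficients \<open>syz_dim M\<close>; these are additive and vanish on
  projectives, so a homomorphism with these values exists. It is unique since classes of modules
  generate the group and every module has a syzygy.\<close>

lemma Omega_bar:
  shows "Omega_bar A \<in> hom (K0 A) (K0 A)"
    and "\<And>M. M \<in> fgmod A \<Longrightarrow> Omega_bar A (K0_class A M) = simple_prod (syz_dim M)"
proof -
  interpret G: comm_group "K0 A" by (rule comm_group_K0)
  define Q where "Q h \<longleftrightarrow> h \<in> hom (K0 A) (K0 A) \<and> h \<in> extensional (carrier (K0 A)) \<and>
        (\<forall>M\<in>fgmod A. \<forall>N\<in>fgmod A. is_syzygy A M N \<longrightarrow> h (K0_class A M) = K0_class A N)" for h
  have syz: "K0_class A N = simple_prod (syz_dim M)" if "M \<in> fgmod A" "N \<in> fgmod A" "is_syzygy A M N" for M N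
    using K0_class_semisimple[OF that(2)] syzygy_dims[OF that] simple_prod_cong[of "\<lambda>v. int (dimV N v)" "syz_dim M"] by simp
  have val: "h (K0_class A M) = simple_prod (syz_dim M)" if "Q h" and M: "M \<in> fgmod A" for h M
  proof -
    obtain N where "N \<in> fgmod A" "is_syzygy A M N" by (rule syzygy_exists[OF M])
    then show ?thesis using that syz[OF M] by (auto simp: Q_def)
  qed
  obtain g where g: "g \<in> hom (K0 A) (K0 A)" "\<And>M. M \<in> fgmod A \<Longrightarrow> g (K0_class A M) = simple_prod (syz_dim M)"
  proof (rule K0_hom_exists[OF comm_group_K0, of A "\<lambda>M. simple_prod (syz_dim M)"])
    fix M N :: "'a std_rmod" assume "M \<in> fgmod A" "N \<in> fgmod A" "rmod_iso A M N"
    then show "simple_prod (syz_dim M) = simple_prod (syz_dim N)"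
      by (intro simple_prod_cong syz_dim_iso[symmetric]) (auto simp: fgmod_iff)
  next
    fix M X Y :: "'a std_rmod"
    assume "M \<in> fgmod A" "X \<in> fgmod A" "Y \<in> fgmod A" "rmod_iso A M (rmod_sum X Y)"
    then show "simple_prod (syz_dim M) = simple_prod (syz_dim X) \<otimes>\<^bsub>K0 A\<^esub> simple_prod (syz_dim Y)"
      unfolding simple_prod_add[symmetric] by (intro simple_prod_cong syz_dim_sum) (auto simp: fgmod_iff)
  next
    fix P :: "'a std_rmod" assume P: "P \<in> fgmod A" "projective A P"
    have "simple_prod (syz_dim P) = simple_prod (\<lambda>_. 0)"
      by (intro simple_prod_cong projective_dims(1)[OF P])
    then show "simple_prod (syz_dim P) = \<one>\<^bsub>K0 A\<^esub>" by (simp add: simple_prod_zero)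
  qed auto
  define h where "h = restrict g (carrier (K0 A))"
  have hg: "h x = g x" if "x \<in> carrier (K0 A)" for x using that by (simp add: h_def)
  have "h \<in> hom (K0 A) (K0 A)" using g(1) by (auto simp: hom_def hg Pi_iff)
  moreover have "h (K0_class A M) = K0_class A N" if "M \<in> fgmod A" "N \<in> fgmod A" "is_syzygy A M N" for M N
    using g(2)[OF that(1)] syz[OF that] hg[OF K0_class_closed[OF that(1)]] by simp
  moreover have "h \<in> extensional (carrier (K0 A))" by (simp add: h_def)
  ultimately have Qh: "Q h" by (auto simp: Q_def)
  have uniq: "h' = h" if "Q h'" for h'
  proof (rule extensionalityI)
    show "h' \<in> extensional (carrier (K0 A))" "h \<in> extensional (carrier (K0 A))" using that Qh by (auto simp: Q_def)
    fix x assume x: "x \<in> carrier (K0 A)"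
    have "h' \<in> hom (K0 A) (K0 A)" "h \<in> hom (K0 A) (K0 A)" using that Qh by (auto simp: Q_def)
    moreover have "h' (K0_class A M) = h (K0_class A M)" if "M \<in> fgmod A" for M
      using val[OF \<open>Q h'\<close> that] val[OF Qh that] by simp
    ultimately show "h' x = h x" by (rule K0_hom_eq[OF G.is_group _ _ _ x])
  qed
  have "Omega_bar A = (THE h. Q h)" by (simp add: Omega_bar_def Q_def)
  also have "\<dots> = h" by (rule the_equality) (fact Qh uniq)+
  finally have "Omega_bar A = h" .
  then show "Omega_bar A \<in> hom (K0 A) (K0 A)"
    "\<And>M. M \<in> fgmod A \<Longrightarrow> Omega_bar A (K0_class A M) = simple_prod (syz_dim M)"
    using Qh val by (auto simp: Q_def)
qed

text \<open>True on generators, and the combinations of simple classes are closed under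
  differences.\<close>

lemma Omega_bar_range:
  assumes "x \<in> carrier (K0 A)"
  shows "\<exists>c. Omega_bar A x = simple_prod c"
  using assms
proof (rule K0_induct)
  interpret G: comm_group "K0 A" by (rule comm_group_K0)
  interpret O: group_hom "K0 A" "K0 A" "Omega_bar A" using Omega_bar(1) by unfold_locales
  show "\<exists>c. Omega_bar A \<one>\<^bsub>K0 A\<^esub> = simple_prod c" using simple_prod_zero by auto
  show "\<exists>c. Omega_bar A (K0_class A M) = simple_prod c" if "M \<in> fgmod A" for M using Omega_bar(2)[OF that] by auto
  fix x y assume "x \<in> carrier (K0 A)" "y \<in> carrier (K0 A)"
    "\<exists>c. Omega_bar A x = simple_prod c" "\<exists>c. Omega_bar A y = simple_prod c"
  then obtain c d where "Omega_bar A (x \<otimes>\<^bsub>K0 A\<^esub> inv\<^bsub>K0 A\<^esub> y) = simple_prod c \<otimes>\<^bsub>K0 A\<^esub> simple_prod (\<lambda>v. - d v)"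
    by (auto simp: simple_prod_inv)
  then show "\<exists>c. Omega_bar A (x \<otimes>\<^bsub>K0 A\<^esub> inv\<^bsub>K0 A\<^esub> y) = simple_prod c"
    unfolding simple_prod_add[symmetric] by blast
qed

text \<open>Coefficients behave as row vectors, multiplied from the right by the matrix
  \<open>adim\<close>: a simple class goes to its row, by \<open>simple_mults\<close>.\<close>

lemma Omega_bar_simple_prod:
  "Omega_bar A (simple_prod x) = simple_prod (\<lambda>w. \<Sum>v\<in>V. x v * int (adim v w))"
proof -
  interpret G: comm_group "K0 A" by (rule comm_group_K0)
  interpret O: group_hom "K0 A" "K0 A" "Omega_bar A" using Omega_bar(1) by unfold_locales
  have "Omega_bar A (simple_prod x) =
      finprod (K0 A) (\<lambda>v. Omega_bar A (K0_class A (simple_rmod v) [^]\<^bsub>K0 A\<^esub> x v)) V"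
    unfolding simple_prod_def by (rule hom_finprod[OF comm_group_K0 comm_group_K0 Omega_bar(1) simple_pow_closed])
  also have "\<dots> = finprod (K0 A) (\<lambda>v. simple_prod (\<lambda>w. x v * int (adim v w))) V"
  proof (rule G.finprod_cong')
    fix v assume v: "v \<in> V"
    have "Omega_bar A (K0_class A (simple_rmod v)) = simple_prod (\<lambda>w. int (adim v w))"
      using Omega_bar(2)[OF simple_rmod_fgmod[OF v]] simple_prod_cong[of "syz_dim (simple_rmod v)"] simple_mults(1)[OF v] by simp
    then show "Omega_bar A (K0_class A (simple_rmod v) [^]\<^bsub>K0 A\<^esub> x v) = simple_prod (\<lambda>w. x v * int (adim v w))"
      using simple_class_closed[OF v] by (simp add: O.hom_int_pow simple_prod_pow)
  qed auto
  also have "\<dots> = simple_prod (\<lambda>w. \<Sum>v\<in>V. x v * int (adim v w))" by (rule simple_prod_finprod[OF finite_V])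
  finally show ?thesis .
qed

text \<open>For a nonsink \<open>v\<close>, the additive invariant \<open>soc_mult\<close> vanishes
  on projectives and so induces a homomorphism to the integers. It is 1 on the simple class at
  \<open>v\<close> and 0 on the others, hence reads off \<open>x v\<close>.\<close>

lemma simple_prod_coord:
  assumes v: "v \<in> V" "nonsink v" and eq: "simple_prod x = \<one>\<^bsub>K0 A\<^esub>"
  shows "x v = 0"
proof -
  interpret Z: comm_group integer_group by (rule abelian_integer_group)
  interpret G: comm_group "K0 A" by (rule comm_group_K0)
  obtain g where g: "g \<in> hom (K0 A) integer_group" "\<And>M. M \<in> fgmod A \<Longrightarrow> g (K0_class A M) = soc_mult M v"
  proof (rule K0_hom_exists[OF abelian_integer_group, of A "\<lambda>M. soc_mult M v"])
    fix M N :: "'a std_rmod" assume "M \<in> fgmod A" "N \<in> fgmod A" "rmod_iso A M N"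
    then show "soc_mult M v = soc_mult N v"
      by (intro soc_mult_iso[symmetric] v) (auto simp: fgmod_iff)
  next
    fix M X Y :: "'a std_rmod"
    assume "M \<in> fgmod A" "X \<in> fgmod A" "Y \<in> fgmod A" "rmod_iso A M (rmod_sum X Y)"
    then have "soc_mult M v = soc_mult X v + soc_mult Y v"
      by (intro soc_mult_sum v) (auto simp: fgmod_iff)
    then show "soc_mult M v = soc_mult X v \<otimes>\<^bsub>integer_group\<^esub> soc_mult Y v" by (simp add: integer_group_def)
  qed (use projective_dims(2) v in \<open>auto simp: integer_group_def\<close>)
  interpret g: group_hom "K0 A" integer_group g using g(1) by unfold_locales
  have "0 = g (simple_prod x)" using eq g.hom_one by (simp add: integer_group_def)
  also have "\<dots> = (\<Sum>u\<in>V. g (K0_class A (simple_rmod u) [^]\<^bsub>K0 A\<^esub> x u))"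
    unfolding simple_prod_def hom_finprod[OF comm_group_K0 abelian_integer_group g(1) simple_pow_closed]
    by (rule finprod_integer_group[OF finite_V])
  also have "\<dots> = (\<Sum>u\<in>V. if u = v then x v else 0)"
    using g(2)[OF simple_rmod_fgmod] simple_mults(2)[OF _ v(1)] simple_class_closed
    by (intro sum.cong) (auto simp: g.hom_int_pow)
  also have "\<dots> = x v" using v finite_V by simp
  finally show ?thesis by simp
qed

lemma sink_adim:
  assumes v: "v \<in> V" "\<not> nonsink v" and w: "w \<in> V"
  shows "adim v w = 0"
proof -
  have "Auv v w \<inter> J \<subseteq> {\<zero>}" using v(2) unfolding nonsink_def Auv_def by blast
  moreover have "\<zero> \<in> Auv v w \<inter> J" using v(1) w J_zero by (simp add: Auv_def)
  ultimately have "Auv v w \<inter> J = {\<zero>}" by blast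
  then show ?thesis using vdim_zero[OF regular] by (simp add: adim_def)
qed

text \<open>A nonzero element of \<open>\<epsilon> v\<close> J is the sum of its products with the
  idempotents, so one of these products is nonzero and lies in the corresponding Peirce
  component.\<close>

lemma nonsink_adim:
  assumes v: "v \<in> V" "nonsink v"
  obtains w where "w \<in> V" "adim v w > 0"
proof -
  obtain j where j: "j \<in> J" "\<epsilon> v \<otimes> j = j" "j \<noteq> \<zero>" using v(2) by (auto simp: nonsink_def)
  note jA = J_carrier[OF j(1)]
  interpret R: right_module A "regular_rmod A" by (rule regular)
  have "\<exists>w\<in>V. j \<otimes> \<epsilon> w \<noteq> \<zero>"
  proof (rule ccontr)
    assume "\<not> ?thesis"
    then have "finsum (regular_rmod A) (\<lambda>w. j \<triangleleft>\<^bsub>regular_rmod A\<^esub> \<epsilon> w) V = \<zero>\<^bsub>regular_rmod A\<^esub>"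
      by (intro R.M.finsum_all0) auto
    then show False using vcomp_decompose[OF regular, of j] j(3) jA by simp
  qed
  then obtain w where w: "w \<in> V" "j \<otimes> \<epsilon> w \<noteq> \<zero>" by auto
  have mem: "j \<otimes> \<epsilon> w \<in> Auv v w \<inter> J"
    using j(2) jA w(1) v(1) J_ideal(1)[OF j(1)] by (simp add: Auv_def m_assoc \<epsilon>_mult m_assoc[symmetric, of "\<epsilon> v"])
  have k: "ksub (regular_rmod A) (Auv v w \<inter> J)"
    by (intro ksub_Int regular ksub_Auv v w rsubmodule_ksub rsubmodule_J)
  have "adim v w \<noteq> 0"
  proof
    assume "adim v w = 0"
    then have "{\<zero>\<^bsub>regular_rmod A\<^esub>} = Auv v w \<inter> J"
      using vdim_zero[OF regular] ksubD(2)[OF k]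
      by (intro vdim_eq_imp_eq[OF regular fd_regular ksub_zero[OF regular] k]) (auto simp: adim_def)
    then show False using mem w(2) by auto
  qed
  then show thesis using that w(1) by simp
qed

text \<open>The row of a sink in \<open>adim\<close> is zero, so the kernel of a projective cover of
  this simple module has dimension zero. The module is therefore isomorphic to its cover.\<close>

lemma K0_class_sink:
  assumes v: "v \<in> V" "\<not> nonsink v"
  shows "K0_class A (simple_rmod v) = \<one>\<^bsub>K0 A\<^esub>"
proof -
  let ?S = "simple_rmod v"
  note S = simple_rmod_fgmod[OF v(1)]
  obtain P p where cov: "projective_cover A ?S P p" by (rule projective_cover_exists[OF S])
  then have P: "P \<in> fgmod A" "projective A P" and p: "p \<in> rmod_hom A P ?S" "p ` carrier P = carrier ?S"
    and sup: "superfluous A P (a_kernel P ?S p)" by (auto simp: projective_cover_def)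
  have PS: "right_module A P" "right_module A ?S" using P S by (auto simp: fgmod_iff)
  interpret P: right_module A P by (rule PS)
  interpret S: right_module A ?S by (rule PS)
  let ?K = "P\<lparr>carrier := a_kernel P ?S p\<rparr>"
  have sub: "rsubmodule A P (a_kernel P ?S p)" using sup by (simp add: superfluous_def)
  have K: "?K \<in> fgmod A" by (rule fgmod_restrict[OF P(1) sub])
  then have K': "right_module A ?K" "fd ?K" by (auto simp: fgmod_iff)
  have "is_syzygy A ?S ?K" using cov rmod_iso_refl unfolding is_syzygy_def by blast
  from syzygy_dims(2)[OF S K this] have "int (dimV ?K w) = 0" if "w \<in> V" for w
    using simple_mults(1)[OF v(1) that] sink_adim[OF v that] that by simp
  then have "dimV ?K w = 0" if "w \<in> V" for w using that by simp
  then have comp: "vcomp ?K w = {\<zero>\<^bsub>P\<^esub>}" if "w \<in> V" for w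
    using vdim_eq_imp_eq[OF K' ksub_zero[OF K'(1)] ksub_vcomp[OF K'(1) that]] vdim_zero[OF K'(1)]
      ksubD(2)[OF ksub_vcomp[OF K'(1) that]] that by (simp add: dimV_def)
  have "x = \<zero>\<^bsub>P\<^esub>" if x: "x \<in> carrier P" "p x = \<zero>\<^bsub>?S\<^esub>" for x
  proof -
    have xK: "x \<in> carrier ?K" using x by (simp add: a_kernel_def')
    have "x \<in> {\<zero>\<^bsub>?K\<^esub>}"
      by (rule rsubmodule_memI[OF K'(1) rsubmodule_zero[OF K'(1)] xK]) (use ract_vcomp[OF K'(1) _ xK] comp in auto)
    then show ?thesis by simp
  qed
  then have "inj_on p (carrier P)"
    by (rule rmod_hom_inj_onI[OF P.abelian_group_axioms S.abelian_group_axioms p(1)])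
  then have "rmod_iso A P ?S" using p by (auto simp: rmod_iso_def bij_betw_def)
  then show ?thesis using K0_class_iso[OF P(1)] K0_class_projective[OF P] by metis
qed

text \<open>Sinks contribute trivial classes and the other simple classes are independent, so
  equations in the subgroup of simple classes become equations between coefficients at
  nonsinks.\<close>

lemma simple_prod_one_iff: "simple_prod x = \<one>\<^bsub>K0 A\<^esub> \<longleftrightarrow> (\<forall>v\<in>V. nonsink v \<longrightarrow> x v = 0)"
proof
  interpret G: comm_group "K0 A" by (rule comm_group_K0)
  assume *: "\<forall>v\<in>V. nonsink v \<longrightarrow> x v = 0"
  have "K0_class A (simple_rmod v) [^]\<^bsub>K0 A\<^esub> x v = \<one>\<^bsub>K0 A\<^esub>" if "v \<in> V" for v
    using * that K0_class_sink[OF that] by (cases "nonsink v") auto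
  then have "simple_prod x = finprod (K0 A) (\<lambda>_. \<one>\<^bsub>K0 A\<^esub>) V"
    unfolding simple_prod_def by (intro G.finprod_cong') auto
  then show "simple_prod x = \<one>\<^bsub>K0 A\<^esub>" by simp
qed (use simple_prod_coord in auto)

end

section \<open>Kernels of powers of a nonnegative matrix\<close>

context vector_space
begin

text \<open>The iterates z, f z, ..., f^(n-1) z are independent. As \<open>t\<close> has at most
  \<open>n\<close> elements, they already span \<open>span t\<close>, and \<open>f ^^ n\<close>
  kills each of them.\<close>

lemma nilpotent_chain:
  assumes add: "\<And>x y. f (x + y) = f x + f y" and scale: "\<And>c x. f (scale c x) = scale c (f x)"
    and t: "finite t" "card t \<le> n" and inv: "\<And>x. x \<in> span t \<Longrightarrow> f x \<in> span t"
    and z: "z \<in> span t" "(f ^^ n) z = 0" "(f ^^ (n - 1)) z \<noteq> 0"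
  shows "n \<le> card t" "\<And>x. x \<in> span t \<Longrightarrow> (f ^^ n) x = 0"
proof -
  have add': "(f ^^ k) (x + y) = (f ^^ k) x + (f ^^ k) y" for k x y by (induct k) (auto simp: add)
  have scale': "(f ^^ k) (scale c x) = scale c ((f ^^ k) x)" for k c x by (induct k) (auto simp: scale)
  have f0: "f 0 = 0" using scale[of 0 0] by simp
  have zero: "(f ^^ k) 0 = 0" for k by (induct k) (auto simp: f0)
  have ker: "subspace {x. (f ^^ k) x = 0}" for k
    by (rule subspaceI) (auto simp: add' scale' zero)
  have zt: "(f ^^ i) z \<in> span t" for i by (induct i) (auto simp: z inv)
  \<comment> \<open>The last \<open>k\<close> iterates before the chain reaches zero; the chain is
    built from its end.\<close>
  define S where "S k = (\<lambda>i. (f ^^ i) z) ` {n - k..<n}" for k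
  have S: "k \<le> n \<Longrightarrow> independent (S k) \<and> card (S k) = k \<and> (\<forall>s\<in>span (S k). (f ^^ k) s = 0)" for k
  proof (induct k)
    case 0
    then show ?case by (simp add: S_def independent_empty)
  next
    case (Suc k)
    define a where "a = (f ^^ (n - Suc k)) z"
    have IH: "independent (S k)" "card (S k) = k" "\<And>s. s \<in> span (S k) \<Longrightarrow> (f ^^ k) s = 0" using Suc by auto
    have "(f ^^ k) a = (f ^^ (k + (n - Suc k))) z" by (simp add: a_def funpow_add)
    also have "k + (n - Suc k) = n - 1" using Suc.prems by simp
    \<comment> \<open>\<open>f ^^ k\<close> kills the span of the last \<open>k\<close> iterates but
      sends the next one to the last nonzero iterate, so the next one is independent of
      them.\<close>
    finally have fa: "(f ^^ k) a \<noteq> 0" using z(3) by simp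
    then have a: "a \<notin> span (S k)" using IH(3) by blast
    then have aS: "a \<notin> S k" using span_base by blast
    have "{n - Suc k..<n} = insert (n - Suc k) {n - k..<n}" using Suc.prems by auto
    then have ins: "S (Suc k) = insert a (S k)" by (simp add: S_def a_def)
    have "(f ^^ Suc k) a = (f ^^ (Suc k + (n - Suc k))) z" unfolding a_def funpow_add by simp
    then have "(f ^^ Suc k) a = 0" using z(2) Suc.prems by simp
    moreover have "(f ^^ Suc k) s = 0" if "s \<in> S k" for s using IH(3)[OF span_base[OF that]] f0 by simp
    ultimately have "span (S (Suc k)) \<subseteq> {x. (f ^^ Suc k) x = 0}"
      unfolding ins by (intro span_minimal ker) auto
    moreover have "finite (S k)" by (simp add: S_def)
    ultimately show ?case using a aS IH(1,2) by (auto simp: ins independent_insert)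
  qed
  have Sn: "independent (S n)" "card (S n) = n" "\<And>s. s \<in> span (S n) \<Longrightarrow> (f ^^ n) s = 0"
    and St: "S n \<subseteq> span t"
    using S[of n] zt by (auto simp: S_def)
  have fin: "finite (S n)" by (simp add: S_def)
  show "n \<le> card t" using independent_span_bound[OF t(1) Sn(1) St] Sn(2) by simp
  \<comment> \<open>A vector of \<open>t\<close> outside would give n + 1 independent vectors in the
    span of at most \<open>n\<close>.\<close>
  have "t \<subseteq> span (S n)"
  proof
    fix a assume a: "a \<in> t"
    show "a \<in> span (S n)"
    proof (rule ccontr)
      assume n: "a \<notin> span (S n)"
      then have "a \<notin> S n" using span_base by blast
      moreover have "independent (insert a (S n))" using n Sn(1) by (simp add: independent_insert)
      then have "card (insert a (S n)) \<le> card t"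
        using independent_span_bound[OF t(1)] St span_base[OF a] by blast
      ultimately show False using fin Sn(2) t(2) by simp
    qed
  qed
  then have "span t \<subseteq> span (S n)" by (rule span_minimal[OF _ subspace_span])
  then show "(f ^^ n) x = 0" if "x \<in> span t" for x using that Sn(3) by blast
qed

end

text \<open>Finitely supported rational functions form a vector space on a type, in which integer
  coefficient vectors indexed by a set of vertices can be placed.\<close>

definition pm_scale :: "rat \<Rightarrow> ('v \<Rightarrow>\<^sub>0 rat) \<Rightarrow> ('v \<Rightarrow>\<^sub>0 rat)" where
  "pm_scale c x = Poly_Mapping.map ((*) c) x"

lemma lookup_pm_scale [simp]: "Poly_Mapping.lookup (pm_scale c x) v = c * Poly_Mapping.lookup x v"
  by (simp add: pm_scale_def Poly_Mapping.map.rep_eq when_def)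

interpretation pm: vector_space pm_scale
  by unfold_locales (auto intro!: poly_mapping_eqI simp: lookup_add algebra_simps)

lemma lookup_sum_single:
  assumes "finite N"
  shows "Poly_Mapping.lookup (\<Sum>v\<in>N. Poly_Mapping.single v (g v)) w = (if w \<in> N then g w else 0)"
  using assms by (auto simp: lookup_sum lookup_single when_def)

text \<open>Rows outside \<open>N\<close> vanish, so the entries on \<open>N\<close> evolve by the
  \<open>N\<close> by \<open>N\<close> block. If the iterates became zero on \<open>N\<close> only
  at exponent n + s, the vector at time \<open>s\<close> would start a chain of length
  \<open>n\<close>. That forces \<open>N = V\<close> and a nilpotent matrix, which the nonzero rows
  exclude.\<close>

lemma nonneg_matrix_kernel_stable:
  fixes T :: "'v \<Rightarrow> 'v \<Rightarrow> nat" and x :: "'v \<Rightarrow> int"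
  assumes V: "finite V" "card V = n" "V \<noteq> {}" and N: "N \<subseteq> V"
    and sink: "\<And>v w. v \<in> V - N \<Longrightarrow> w \<in> V \<Longrightarrow> T v w = 0"
    and nonsink: "\<And>v. v \<in> N \<Longrightarrow> \<exists>w\<in>V. T v w > 0"
  defines "step \<equiv> \<lambda>y w. \<Sum>v\<in>V. y v * int (T v w)"
  assumes zero: "\<And>v. v \<in> N \<Longrightarrow> (step ^^ (n + s)) x v = 0"
    and v: "v \<in> N"
  shows "(step ^^ (n + s - 1)) x v = 0"
proof -
  have "card V > 0" using V(1,3) by (simp add: card_gt_0_iff)
  then have n: "n \<ge> 1" using V(2) by simp
  have finN: "finite N" using V N finite_subset by auto
  \<comment> \<open>The iterate at time \<open>k\<close>, restricted to \<open>N\<close> and made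
    rational.\<close>
  define y :: "nat \<Rightarrow> 'v \<Rightarrow>\<^sub>0 rat" where
    "y k = (\<Sum>v\<in>N. Poly_Mapping.single v (of_int ((step ^^ k) x v)))" for k
  \<comment> \<open>One step of the block on \<open>N\<close>.\<close>
  define f :: "('v \<Rightarrow>\<^sub>0 rat) \<Rightarrow> ('v \<Rightarrow>\<^sub>0 rat)" where
    "f z = (\<Sum>w\<in>N. Poly_Mapping.single w (\<Sum>v\<in>N. Poly_Mapping.lookup z v * of_nat (T v w)))" for z
  define t :: "('v \<Rightarrow>\<^sub>0 rat) set" where "t = (\<lambda>v. Poly_Mapping.single v 1) ` N"
  have ly: "Poly_Mapping.lookup (y k) w = (if w \<in> N then of_int ((step ^^ k) x w) else 0)" for k w
    unfolding y_def by (rule lookup_sum_single[OF finN])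
  have lf: "Poly_Mapping.lookup (f z) w = (if w \<in> N then \<Sum>v\<in>N. Poly_Mapping.lookup z v * of_nat (T v w) else 0)" for z w
    unfolding f_def by (rule lookup_sum_single[OF finN])
  have fy: "f (y k) = y (Suc k)" for k
  proof (rule poly_mapping_eqI)
    fix w
    show "Poly_Mapping.lookup (f (y k)) w = Poly_Mapping.lookup (y (Suc k)) w"
    proof (cases "w \<in> N")
      case True
      have "(step ^^ Suc k) x w = (\<Sum>v\<in>V. (step ^^ k) x v * int (T v w))" by (simp add: step_def)
      also have "\<dots> = (\<Sum>v\<in>N. (step ^^ k) x v * int (T v w))"
        using sink True N V(1) by (intro sum.mono_neutral_right) auto
      finally show ?thesis using True by (simp add: lf ly)
    qed (simp add: lf ly)
  qed
  have fyk: "(f ^^ m) (y k) = y (k + m)" for k m by (induct m) (auto simp: fy)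
  have ones: "(\<Sum>v\<in>N. Poly_Mapping.single v (g v)) \<in> pm.span t" for g
  proof (rule pm.span_sum)
    fix v assume "v \<in> N"
    then have "Poly_Mapping.single v 1 \<in> pm.span t" by (intro pm.span_base) (auto simp: t_def)
    then have "pm_scale (g v) (Poly_Mapping.single v 1) \<in> pm.span t" by (rule pm.span_scale)
    moreover have "pm_scale (g v) (Poly_Mapping.single v 1) = Poly_Mapping.single v (g v)"
      by (rule poly_mapping_eqI) (simp add: lookup_single when_def)
    ultimately show "Poly_Mapping.single v (g v) \<in> pm.span t" by simp
  qed
  have add: "f (a + b) = f a + f b" for a b
    by (rule poly_mapping_eqI) (simp add: lf lookup_add distrib_right sum.distrib)
  have scale: "f (pm_scale c a) = pm_scale c (f a)" for c a
    by (rule poly_mapping_eqI) (simp add: lf sum_distrib_left mult.assoc)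
  have cardt: "card t = card N" unfolding t_def
    by (rule card_image) (auto simp: inj_on_def dest: arg_cong[of _ _ Poly_Mapping.keys])
  have tn: "card t \<le> n" using cardt card_mono[OF V(1) N] V(2) by simp
  have "y (n + s) = 0" using zero by (intro poly_mapping_eqI) (simp add: ly)
  then have z2: "(f ^^ n) (y s) = 0" by (simp add: fyk add.commute)
  have "y (n + s - 1) = 0"
  proof (rule ccontr)
    assume "y (n + s - 1) \<noteq> 0"
    then have z3: "(f ^^ (n - 1)) (y s) \<noteq> 0" using n by (simp add: fyk add.commute)
    have fint: "\<And>a. a \<in> pm.span t \<Longrightarrow> f a \<in> pm.span t" unfolding f_def by (rule ones)
    have yt: "y s \<in> pm.span t" unfolding y_def by (rule ones)
    have fin: "finite t" using finN by (simp add: t_def)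
    \<comment> \<open>The chain starts at \<open>y s\<close>: its iterate at n - 1 is nonzero and
      the one at \<open>n\<close> is zero.\<close>
    have chain: "n \<le> card t" "\<And>a. a \<in> pm.span t \<Longrightarrow> (f ^^ n) a = 0"
      using pm.nilpotent_chain[of f t n "y s", OF add scale fin tn fint yt z2 z3] by auto
    have NV: "N = V" using chain(1) cardt V N by (metis card_seteq)
    \<comment> \<open>The all-ones vector is the witness against nilpotency: a positive entry at
      \<open>v\<close> gives a positive entry at every \<open>w\<close> with
      \<open>T v w > 0\<close>, and nothing cancels since all entries are nonnegative.\<close>
    define p :: "'v \<Rightarrow>\<^sub>0 rat" where "p = (\<Sum>v\<in>N. Poly_Mapping.single v 1)"
    have "(\<forall>v. Poly_Mapping.lookup ((f ^^ k) p) v \<ge> 0) \<and> (\<exists>v\<in>V. Poly_Mapping.lookup ((f ^^ k) p) v > 0)" for k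
    proof (induct k)
      case 0
      have "Poly_Mapping.lookup p w = (if w \<in> N then 1 else 0)" for w
        unfolding p_def by (rule lookup_sum_single[OF finN])
      then show ?case using V(3) NV by auto
    next
      case (Suc k)
      let ?q = "(f ^^ k) p"
      have nn: "\<And>v. Poly_Mapping.lookup ?q v \<ge> 0" using Suc by blast
      obtain v where v: "v \<in> V" "Poly_Mapping.lookup ?q v > 0" using Suc by blast
      obtain w where w: "w \<in> V" "T v w > 0" using nonsink v NV by auto
      have "0 < (\<Sum>v\<in>V. Poly_Mapping.lookup ?q v * of_nat (T v w))"
        by (rule sum_pos2[OF V(1) v(1)]) (use v w nn in auto)
      then show ?case using w(1) nn by (auto simp: lf NV intro!: sum_nonneg bexI[of _ w])
    qed
    moreover have "(f ^^ n) p = 0" unfolding p_def by (rule chain(2)[OF ones])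
    ultimately show False by (metis lookup_zero less_irrefl)
  qed
  then have "Poly_Mapping.lookup (y (n + s - 1)) v = 0" by simp
  then show ?thesis using v by (simp add: ly)
qed

section \<open>The bound for split algebras with radical square zero\<close>

context split_rad_square_zero
begin

theorem phi_dim_le_card:
  assumes V: "V \<noteq> {}"
  shows "phi_dim A \<le> enat (card V)"
  unfolding phi_dim_def
proof (rule SUP_least)
  fix M :: "'a std_rmod" assume M: "M \<in> fgmod A"
  let ?n = "card V"
  let ?\<Omega> = "Omega_bar A"
  interpret G: comm_group "K0 A" by (rule comm_group_K0)
  interpret O: group_hom "K0 A" "K0 A" ?\<Omega> using Omega_bar(1) by unfold_locales
  define step :: "('v \<Rightarrow> int) \<Rightarrow> 'v \<Rightarrow> int" where
    "step = (\<lambda>y w. \<Sum>v\<in>V. y v * int (adim v w))"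
  have pow_closed: "(?\<Omega> ^^ k) a \<in> carrier (K0 A)" if "a \<in> carrier (K0 A)" for k a
    using that by (induct k) auto
  have pow_diff: "(?\<Omega> ^^ k) (a \<otimes>\<^bsub>K0 A\<^esub> inv\<^bsub>K0 A\<^esub> b) = (?\<Omega> ^^ k) a \<otimes>\<^bsub>K0 A\<^esub> inv\<^bsub>K0 A\<^esub> (?\<Omega> ^^ k) b"
    if "a \<in> carrier (K0 A)" "b \<in> carrier (K0 A)" for k a b
    using pow_closed that by (induct k) auto
  have pow_simple: "(?\<Omega> ^^ k) (simple_prod x) = simple_prod ((step ^^ k) x)" for k x
    by (induct k) (auto simp: Omega_bar_simple_prod step_def)
  have sub: "add_subgroup A M \<subseteq> carrier (K0 A)"
    unfolding add_subgroup_def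
    by (rule G.generate_incl) (auto simp: direct_summand_def K0_class_closed)
  have inj: "inj_on ?\<Omega> ((?\<Omega> ^^ (?n + s)) ` add_subgroup A M)" for s
  proof (rule inj_onI)
    fix x y assume "x \<in> (?\<Omega> ^^ (?n + s)) ` add_subgroup A M" "y \<in> (?\<Omega> ^^ (?n + s)) ` add_subgroup A M"
      and eq: "?\<Omega> x = ?\<Omega> y"
    then obtain a b where ab: "x = (?\<Omega> ^^ (?n + s)) a" "y = (?\<Omega> ^^ (?n + s)) b"
      "a \<in> carrier (K0 A)" "b \<in> carrier (K0 A)" using sub by auto
    \<comment> \<open>Injectivity on the image is tested on a difference, which is the image of the
      single element \<open>c\<close>.\<close>
    define c where "c = a \<otimes>\<^bsub>K0 A\<^esub> inv\<^bsub>K0 A\<^esub> b"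
    have c: "c \<in> carrier (K0 A)" using ab by (simp add: c_def)
    have xy: "x \<in> carrier (K0 A)" "y \<in> carrier (K0 A)" using ab pow_closed by auto
    have cxy: "(?\<Omega> ^^ (?n + s)) c = x \<otimes>\<^bsub>K0 A\<^esub> inv\<^bsub>K0 A\<^esub> y"
      unfolding c_def ab(1,2) by (rule pow_diff[OF ab(3,4)])
    \<comment> \<open>One application reaches the simple classes, so exponents of
      \<open>step\<close> lag by one behind those of the operator. Stability at n - 1 for
      \<open>step\<close> becomes stability at n for the operator.\<close>
    obtain z where z: "?\<Omega> c = simple_prod z" using Omega_bar_range[OF c] by blast
    have swap: "(?\<Omega> ^^ Suc k) c = simple_prod ((step ^^ k) z)" for k
      unfolding funpow_Suc_right o_def z by (rule pow_simple)
    have "simple_prod ((step ^^ (?n + s)) z) = ?\<Omega> (x \<otimes>\<^bsub>K0 A\<^esub> inv\<^bsub>K0 A\<^esub> y)"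
      unfolding swap[symmetric] cxy[symmetric] by simp
    also have "\<dots> = \<one>\<^bsub>K0 A\<^esub>" using xy eq by simp
    finally have "\<forall>v\<in>V. nonsink v \<longrightarrow> (step ^^ (?n + s)) z v = 0" by (simp only: simple_prod_one_iff)
    then have "(step ^^ (?n + s - 1)) z v = 0" if "v \<in> V" "nonsink v" for v
      unfolding step_def using that
      by (intro nonneg_matrix_kernel_stable[OF finite_V refl V, of "{v \<in> V. nonsink v}"])
        (auto simp: sink_adim elim: nonsink_adim)
    then have one: "simple_prod ((step ^^ (?n + s - 1)) z) = \<one>\<^bsub>K0 A\<^esub>" by (simp add: simple_prod_one_iff)
    \<comment> \<open>Nonemptiness of \<open>V\<close> makes the truncated subtraction
      exact.\<close>
    have Suc_eq: "Suc (?n + s - 1) = ?n + s" using V finite_V by (simp add: card_gt_0_iff)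
    have "(?\<Omega> ^^ Suc (?n + s - 1)) c = \<one>\<^bsub>K0 A\<^esub>" unfolding swap by (rule one)
    then have "(?\<Omega> ^^ (?n + s)) c = \<one>\<^bsub>K0 A\<^esub>" unfolding Suc_eq .
    then have "x \<otimes>\<^bsub>K0 A\<^esub> inv\<^bsub>K0 A\<^esub> y = \<one>\<^bsub>K0 A\<^esub>" using cxy by simp
    then show "x = y" using xy G.inv_equality by (metis G.inv_closed G.inv_inv)
  qed
  then show "igusa_todorov_phi A M \<le> enat ?n"
    unfolding igusa_todorov_phi_def by (intro Inf_lower) blast
qed

end

section \<open>The quotient of the path algebra\<close>

lemma poly_mapping_expansion:
  "f = (\<Sum>x\<in>Poly_Mapping.keys f. Poly_Mapping.single x (Poly_Mapping.lookup f x))"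
  by (rule poly_mapping_eqI)
    (auto simp: lookup_sum lookup_single when_def in_keys_iff)

text \<open>The product of two paths with coefficient \<open>c\<close>. Being additive in
  \<open>c\<close>, it allows coefficients to be summed over common supports.\<close>

definition path_term :: "('v, 'e) path \<Rightarrow> ('v, 'e) path \<Rightarrow> 'k::field \<Rightarrow> (('v, 'e) path \<Rightarrow>\<^sub>0 'k)" where
  "path_term x y c = (case x of (u, p, v) \<Rightarrow> case y of (v', q, w) \<Rightarrow>
     if v = v' then Poly_Mapping.single (u, p @ q, w) c else 0)"

lemma path_term_zero [simp]: "path_term x y 0 = 0"
  by (auto simp: path_term_def split: prod.split)

lemma path_term_add: "path_term x y (c + d) = path_term x y c + path_term x y d"
  by (auto simp: path_term_def single_add split: prod.split)

text \<open>Summation over any finite supersets of the supports lets products of elements with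
  different supports be compared, as bilinearity requires.\<close>

lemma path_mult_superset:
  assumes "finite F" "Poly_Mapping.keys f \<subseteq> F" "finite G" "Poly_Mapping.keys g \<subseteq> G"
  shows "path_mult f g = (\<Sum>x\<in>F. \<Sum>y\<in>G. path_term x y (Poly_Mapping.lookup f x * Poly_Mapping.lookup g y))"
proof -
  have "path_mult f g = (\<Sum>x\<in>Poly_Mapping.keys f. \<Sum>y\<in>Poly_Mapping.keys g.
      path_term x y (Poly_Mapping.lookup f x * Poly_Mapping.lookup g y))"
    unfolding path_mult_def by (intro sum.cong) (auto simp: path_term_def split: prod.split intro!: sum.cong)
  also have "\<dots> = (\<Sum>x\<in>Poly_Mapping.keys f. \<Sum>y\<in>G. path_term x y (Poly_Mapping.lookup f x * Poly_Mapping.lookup g y))"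
    using assms by (intro sum.cong refl sum.mono_neutral_left) (auto simp: in_keys_iff)
  also have "\<dots> = (\<Sum>x\<in>F. \<Sum>y\<in>G. path_term x y (Poly_Mapping.lookup f x * Poly_Mapping.lookup g y))"
    using assms by (intro sum.mono_neutral_left) (auto simp: in_keys_iff)
  finally show ?thesis .
qed

lemma path_mult_add_left: "path_mult (f + f') g = path_mult f g + path_mult f' g"
proof -
  let ?F = "Poly_Mapping.keys f \<union> Poly_Mapping.keys f'" and ?G = "Poly_Mapping.keys g"
  have "Poly_Mapping.keys (f + f') \<subseteq> ?F" by (rule keys_add)
  then show ?thesis
    by (simp add: path_mult_superset[of ?F _ ?G] lookup_add distrib_right path_term_add sum.distrib)
qed

lemma path_mult_add_right: "path_mult f (g + g') = path_mult f g + path_mult f g'"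
proof -
  let ?F = "Poly_Mapping.keys f" and ?G = "Poly_Mapping.keys g \<union> Poly_Mapping.keys g'"
  have "Poly_Mapping.keys (g + g') \<subseteq> ?G" by (rule keys_add)
  then show ?thesis
    by (simp add: path_mult_superset[of ?F _ ?G] lookup_add distrib_left path_term_add sum.distrib)
qed

lemma path_mult_zero [simp]: "path_mult 0 g = 0" "path_mult f 0 = 0"
  by (simp_all add: path_mult_def)

lemma path_mult_sum_left: "path_mult (sum f I) g = (\<Sum>i\<in>I. path_mult (f i) g)"
  by (induct I rule: infinite_finite_induct) (auto simp: path_mult_add_left)

lemma path_mult_sum_right: "path_mult f (sum g I) = (\<Sum>i\<in>I. path_mult f (g i))"
  by (induct I rule: infinite_finite_induct) (auto simp: path_mult_add_right)

lemma path_mult_single: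
  "path_mult (Poly_Mapping.single x c) (Poly_Mapping.single y d) = path_term x y (c * d)"
  by (subst path_mult_superset[of "{x}" _ "{y}"]) auto

lemma poly_mapping_additive_induct:
  fixes f :: "'x \<Rightarrow>\<^sub>0 'k::comm_monoid_add"
  assumes "Poly_Mapping.keys f \<subseteq> X" and "Q 0"
    and "\<And>x c. x \<in> X \<Longrightarrow> Q (Poly_Mapping.single x c)"
    and "\<And>f g. Q f \<Longrightarrow> Q g \<Longrightarrow> Q (f + g)"
  shows "Q f"
proof -
  have "Q (\<Sum>x\<in>I. Poly_Mapping.single x (Poly_Mapping.lookup f x))" if "finite I" "I \<subseteq> X" for I
    using that by (induct I rule: finite_induct) (auto simp: assms)
  from this[OF finite_keys assms(1)] show ?thesis using poly_mapping_expansion[of f] by simp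
qed

text \<open>Both sides are additive in each argument, which reduces the claim to three paths, where
  it is associativity of concatenation.\<close>

lemma path_mult_assoc: "path_mult (path_mult f g) h = path_mult f (path_mult g h)"
proof (rule poly_mapping_additive_induct[of f UNIV])
  fix x c
  show "path_mult (path_mult (Poly_Mapping.single x c) g) h = path_mult (Poly_Mapping.single x c) (path_mult g h)"
  proof (rule poly_mapping_additive_induct[of g UNIV])
    fix y d
    show "path_mult (path_mult (Poly_Mapping.single x c) (Poly_Mapping.single y d)) h =
        path_mult (Poly_Mapping.single x c) (path_mult (Poly_Mapping.single y d) h)"
    proof (rule poly_mapping_additive_induct[of h UNIV])
      fix z e
      show "path_mult (path_mult (Poly_Mapping.single x c) (Poly_Mapping.single y d)) (Poly_Mapping.single z e) =
        path_mult (Poly_Mapping.single x c) (path_mult (Poly_Mapping.single y d) (Poly_Mapping.single z e))"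
        by (cases x; cases y; cases z) (auto simp: path_mult_single path_term_def mult.assoc)
    qed (auto simp: path_mult_add_left path_mult_add_right)
  qed (auto simp: path_mult_add_left path_mult_add_right)
qed (auto simp: path_mult_add_left path_mult_add_right)

lemma path_algebra_simps:
  "carrier (path_algebra Q) = {f. Poly_Mapping.keys f \<subseteq> quiver_paths Q}"
  "f \<otimes>\<^bsub>path_algebra Q\<^esub> g = path_mult f g"
  "\<one>\<^bsub>path_algebra Q\<^esub> = (\<Sum>v\<in>verts Q. Poly_Mapping.single (v, [], v) 1)"
  "\<zero>\<^bsub>path_algebra Q\<^esub> = 0" "f \<oplus>\<^bsub>path_algebra Q\<^esub> g = f + g"
  by (simp_all add: path_algebra_def)

text \<open>The span of the paths of length at least \<open>k\<close>; for \<open>k\<close> equal to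
  0, 1 and 2 it is the path algebra, the arrow ideal and the square of that ideal.\<close>

definition long_paths :: "('v, 'e) pre_digraph \<Rightarrow> nat \<Rightarrow> (('v, 'e) path \<Rightarrow>\<^sub>0 'k::field) set" where
  "long_paths Q k = {f. Poly_Mapping.keys f \<subseteq> {(u, p, v) \<in> quiver_paths Q. k \<le> length p}}"

context fin_digraph
begin

lemma quiver_paths_append:
  "(u, p, v) \<in> quiver_paths G \<Longrightarrow> (v, q, w) \<in> quiver_paths G \<Longrightarrow> (u, p @ q, w) \<in> quiver_paths G"
  unfolding quiver_paths_def using awalk_appendI by blast

lemma trivial_path: "(u, [], v) \<in> quiver_paths G \<longleftrightarrow> u = v \<and> u \<in> verts G"
  by (auto simp: quiver_paths_def awalk_Nil_iff)

lemma path_source: "(u, p, v) \<in> quiver_paths G \<Longrightarrow> u \<in> verts G"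
  by (auto simp: quiver_paths_def awalk_def)

lemma path_target: "(u, p, v) \<in> quiver_paths G \<Longrightarrow> v \<in> verts G"
  by (auto simp: quiver_paths_def dest: awalk_last_in_verts)

lemma long_paths_0: "long_paths G 0 = carrier (path_algebra G)"
  by (auto simp: long_paths_def path_algebra_simps)

lemma long_paths_subset: "long_paths G k \<subseteq> carrier (path_algebra G)"
  by (auto simp: long_paths_def path_algebra_simps)

lemma long_paths_mult:
  assumes "f \<in> long_paths G k" "g \<in> long_paths G l"
  shows "path_mult f g \<in> long_paths G (k + l)"
proof -
  have "Poly_Mapping.keys (path_term x y c) \<subseteq> {(u, p, v) \<in> quiver_paths G. k + l \<le> length p}"
    if xy: "x \<in> Poly_Mapping.keys f" "y \<in> Poly_Mapping.keys g" for x y c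
  proof -
    obtain u p v where x: "x = (u, p, v)" by (cases x)
    obtain v' q w where y: "y = (v', q, w)" by (cases y)
    have "(u, p, v) \<in> quiver_paths G" "k \<le> length p" "(v', q, w) \<in> quiver_paths G" "l \<le> length q"
      using xy assms by (auto simp: long_paths_def x y)
    then show ?thesis using quiver_paths_append[of u p v q w] by (auto simp: path_term_def x y)
  qed
  then show ?thesis
    unfolding long_paths_def mem_Collect_eq path_mult_superset[OF finite_keys subset_refl finite_keys subset_refl]
    by (intro subset_trans[OF keys_sum] UN_least)
qed

lemma long_paths_add: "f \<in> long_paths G k \<Longrightarrow> g \<in> long_paths G k \<Longrightarrow> f + g \<in> long_paths G k"
  unfolding long_paths_def mem_Collect_eq by (intro subset_trans[OF keys_add] Un_least)

lemma long_paths_zero: "0 \<in> long_paths G k"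
  by (simp add: long_paths_def)

lemma long_paths_uminus: "f \<in> long_paths G k \<Longrightarrow> - f \<in> long_paths G k"
  by (simp add: long_paths_def keys_minus)

lemma path_algebra_abelian_group: "abelian_group (path_algebra G :: (('a, 'b) path \<Rightarrow>\<^sub>0 'k::field) ring)"
proof (rule abelian_groupI)
  let ?R = "path_algebra G :: (('a, 'b) path \<Rightarrow>\<^sub>0 'k) ring"
  show "x \<oplus>\<^bsub>?R\<^esub> y \<in> carrier ?R" if "x \<in> carrier ?R" "y \<in> carrier ?R" for x y
    using that long_paths_add[of x 0 y] by (simp add: long_paths_0 path_algebra_simps(5))
  show "\<exists>y\<in>carrier ?R. y \<oplus>\<^bsub>?R\<^esub> x = \<zero>\<^bsub>?R\<^esub>" if "x \<in> carrier ?R" for x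
    using that long_paths_uminus[of x 0] by (auto simp: long_paths_0 path_algebra_simps(4,5) intro!: bexI[of _ "- x"])
qed (auto simp: path_algebra_simps add_ac)

text \<open>Every path has exactly one source and one target, so only one trivial path acts on it
  from each side. With \<open>c = 1\<close> this is the unit law, and in general it makes the
  scalars central.\<close>

lemma path_mult_trivial:
  assumes "f \<in> carrier (path_algebra G)"
  shows "path_mult (\<Sum>v\<in>verts G. Poly_Mapping.single (v, [], v) c) f = Poly_Mapping.map ((*) c) f"
    "path_mult f (\<Sum>v\<in>verts G. Poly_Mapping.single (v, [], v) c) = Poly_Mapping.map ((*) c) f"
proof -
  have m0: "Poly_Mapping.map ((*) c) 0 = 0" by (rule poly_mapping_eqI) (simp add: Poly_Mapping.map.rep_eq)
  have madd: "Poly_Mapping.map ((*) c) (f + g) = Poly_Mapping.map ((*) c) f + Poly_Mapping.map ((*) c) g"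
    for f g :: "('a, 'b) path \<Rightarrow>\<^sub>0 'c"
    by (rule poly_mapping_eqI) (auto simp: Poly_Mapping.map.rep_eq when_def lookup_add distrib_left add_eq_0_iff)
  have ms: "Poly_Mapping.map ((*) c) (Poly_Mapping.single x d) = Poly_Mapping.single x (c * d)"
    for x :: "('a, 'b) path" and d
    by (rule poly_mapping_eqI) (auto simp: Poly_Mapping.map.rep_eq when_def lookup_single)
  have keys: "Poly_Mapping.keys f \<subseteq> quiver_paths G" using assms by (simp add: path_algebra_simps)
  show "path_mult (\<Sum>v\<in>verts G. Poly_Mapping.single (v, [], v) c) f = Poly_Mapping.map ((*) c) f"
  proof (rule poly_mapping_additive_induct[OF keys])
    fix x d assume x: "x \<in> quiver_paths G"
    obtain u p w where u: "x = (u, p, w)" by (cases x)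
    have "path_mult (\<Sum>v\<in>verts G. Poly_Mapping.single (v, [], v) c) (Poly_Mapping.single x d) =
      (\<Sum>v\<in>verts G. if v = u then Poly_Mapping.single x (c * d) else 0)"
      unfolding path_mult_sum_left path_mult_single by (intro sum.cong) (auto simp: path_term_def u)
    also have "\<dots> = Poly_Mapping.single x (c * d)" using path_source x u finite_verts by auto
    finally show "path_mult (\<Sum>v\<in>verts G. Poly_Mapping.single (v, [], v) c) (Poly_Mapping.single x d) =
      Poly_Mapping.map ((*) c) (Poly_Mapping.single x d)" by (simp add: ms)
  qed (auto simp: m0 madd path_mult_add_right)
  show "path_mult f (\<Sum>v\<in>verts G. Poly_Mapping.single (v, [], v) c) = Poly_Mapping.map ((*) c) f"
  proof (rule poly_mapping_additive_induct[OF keys])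
    fix x d assume x: "x \<in> quiver_paths G"
    obtain u p w where u: "x = (u, p, w)" by (cases x)
    have "path_mult (Poly_Mapping.single x d) (\<Sum>v\<in>verts G. Poly_Mapping.single (v, [], v) c) =
      (\<Sum>v\<in>verts G. if v = w then Poly_Mapping.single x (d * c) else 0)"
      unfolding path_mult_sum_right path_mult_single by (intro sum.cong) (auto simp: path_term_def u)
    also have "\<dots> = Poly_Mapping.single x (d * c)" using path_target x u finite_verts by auto
    finally show "path_mult (Poly_Mapping.single x d) (\<Sum>v\<in>verts G. Poly_Mapping.single (v, [], v) c) =
      Poly_Mapping.map ((*) c) (Poly_Mapping.single x d)" by (simp add: ms mult.commute)
  qed (auto simp: m0 madd path_mult_add_left)
qed

lemma map_times_one: "Poly_Mapping.map ((*) 1) f = (f :: 'x \<Rightarrow>\<^sub>0 'k::field)"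
  by (rule poly_mapping_eqI) (simp add: Poly_Mapping.map.rep_eq when_def)

lemma trivial_sum_carrier: "(\<Sum>v\<in>verts G. Poly_Mapping.single (v, [], v) c) \<in> carrier (path_algebra G)"
  unfolding path_algebra_simps mem_Collect_eq
  by (intro subset_trans[OF keys_sum] UN_least) (auto simp: trivial_path)

lemma ring_path_algebra: "ring (path_algebra G :: (('a, 'b) path \<Rightarrow>\<^sub>0 'k::field) ring)"
proof (rule ringI)
  let ?R = "path_algebra G :: (('a, 'b) path \<Rightarrow>\<^sub>0 'k) ring"
  show "abelian_group ?R" by (rule path_algebra_abelian_group)
  show "monoid ?R"
  proof (rule monoidI)
    show "x \<otimes>\<^bsub>?R\<^esub> y \<in> carrier ?R" if "x \<in> carrier ?R" "y \<in> carrier ?R" for x y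
      using that long_paths_mult[of x 0 y 0] by (simp add: long_paths_0 path_algebra_simps(2))
    show "\<one>\<^bsub>?R\<^esub> \<in> carrier ?R" unfolding path_algebra_simps(3) by (rule trivial_sum_carrier)
    show "\<one>\<^bsub>?R\<^esub> \<otimes>\<^bsub>?R\<^esub> x = x" "x \<otimes>\<^bsub>?R\<^esub> \<one>\<^bsub>?R\<^esub> = x" if "x \<in> carrier ?R" for x
      using path_mult_trivial[OF that, of 1] by (simp_all add: path_algebra_simps(2,3) map_times_one)
  qed (simp add: path_algebra_simps(2) path_mult_assoc)
qed (simp_all add: path_algebra_simps(2,5) path_mult_add_left path_mult_add_right)

lemma ideal_long_paths: "ideal (long_paths G k) (path_algebra G :: (('a, 'b) path \<Rightarrow>\<^sub>0 'k::field) ring)"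
proof -
  let ?R = "path_algebra G :: (('a, 'b) path \<Rightarrow>\<^sub>0 'k) ring"
  interpret ring ?R by (rule ring_path_algebra)
  show ?thesis
  proof (rule idealI[OF ring_path_algebra])
    have inv: "\<ominus>\<^bsub>?R\<^esub> f = - f" if "f \<in> carrier ?R" for f
      using that long_paths_uminus[of f 0]
      by (intro minus_equality) (auto simp: long_paths_0 path_algebra_simps(4,5))
    show "subgroup (long_paths G k) (add_monoid ?R)"
    proof (rule add.subgroupI)
      show "long_paths G k \<subseteq> carrier ?R" by (rule long_paths_subset)
      show "(long_paths G k :: (('a, 'b) path \<Rightarrow>\<^sub>0 'k) set) \<noteq> {}" using long_paths_zero by auto
      show "\<ominus>\<^bsub>?R\<^esub> f \<in> long_paths G k" if "f \<in> long_paths G k" for f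
        using inv[OF subsetD[OF long_paths_subset that]] long_paths_uminus[OF that] by simp
      show "f \<oplus>\<^bsub>?R\<^esub> g \<in> long_paths G k" if "f \<in> long_paths G k" "g \<in> long_paths G k" for f g
        using long_paths_add that by (simp add: path_algebra_simps(5))
    qed
    show "x \<otimes>\<^bsub>?R\<^esub> a \<in> long_paths G k" "a \<otimes>\<^bsub>?R\<^esub> x \<in> long_paths G k"
      if "a \<in> long_paths G k" "x \<in> carrier ?R" for a x
      using long_paths_mult[of x 0 a k] long_paths_mult[of a k x 0] that
      by (simp_all add: long_paths_0 path_algebra_simps(2))
  qed
qed

text \<open>A path of positive length is the product of its first arrow with the remaining path,
  which gives the less obvious inclusion.\<close>

lemma arrow_ideal_eq: "(arrow_ideal G :: (('a, 'b) path \<Rightarrow>\<^sub>0 'k::field) set) = long_paths G 1"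
proof
  let ?R = "path_algebra G :: (('a, 'b) path \<Rightarrow>\<^sub>0 'k) ring"
  interpret ring ?R by (rule ring_path_algebra)
  let ?S = "{Poly_Mapping.single (tail G e, [e], head G e) 1 :: ('a, 'b) path \<Rightarrow>\<^sub>0 'k | e. e \<in> arcs G}"
  have arrow: "(tail G e, [e], head G e) \<in> quiver_paths G" if "e \<in> arcs G" for e
    using arc_implies_awalk[OF that] by (simp add: quiver_paths_def)
  have S: "?S \<subseteq> long_paths G 1" using arrow by (auto simp: long_paths_def)
  then show "arrow_ideal G \<subseteq> (long_paths G 1 :: (('a, 'b) path \<Rightarrow>\<^sub>0 'k) set)"
    unfolding arrow_ideal_def by (intro genideal_minimal ideal_long_paths)
  have SR: "?S \<subseteq> carrier ?R" using S long_paths_subset by blast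
  interpret I: ideal "arrow_ideal G" ?R unfolding arrow_ideal_def by (rule genideal_ideal[OF SR])
  show "long_paths G 1 \<subseteq> (arrow_ideal G :: (('a, 'b) path \<Rightarrow>\<^sub>0 'k) set)"
  proof
    fix f :: "('a, 'b) path \<Rightarrow>\<^sub>0 'k" assume "f \<in> long_paths G 1"
    then have "Poly_Mapping.keys f \<subseteq> {(u, p, v) \<in> quiver_paths G. 1 \<le> length p}" by (simp add: long_paths_def)
    then show "f \<in> arrow_ideal G"
    proof (rule poly_mapping_additive_induct)
      show "(0 :: ('a, 'b) path \<Rightarrow>\<^sub>0 'k) \<in> arrow_ideal G" using I.zero_closed by (simp add: path_algebra_simps)
      show "f + g \<in> arrow_ideal G" if "f \<in> arrow_ideal G" "g \<in> arrow_ideal G" for f g :: "('a, 'b) path \<Rightarrow>\<^sub>0 'k"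
        using I.a_closed[OF that] by (simp add: path_algebra_simps)
      fix x and c :: 'k assume x: "x \<in> {(u, p, v) \<in> quiver_paths G. 1 \<le> length p}"
      then obtain u e p w where xe: "x = (u, e # p, w)" "(u, e # p, w) \<in> quiver_paths G"
        by (auto simp: Suc_le_length_iff)
      then have e: "e \<in> arcs G" "u = tail G e" "(head G e, p, w) \<in> quiver_paths G"
        by (auto simp: quiver_paths_def awalk_Cons_iff)
      have "Poly_Mapping.single (tail G e, [e], head G e) 1 \<in> (arrow_ideal G :: (('a, 'b) path \<Rightarrow>\<^sub>0 'k) set)"
        using genideal_self[OF SR] e(1) unfolding arrow_ideal_def by blast
      moreover have "Poly_Mapping.single (head G e, p, w) c \<in> carrier ?R"
        using e(3) by (simp add: path_algebra_simps)
      ultimately have "path_mult (Poly_Mapping.single (tail G e, [e], head G e) 1) (Poly_Mapping.single (head G e, p, w) c) \<in> arrow_ideal G"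
        using I.I_r_closed by (simp add: path_algebra_simps(2))
      then show "Poly_Mapping.single x c \<in> arrow_ideal G"
        by (simp add: path_mult_single path_term_def xe(1) e(2))
    qed
  qed
qed

text \<open>A path of length at least two is an arrow times a path of positive length; conversely,
  lengths add in products.\<close>

lemma arrow_ideal_square:
  "(arrow_ideal G \<cdot>\<^bsub>path_algebra G\<^esub> arrow_ideal G :: (('a, 'b) path \<Rightarrow>\<^sub>0 'k::field) set) = long_paths G 2"
proof
  let ?R = "path_algebra G :: (('a, 'b) path \<Rightarrow>\<^sub>0 'k) ring"
  interpret ring ?R by (rule ring_path_algebra)
  let ?I = "long_paths G 1 :: (('a, 'b) path \<Rightarrow>\<^sub>0 'k) set"
  interpret I2: ideal "?I \<cdot>\<^bsub>?R\<^esub> ?I" ?R by (intro ideal_prod_is_ideal ideal_long_paths)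
  have "f \<in> long_paths G 2" if "f \<in> ?I \<cdot>\<^bsub>?R\<^esub> ?I" for f
    using that
  proof induct
    case (prod i j)
    then show ?case using long_paths_mult[of i 1 j 1] by (simp add: path_algebra_simps numeral_2_eq_2)
  qed (simp add: path_algebra_simps long_paths_add)
  then show "arrow_ideal G \<cdot>\<^bsub>?R\<^esub> arrow_ideal G \<subseteq> long_paths G 2" unfolding arrow_ideal_eq by blast
  show "long_paths G 2 \<subseteq> arrow_ideal G \<cdot>\<^bsub>?R\<^esub> arrow_ideal G" unfolding arrow_ideal_eq
  proof
    fix f :: "('a, 'b) path \<Rightarrow>\<^sub>0 'k" assume "f \<in> long_paths G 2"
    then have "Poly_Mapping.keys f \<subseteq> {(u, p, v) \<in> quiver_paths G. 2 \<le> length p}" by (simp add: long_paths_def)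
    then show "f \<in> ?I \<cdot>\<^bsub>?R\<^esub> ?I"
    proof (rule poly_mapping_additive_induct)
      show "0 \<in> ?I \<cdot>\<^bsub>?R\<^esub> ?I" using I2.zero_closed by (simp add: path_algebra_simps)
      show "f + g \<in> ?I \<cdot>\<^bsub>?R\<^esub> ?I" if "f \<in> ?I \<cdot>\<^bsub>?R\<^esub> ?I" "g \<in> ?I \<cdot>\<^bsub>?R\<^esub> ?I" for f g
        using I2.a_closed[OF that] by (simp add: path_algebra_simps)
      fix x and c :: 'k assume x: "x \<in> {(u, p, v) \<in> quiver_paths G. 2 \<le> length p}"
      then obtain u e p w where xe: "x = (u, e # p, w)" "(u, e # p, w) \<in> quiver_paths G" "1 \<le> length p"
        by (auto simp: Suc_le_length_iff numeral_2_eq_2)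
      then have e: "e \<in> arcs G" "u = tail G e" "(head G e, p, w) \<in> quiver_paths G"
        by (auto simp: quiver_paths_def awalk_Cons_iff)
      have "(tail G e, [e], head G e) \<in> quiver_paths G"
        using arc_implies_awalk[OF e(1)] by (simp add: quiver_paths_def)
      then have "Poly_Mapping.single (tail G e, [e], head G e) 1 \<in> ?I" "Poly_Mapping.single (head G e, p, w) c \<in> ?I"
        using e(3) xe(3) by (auto simp: long_paths_def)
      from ideal_prod.prod[OF this, of ?R] show "Poly_Mapping.single x c \<in> ?I \<cdot>\<^bsub>?R\<^esub> ?I"
        by (simp add: path_algebra_simps path_mult_single path_term_def xe(1) e(2))
    qed
  qed
qed

text \<open>Elements of the ideal being factored out have no trivial path in their support, so the
  coefficient of a trivial path is the same for all representatives of a coset. This justifies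
  reading the characters off an arbitrary representative.\<close>

lemma radical_square_zero_split:
  fixes A :: "(('a, 'b) path \<Rightarrow>\<^sub>0 'k::field) set ring"
  assumes A: "A = radical_square_zero_algebra G"
  defines "\<pi> \<equiv> \<lambda>f. long_paths G 2 +>\<^bsub>path_algebra G\<^esub> f"
  shows "split_rad_square_zero A (verts G)
    (\<lambda>c. \<pi> (\<Sum>v\<in>verts G. Poly_Mapping.single (v, [], v) c))
    (\<lambda>v. \<pi> (Poly_Mapping.single (v, [], v) 1))
    (\<lambda>v X. Poly_Mapping.lookup (SOME f. f \<in> X) (v, [], v))"
proof -
  define R where "R = (path_algebra G :: (('a, 'b) path \<Rightarrow>\<^sub>0 'k) ring)"
  define I where "I = (long_paths G 2 :: (('a, 'b) path \<Rightarrow>\<^sub>0 'k) set)"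
  define \<kappa> :: "'k \<Rightarrow> ('a, 'b) path \<Rightarrow>\<^sub>0 'k" where "\<kappa> c = (\<Sum>v\<in>verts G. Poly_Mapping.single (v, [], v) c)" for c
  define \<chi> where "\<chi> v X = Poly_Mapping.lookup (SOME f. f \<in> X) (v, [], v)" for v and X :: "(('a, 'b) path \<Rightarrow>\<^sub>0 'k) set"
  have [simp]: "f \<otimes>\<^bsub>R\<^esub> g = path_mult f g" "\<one>\<^bsub>R\<^esub> = (\<Sum>v\<in>verts G. Poly_Mapping.single (v, [], v) 1)"
    "\<zero>\<^bsub>R\<^esub> = 0" "f \<oplus>\<^bsub>R\<^esub> g = f + g" for f g
    by (simp_all add: R_def path_algebra_simps)
  have carR: "carrier R = {f. Poly_Mapping.keys f \<subseteq> quiver_paths G}" by (simp add: R_def path_algebra_simps)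
  have AR: "A = R Quot I" by (simp add: A radical_square_zero_algebra_def arrow_ideal_square R_def I_def)
  have \<pi>I: "\<pi> f = I +>\<^bsub>R\<^esub> f" for f by (simp add: \<pi>_def R_def I_def)
  interpret R: ring R unfolding R_def by (rule ring_path_algebra)
  interpret I: ideal I R unfolding I_def R_def by (rule ideal_long_paths)
  interpret A: ring A unfolding AR by (rule I.quotient_is_ring)
  have \<pi>: "\<pi> \<in> ring_hom R A" unfolding AR \<pi>I[abs_def] by (rule I.rcos_ring_hom)
  note \<pi>c = ring_hom_closed[OF \<pi>] and \<pi>a = ring_hom_add[OF \<pi>, simplified]
    and \<pi>m = ring_hom_mult[OF \<pi>, simplified] and \<pi>1 = ring_hom_one[OF \<pi>]
  have \<pi>0: "\<pi> f = \<zero>\<^bsub>A\<^esub>" if "f \<in> I" for f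
    using that I.a_subset R.a_coset_join2[OF _ I.a_subgroup] by (auto simp: \<pi>I AR FactRing_def)
  have surj: "\<exists>f\<in>carrier R. a = \<pi> f" if "a \<in> carrier A" for a
    using that by (auto simp: AR FactRing_def A_RCOSETS_def' \<pi>I)
  have \<chi>\<pi>: "\<chi> v (\<pi> f) = Poly_Mapping.lookup f (v, [], v)" for v f
  proof -
    have "f \<in> \<pi> f" using I.zero_closed by (force simp: \<pi>I a_r_coset_def')
    then have "(SOME g. g \<in> \<pi> f) \<in> \<pi> f" by (rule someI)
    then obtain h where h: "h \<in> I" "(SOME g. g \<in> \<pi> f) = h + f" by (auto simp: \<pi>I a_r_coset_def')
    then have "(v, [], v) \<notin> Poly_Mapping.keys h" by (auto simp: I_def long_paths_def)
    then show ?thesis using h(2) by (simp add: \<chi>_def lookup_add in_keys_iff)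
  qed
  have \<kappa>R: "\<kappa> c \<in> carrier R" for c unfolding \<kappa>_def R_def by (rule trivial_sum_carrier)
  have \<kappa>m: "path_mult (\<kappa> c) f = Poly_Mapping.map ((*) c) f" "path_mult f (\<kappa> c) = Poly_Mapping.map ((*) c) f"
    if "f \<in> carrier R" for c f
    using path_mult_trivial[of f c] that by (simp_all add: \<kappa>_def R_def)
  have l\<kappa>: "Poly_Mapping.lookup (\<kappa> c) x = (if \<exists>v\<in>verts G. x = (v, [], v) then c else 0)" for c x
  proof (cases "\<exists>v\<in>verts G. x = (v, [], v)")
    case True
    then obtain v where v: "v \<in> verts G" "x = (v, [], v)" by blast
    have "Poly_Mapping.lookup (\<kappa> c) x = (\<Sum>u\<in>verts G. if u = v then c else 0)"
      unfolding \<kappa>_def lookup_sum by (intro sum.cong) (auto simp: v lookup_single when_def)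
    then show ?thesis using v finite_verts by auto
  qed (auto simp: \<kappa>_def lookup_sum lookup_single when_def intro!: sum.neutral)
  have single_R: "Poly_Mapping.single x c \<in> carrier R" if "x \<in> quiver_paths G" for x and c :: 'k
    using that by (simp add: carR)
  have triv: "(v, [], v) \<in> quiver_paths G" if "v \<in> verts G" for v using that trivial_path by simp
  have map_single: "Poly_Mapping.map ((*) c) (Poly_Mapping.single x d) = Poly_Mapping.single x (c * d)"
    for c d :: 'k and x :: "('a, 'b) path"
    by (rule poly_mapping_eqI) (auto simp: Poly_Mapping.map.rep_eq when_def lookup_single)
  show ?thesis
    unfolding \<kappa>_def[symmetric] \<chi>_def[symmetric]
  proof (rule split_rad_square_zero.intro[OF A.ring_axioms], unfold_locales)
    show "finite (verts G)" by simp
    show "\<pi> (\<kappa> c) \<in> carrier A" for c by (rule \<pi>c[OF \<kappa>R])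
    show "\<pi> (\<kappa> (c + d)) = \<pi> (\<kappa> c) \<oplus>\<^bsub>A\<^esub> \<pi> (\<kappa> d)" for c d
    proof -
      have "\<kappa> (c + d) = \<kappa> c + \<kappa> d" by (simp add: \<kappa>_def single_add sum.distrib)
      then show ?thesis using \<pi>a[OF \<kappa>R \<kappa>R] by simp
    qed
    show "\<pi> (\<kappa> (c * d)) = \<pi> (\<kappa> c) \<otimes>\<^bsub>A\<^esub> \<pi> (\<kappa> d)" for c d
    proof -
      have "path_mult (\<kappa> c) (\<kappa> d) = \<kappa> (c * d)"
        unfolding \<kappa>m(1)[OF \<kappa>R] by (rule poly_mapping_eqI) (auto simp: Poly_Mapping.map.rep_eq when_def l\<kappa>)
      then show ?thesis using \<pi>m[OF \<kappa>R \<kappa>R] by metis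
    qed
    show "\<pi> (\<kappa> 1) = \<one>\<^bsub>A\<^esub>" using \<pi>1 by (simp add: \<kappa>_def)
    show "\<pi> (\<kappa> c) \<otimes>\<^bsub>A\<^esub> a = a \<otimes>\<^bsub>A\<^esub> \<pi> (\<kappa> c)" if "a \<in> carrier A" for a c
    proof -
      obtain f where f: "f \<in> carrier R" "a = \<pi> f" using surj[OF \<open>a \<in> carrier A\<close>] by blast
      show ?thesis unfolding f(2) \<pi>m[OF \<kappa>R f(1), symmetric] \<pi>m[OF f(1) \<kappa>R, symmetric] \<kappa>m[OF f(1)] ..
    qed
    show "\<pi> (Poly_Mapping.single (v, [], v) 1) \<in> carrier A" if "v \<in> verts G" for v
      by (rule \<pi>c[OF single_R[OF triv[OF that]]])
    show "\<pi> (Poly_Mapping.single (u, [], u) 1) \<otimes>\<^bsub>A\<^esub> \<pi> (Poly_Mapping.single (v, [], v) 1) =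
        (if u = v then \<pi> (Poly_Mapping.single (u, [], u) 1) else \<zero>\<^bsub>A\<^esub>)" if "u \<in> verts G" "v \<in> verts G" for u v
      unfolding \<pi>m[OF single_R[OF triv[OF that(1)]] single_R[OF triv[OF that(2)]], symmetric]
      using \<pi>0[OF I.zero_closed] by (simp add: path_mult_single path_term_def)
    show "(\<Oplus>\<^bsub>A\<^esub>v\<in>verts G. \<pi> (Poly_Mapping.single (v, [], v) 1)) = \<one>\<^bsub>A\<^esub>"
    proof -
      have "finite F \<Longrightarrow> F \<subseteq> verts G \<Longrightarrow> (\<Sum>v\<in>F. Poly_Mapping.single (v, [], v) 1) \<in> carrier R \<and>
        (\<Oplus>\<^bsub>A\<^esub>v\<in>F. \<pi> (Poly_Mapping.single (v, [], v) 1)) = \<pi> (\<Sum>v\<in>F. Poly_Mapping.single (v, [], v) 1)" for F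
      proof (induct F rule: finite_induct)
        case empty
        show ?case using \<pi>0[OF I.zero_closed] R.zero_closed by simp
      next
        case (insert v F)
        have v: "Poly_Mapping.single (v, [], v) 1 \<in> carrier R" using insert by (intro single_R triv) auto
        have "(\<lambda>v. \<pi> (Poly_Mapping.single (v, [], v) 1)) \<in> F \<rightarrow> carrier A"
          using insert by (auto intro!: \<pi>c single_R triv)
        then show ?case
          using insert v \<pi>c[OF v] \<pi>a[OF v] R.a_closed[OF v] by (simp add: A.finsum_insert)
      qed
      from this[OF finite_verts subset_refl] show ?thesis using \<pi>1 by simp
    qed
    show "\<chi> v (a \<oplus>\<^bsub>A\<^esub> b) = \<chi> v a + \<chi> v b" if "a \<in> carrier A" "b \<in> carrier A" for v a b
    proof -
      obtain f g where fg: "f \<in> carrier R" "a = \<pi> f" "g \<in> carrier R" "b = \<pi> g" using surj[OF \<open>a \<in> carrier A\<close>] surj[OF \<open>b \<in> carrier A\<close>] by blast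
      show ?thesis unfolding fg(2,4) \<pi>a[OF fg(1,3), symmetric] \<chi>\<pi> by (rule lookup_add)
    qed
    show "\<chi> v (a \<otimes>\<^bsub>A\<^esub> b) = \<chi> v a * \<chi> v b" if v: "v \<in> verts G" and ab: "a \<in> carrier A" "b \<in> carrier A" for v a b
    proof -
      obtain f g where fg: "f \<in> carrier R" "a = \<pi> f" "g \<in> carrier R" "b = \<pi> g" using surj[OF ab(1)] surj[OF ab(2)] by blast
      let ?e = "(v, [], v) :: ('a, 'b) path"
      let ?F = "insert ?e (Poly_Mapping.keys f)" and ?H = "insert ?e (Poly_Mapping.keys g)"
      \<comment> \<open>Only the trivial path times itself produces the trivial path, so its
        coefficient is multiplicative.\<close>
      have t: "Poly_Mapping.lookup (path_term x y c) ?e = (if y = ?e then if x = ?e then c else 0 else 0)"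
        if "x \<in> ?F" "y \<in> ?H" for x y and c :: 'k
      proof -
        have "x \<in> quiver_paths G" "y \<in> quiver_paths G" using that fg triv[OF v] by (auto simp: carR)
        then show ?thesis
          by (cases x; cases y) (auto simp: path_term_def lookup_single when_def trivial_path)
      qed
      have "Poly_Mapping.lookup (path_mult f g) ?e =
        (\<Sum>x\<in>?F. \<Sum>y\<in>?H. if y = ?e then if x = ?e then Poly_Mapping.lookup f x * Poly_Mapping.lookup g y else 0 else 0)"
        unfolding path_mult_superset[of ?F f ?H g, OF _ subset_insertI _ subset_insertI, simplified] lookup_sum
        by (intro sum.cong refl t) auto
      also have "\<dots> = (\<Sum>x\<in>?F. if x = ?e then Poly_Mapping.lookup f x * Poly_Mapping.lookup g ?e else 0)"
        by (intro sum.cong refl, subst sum.delta) auto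
      also have "\<dots> = Poly_Mapping.lookup f ?e * Poly_Mapping.lookup g ?e"
        by (subst sum.delta) auto
      finally show ?thesis unfolding fg(2,4) \<pi>m[OF fg(1,3), symmetric] \<chi>\<pi> .
    qed
    show "\<chi> v (\<pi> (\<kappa> c)) = c" if "v \<in> verts G" for v c using that by (simp add: \<chi>\<pi> l\<kappa>)
    show "\<chi> u (\<pi> (Poly_Mapping.single (v, [], v) 1)) = (if u = v then 1 else 0)" for u v
      by (auto simp: \<chi>\<pi> lookup_single when_def)
    show "a \<otimes>\<^bsub>A\<^esub> b = \<zero>\<^bsub>A\<^esub>" if ab: "a \<in> carrier A" "b \<in> carrier A"
      and z: "\<And>v. v \<in> verts G \<Longrightarrow> \<chi> v a = 0" "\<And>v. v \<in> verts G \<Longrightarrow> \<chi> v b = 0" for a b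
    proof -
      obtain f g where fg: "f \<in> carrier R" "a = \<pi> f" "g \<in> carrier R" "b = \<pi> g" using surj[OF ab(1)] surj[OF ab(2)] by blast
      \<comment> \<open>When all characters vanish, no trivial path is in the support; two such
        representatives multiply into the ideal.\<close>
      have long: "h \<in> long_paths G 1" if h: "h \<in> carrier R" "\<And>v. v \<in> verts G \<Longrightarrow> \<chi> v (\<pi> h) = 0" for h
      proof -
        have "1 \<le> length p" if "(u, p, v) \<in> Poly_Mapping.keys h" for u p v
        proof (rule ccontr)
          assume "\<not> 1 \<le> length p"
          then have "p = []" by (cases p) auto
          moreover from this have "u = v" "v \<in> verts G" using that h(1) trivial_path by (auto simp: carR)
          ultimately show False using that h(2) by (simp add: \<chi>\<pi> in_keys_iff)
        qed
        then show ?thesis using h(1) by (auto simp: long_paths_def carR)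
      qed
      have "f \<in> long_paths G 1" "g \<in> long_paths G 1" using fg z long by auto
      then have "path_mult f g \<in> I" using long_paths_mult[of f 1 g 1] by (simp add: I_def numeral_2_eq_2)
      then show ?thesis unfolding fg(2,4) \<pi>m[OF fg(1,3), symmetric] by (rule \<pi>0)
    qed
    \<comment> \<open>The trivial paths and the arrows span the quotient, as all longer paths become
      zero.\<close>
    let ?P = "(\<lambda>v. (v, [], v)) ` verts G \<union> (\<lambda>e. (tail G e, [e], head G e)) ` arcs G"
    have P: "?P \<subseteq> quiver_paths G"
      using triv arc_implies_awalk by (auto simp: quiver_paths_def)
    let ?B = "(\<lambda>x. \<pi> (Poly_Mapping.single x 1)) ` ?P"
    show "\<exists>B. finite B \<and> B \<subseteq> carrier A \<and> (\<forall>X. B \<subseteq> X \<and> \<zero>\<^bsub>A\<^esub> \<in> X \<and> (\<forall>x\<in>X. \<forall>y\<in>X. x \<oplus>\<^bsub>A\<^esub> y \<in> X) \<and>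
        (\<forall>x\<in>X. \<forall>c. x \<otimes>\<^bsub>A\<^esub> \<pi> (\<kappa> c) \<in> X) \<longrightarrow> carrier A \<subseteq> X)"
    proof (intro exI[of _ ?B] conjI allI impI)
      show "finite ?B" by simp
      show "?B \<subseteq> carrier A" using P by (auto intro!: \<pi>c single_R)
      fix X assume X: "?B \<subseteq> X \<and> \<zero>\<^bsub>A\<^esub> \<in> X \<and> (\<forall>x\<in>X. \<forall>y\<in>X. x \<oplus>\<^bsub>A\<^esub> y \<in> X) \<and> (\<forall>x\<in>X. \<forall>c. x \<otimes>\<^bsub>A\<^esub> \<pi> (\<kappa> c) \<in> X)"
      have "f \<in> carrier R \<and> \<pi> f \<in> X" if "f \<in> carrier R" for f
      proof (rule poly_mapping_additive_induct)
        show "Poly_Mapping.keys f \<subseteq> quiver_paths G" using that by (simp add: carR)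
        show "0 \<in> carrier R \<and> \<pi> 0 \<in> X" using X \<pi>0[OF I.zero_closed] R.zero_closed by simp
        show "f + g \<in> carrier R \<and> \<pi> (f + g) \<in> X" if "f \<in> carrier R \<and> \<pi> f \<in> X" "g \<in> carrier R \<and> \<pi> g \<in> X" for f g
          using that X \<pi>a[of f g] R.a_closed[of f g] by simp
        fix x and c :: 'k assume x: "x \<in> quiver_paths G"
        have "\<pi> (Poly_Mapping.single x c) \<in> X"
        proof (cases "x \<in> ?P")
          case True
          then have "\<pi> (Poly_Mapping.single x 1) \<otimes>\<^bsub>A\<^esub> \<pi> (\<kappa> c) \<in> X" using X by blast
          then show ?thesis
            unfolding \<pi>m[OF single_R[OF x] \<kappa>R, symmetric] \<kappa>m(2)[OF single_R[OF x]] by (simp add: map_single)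
        next
          case False
          obtain u p w where x': "x = (u, p, w)" by (cases x)
          have "2 \<le> length p"
          proof (rule ccontr)
            assume "\<not> 2 \<le> length p"
            then consider "p = []" | e where "p = [e]" by (cases p; cases "tl p") auto
            then show False
            proof cases
              case 1
              then show False using x False trivial_path by (auto simp: x')
            next
              case 2
              then show False using x False by (auto simp: x' quiver_paths_def awalk_simps)
            qed
          qed
          then have "Poly_Mapping.single x c \<in> I" using x by (simp add: I_def long_paths_def x')
          then show ?thesis using \<pi>0 X by simp
        qed
        then show "Poly_Mapping.single x c \<in> carrier R \<and> \<pi> (Poly_Mapping.single x c) \<in> X"
          using single_R[OF x] by blast
      qed
      then show "carrier A \<subseteq> X" using surj by blast
    qed
  qed
qed

end

theorem corollary4p17:
  fixes Q :: "('v, 'e) pre_digraph"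
    and A :: "(('v, 'e) path \<Rightarrow>\<^sub>0 'k::field) set ring"
    and n :: nat
  assumes "fin_digraph Q"
    and "Digraph_Component.connected Q"
    and "card (verts Q) = n"
    and "A = radical_square_zero_algebra Q"
  shows "phi_dim A \<le> enat n"
proof -
  interpret fin_digraph Q by fact
  \<comment> \<open>Connectedness of a digraph includes the existence of a vertex.\<close>
  have "verts Q \<noteq> {}" using assms(2) by (auto simp: connected_def strongly_connected_def)
  then show ?thesis
    using split_rad_square_zero.phi_dim_le_card[OF radical_square_zero_split[OF assms(4)]] assms(3) by simp
qed

end
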